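(* Let $m\ge 3$ be an integer and let $U_1,U_2,\ldots$ be independent points uniformly distributed on the unit circumference $\mathbb{S}$. For $n\ge m$ let $$\mathcal{A}_n^m=\max_{1\le i_1<\ldots<i_m\le n}\mathcal{A}_m(U_{i_1},\ldots,U_{i_m})$$ be the maximal area among the areas of all convex $m$-polygons with vertices $U_{i_1},\ldots,U_{i_m}$. Then for each $t>0$ $$\lim_{n\to\infty}P\left\{n^{\frac{2m}{m-1}}\left(\frac m2\sin\frac{2\pi}{m}-\mathcal{A}_n^m\right)\le t\right\}=1-\exp\left\{-\frac{t^{\frac{m-1}{2}}}{K_{2m}}\right\},$$ where $$K_{2m}=m^{\frac32}\left(\pi\sin\frac{2\pi}{m}\right)^{\frac{m-1}{2}}\Gamma\left(\frac{m+1}{2}\right).$$ The rate of convergence is $O\left(n^{-\frac{1}{m-1}}\right)$; that is, for each fixed $t>0$ the absolute difference between the probability on the left and its limit is $O\left(n^{-\frac{1}{m-1}}\right)$ as $n\to\infty$.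
   Context: The unit circumference $\mathbb{S}$ is the circle of radius $1$ in the plane. For $m$ distinct points $u_1,\ldots,u_m\in\mathbb{S}$, $\mathcal{A}_m(u_1,\ldots,u_m)$ denotes the area of the convex $m$-polygon inscribed in the circle whose vertex set is $\{u_1,\ldots,u_m\}$. The points are almost surely distinct. $\Gamma$ is Euler's gamma function. Here $m$ is fixed as $n\to\infty$. *)

theory Defs
  imports "HOL-Probability.Probability" "HOL-Library.Landau_Symbols"
begin

text \<open>The plane is modelled by the complex numbers, so that the unit circumference is
  \<^term>\<open>sphere (0::complex) 1\<close>. Its uniform distribution is the law of the point whose
  polar angle is uniformly distributed on an interval of length \<open>2\<pi>\<close>.\<close>

definition uniform_circle :: "complex measure" where
  "uniform_circle = distr (uniform_measure lborel {0..<2 * pi}) borel cis"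

text \<open>Distinct points on the circle are in convex position, so the convex polygon with
  vertex set \<open>V\<close> is the convex hull of \<open>V\<close>.\<close>

definition polygon_area :: "complex set \<Rightarrow> real" where
  "polygon_area V = measure lebesgue (convex hull V)"

text \<open>The index tuples \<open>1 \<le> i\<^sub>1 < \<dots> < i\<^sub>m \<le> n\<close> are represented by the \<open>m\<close>-element
  subsets \<open>I\<close> of \<open>{1..n}\<close>. The value is meaningful only for \<open>m \<le> n\<close>, as otherwise the
  maximum is taken over the empty set.\<close>

definition max_polygon_area :: "nat \<Rightarrow> nat \<Rightarrow> (nat \<Rightarrow> complex) \<Rightarrow> real" where
  "max_polygon_area m n u = Max ((\<lambda>I. polygon_area (u ` I)) ` {I. I \<subseteq> {1..n} \<and> card I = m})"

definition K_const :: "nat \<Rightarrow> real" where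
  "K_const m = real m powr (3 / 2) * (pi * sin (2 * pi / real m)) powr ((real m - 1) / 2)
                 * Gamma ((real m + 1) / 2)"

end

theory Submission
  imports Defs
begin

text \<open>Write an inscribed \<open>m\<close>-gon through its central angles \<open>g\<^sub>1, \<dots>, g\<^sub>m\<close>, so that its area is
  \<open>(\<Sum> sin g\<^sub>j) / 2\<close>. Its deficit from the regular \<open>m\<close>-gon is globally bounded below by a multiple of
  \<open>Q = \<Sum> (g\<^sub>j - 2\<pi>/m)\<^sup>2\<close> and equals \<open>sin (2\<pi>/m) Q / 4 + O(Q\<^bsup>3/2\<^esup>)\<close>. After fixing one vertex, the set
  \<open>Q \<le> c\<close> is a union of \<open>(m-1)!\<close> disjoint congruent ellipsoids, whence the probability \<open>p\<close> that \<open>m\<close> random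
  points have deficit at most \<open>\<delta>\<^sup>2\<close> is \<open>\<kappa> \<delta>\<^bsup>m-1\<^esup> (1 + O(\<delta>))\<close>. The number of such \<open>m\<close>-subsets of
  the sample is a sum of dissociated indicators, and the Chen--Stein method compares the probability that it
  vanishes with \<open>exp (- (n choose m) p)\<close>. If two overlapping subsets are both nearly maximal, then
  the \<open>m\<close>-th powers of all their points are within \<open>O(\<delta>)\<close> of each other, so a pair with union of size
  \<open>r\<close> contributes \<open>O(\<delta>\<^bsup>r-1\<^esup>)\<close>. With \<open>\<delta> = sqrt t * n powr (- m/(m-1))\<close> the worst case \<open>r = m + 1\<close>
  gives the rate.\<close>

section \<open>Area of inscribed polygons\<close>

text \<open>The cubic expansion of the deficit is informative only where \<open>Q\<close> is small,
  and the global lower bound is what forces this: a deficit of at most \<open>\<delta>^2\<close>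
  implies \<open>Q = O(\<delta>^2)\<close>, so the error \<open>O(Q^(3/2))\<close> becomes a
  relative error \<open>O(\<delta>)\<close>. The m-th power is used because it sends all vertices of
  a regular m-gon to one point: two overlapping polygons can be compared through one shared vertex
  without matching their other vertices, and each of the remaining \<open>r - 1\<close> points costs
  a factor \<open>O(\<delta>)\<close>. Put \<open>y = n powr (- 1 / (m - 1))\<close>, so that
  \<open>\<delta> = sqrt t * y ^ m\<close> and \<open>n * \<delta> = sqrt t * y\<close>. Then
  \<open>n ^ m * \<delta> ^ (m - 1)\<close> is exactly \<open>t powr ((m - 1) / 2)\<close>, the
  source of the limit, while the pairs with union of size \<open>r\<close> add up to
  \<open>O(n * y ^ (r - 1)) = O(y ^ (r - m))\<close>. Size \<open>r = m\<close> occurs only for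
  equal subsets, which enter the Poisson bound through products of probabilities alone. The other
  errors, \<open>O(1 / n)\<close> from the binomial coefficient and \<open>O(\<delta>)\<close> from
  the volume, are of no larger order.\<close>

lemma distr_lborel_vec2_complex:
  "distr lborel borel (\<lambda>v::real^2. Complex (v $ 1) (v $ 2)) = (lborel :: complex measure)"
proof (rule lborel_eqI [symmetric])
  fix l u :: complex
  assume lu: "\<And>b. b \<in> Basis \<Longrightarrow> l \<bullet> b \<le> u \<bullet> b"
  have meas: "(\<lambda>v::real^2. Complex (v $ 1) (v $ 2)) \<in> borel_measurable borel"
    by (intro borel_measurable_continuous_onI continuous_intros)
  have vimage: "(\<lambda>v::real^2. Complex (v $ 1) (v $ 2)) -` box l u = box (vector [Re l, Im l]) (vector [Re u, Im u])"
    by (auto simp: mem_box_cart in_box_complex_iff forall_2)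
  have "emeasure lborel (box (vector [Re l, Im l]) (vector [Re u, Im u]) :: (real^2) set) = (Re u - Re l) * (Im u - Im l)"
    using lu[of 1] lu[of \<i>] by (subst emeasure_lborel_box)
      (auto simp: Basis_vec_def Basis_complex_def inner_axis UNIV_2 forall_2 axis_eq_axis mult.commute)
  then show "emeasure (distr lborel borel (\<lambda>v::real^2. Complex (v $ 1) (v $ 2))) (box l u) = (\<Prod>b\<in>Basis. (u - l) \<bullet> b)"
    using meas by (simp add: emeasure_distr vimage Basis_complex_def)
qed simp

text \<open>Transported from \<open>content_triangle\<close>, which lives on \<open>real^2\<close>,
  along the measure-preserving coordinate map.\<close>

lemma measure_complex_triangle:
  fixes a b c :: complex
  shows "measure lebesgue (convex hull {a, b, c}) = \<bar>Im (cnj (b - a) * (c - a))\<bar> / 2"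
proof -
  define f where "f = (\<lambda>v::real^2. Complex (v $ 1) (v $ 2))"
  define g :: "complex \<Rightarrow> real^2" where "g z = vector [Re z, Im z]" for z
  have fg: "f (g z) = z" for z by (simp add: f_def g_def complex_eq_iff)
  have lin: "linear f"
    by (intro linearI) (auto simp: f_def complex_eq_iff)
  have meas: "f \<in> borel_measurable borel"
    unfolding f_def by (intro borel_measurable_continuous_onI continuous_intros)
  have inj: "inj f" by (intro injI) (auto simp: f_def vec_eq_iff forall_2)
  have hull: "f ` (convex hull {g a, g b, g c}) = convex hull {a, b, c}"
    using convex_hull_linear_image[OF lin, of "{g a, g b, g c}"] by (simp add: fg)
  have vim: "f -` (convex hull {a, b, c}) = convex hull {g a, g b, g c}"
    unfolding hull[symmetric] by (rule inj_vimage_image_eq[OF inj])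
  have b: "convex hull {a, b, c} \<in> sets borel"
    by (intro borel_closed compact_imp_closed finite_imp_compact_convex_hull) simp
  have "measure lebesgue (convex hull {a, b, c}) = measure lborel (convex hull {a, b, c})"
    using b by simp
  also have "\<dots> = measure (distr lborel borel f) (convex hull {a, b, c})"
    by (simp add: f_def distr_lborel_vec2_complex)
  also have "\<dots> = measure lborel (convex hull {g a, g b, g c})"
    using b meas by (simp add: measure_distr vim)
  also have "\<dots> = \<bar>Im (cnj (b - a) * (c - a))\<bar> / 2"
    by (subst content_triangle) (simp add: g_def algebra_simps)
  finally show ?thesis .
qed

text \<open>After rotation by \<open>- \<mu>\<close> the line is vertical at abscissa
  \<open>cos h\<close>, and the unit disc cuts it at ordinates between \<open>- sin h\<close> and
  \<open>sin h\<close>.\<close>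

lemma disc_Int_chord_line:
  fixes q :: complex
  assumes "norm q \<le> 1" and "q \<bullet> cis \<mu> = cos h" and "sin h \<ge> 0"
  shows "q \<in> closed_segment (cis (\<mu> - h)) (cis (\<mu> + h))"
proof -
  define p where "p = q * cnj (cis \<mu>)"
  have q: "q = p * cis \<mu>" by (simp add: p_def mult.assoc cis_mult cis_cnj)
  have Rep: "Re p = cos h" using assms(2) by (simp add: p_def inner_complex_def algebra_simps)
  have np: "norm p \<le> 1" using assms(1) by (simp add: p_def norm_mult)
  have "(Re p)\<^sup>2 + (Im p)\<^sup>2 \<le> 1"
    using np by (simp add: cmod_def)
  then have "(Im p)\<^sup>2 \<le> (sin h)\<^sup>2" unfolding Rep using sin_cos_squared_add[of h] by linarith
  then have Imp: "\<bar>Im p\<bar> \<le> sin h" using assms(3) abs_le_square_iff by force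
  show ?thesis
  \<comment> \<open>When \<open>sin h = 0\<close> the chord degenerates to a point, and the segment
    parameter \<open>u\<close> of the other case would divide by zero.\<close>
  proof (cases "sin h = 0")
    case True
    then have "Im p = 0" using Imp by simp
    then have "p = cos h" using Rep by (simp add: complex_eq_iff)
    then have "q = cis (\<mu> + h)" using True q by (simp add: complex_eq_iff cos_add sin_add)
    then show ?thesis by simp
  next
    case False
    define u where "u = (1 + Im p / sin h) / 2"
    have pos: "sin h > 0" using False assms(3) by simp
    have u: "0 \<le> u" "u \<le> 1" using Imp pos unfolding u_def abs_le_iff by (auto simp: field_simps)
    have s: "(2 * u - 1) * sin h = Im p" using pos by (simp add: u_def field_simps)
    have "p = (1 - u) *\<^sub>R cis (- h) + u *\<^sub>R cis h"
      using s Rep by (auto simp: complex_eq_iff algebra_simps)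
    then have "p * cis \<mu> = ((1 - u) *\<^sub>R cis (- h) + u *\<^sub>R cis h) * cis \<mu>" by simp
    then have "q = (1 - u) *\<^sub>R (cis (-h) * cis \<mu>) + u *\<^sub>R (cis h * cis \<mu>)"
      unfolding q by (simp only: distrib_right mult_scaleR_left)
    then have "q = (1 - u) *\<^sub>R cis (\<mu> - h) + u *\<^sub>R cis (\<mu> + h)"
      by (simp add: cis_mult add.commute)
    then show ?thesis using u by (auto simp: closed_segment_def)
  qed
qed

text \<open>A segment from \<open>c\<close> to the hull crosses the line through the two marked vertices inside the disc, hence
  between these vertices.\<close>

lemma convex_hull_insert_across_line:
  fixes V :: "complex set"
  assumes V: "V \<noteq> {}" "convex hull V \<subseteq> cball 0 1" and c: "norm c \<le> 1"
    and h: "sin h \<ge> 0" and ab: "cis (\<mu> - h) \<in> V" "cis (\<mu> + h) \<in> V"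
    and le: "\<forall>v\<in>V. cos h \<le> v \<bullet> cis \<mu>" and lc: "c \<bullet> cis \<mu> \<le> cos h"
  shows "convex hull (insert c V) = convex hull V \<union> convex hull {cis (\<mu> - h), cis (\<mu> + h), c}"
    and "convex hull V \<subseteq> {x. cos h \<le> x \<bullet> cis \<mu>}"
    and "convex hull {cis (\<mu> - h), cis (\<mu> + h), c} \<subseteq> {x. x \<bullet> cis \<mu> \<le> cos h}"
proof -
  let ?a = "cis (\<mu> - h)" and ?b = "cis (\<mu> + h)"
  let ?T = "convex hull {?a, ?b, c}"
  show hV: "convex hull V \<subseteq> {x. cos h \<le> x \<bullet> cis \<mu>}"
    using le convex_halfspace_ge[where a = "cis \<mu>" and b = "cos h"]
    by (intro hull_minimal) (auto simp: inner_commute)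
  have on: "?a \<bullet> cis \<mu> = cos h" "?b \<bullet> cis \<mu> = cos h"
    using cos_diff[of "\<mu> - h" \<mu>] cos_diff[of "\<mu> + h" \<mu>] by (simp_all add: inner_complex_def)
  show hT: "?T \<subseteq> {x. x \<bullet> cis \<mu> \<le> cos h}"
    using lc on convex_halfspace_le[where a = "cis \<mu>" and b = "cos h"]
    by (intro hull_minimal) (auto simp: inner_commute)
  show "convex hull (insert c V) = convex hull V \<union> ?T"
  proof
    show "convex hull V \<union> ?T \<subseteq> convex hull (insert c V)"
      using ab by (intro Un_least hull_mono) auto
    show "convex hull (insert c V) \<subseteq> convex hull V \<union> ?T"
    proof
      fix x assume "x \<in> convex hull (insert c V)"
      then obtain y where y: "y \<in> convex hull V" and x: "x \<in> closed_segment c y"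
        using V(1) by (auto simp: convex_hull_insert_segments)
      have "connected (closed_segment c y)" by simp
      then obtain q where q: "q \<in> closed_segment c y" "cis \<mu> \<bullet> q = cos h"
        using connected_ivt_hyperplane[of "closed_segment c y" c y "cis \<mu>" "cos h"] lc hV y
        by (auto simp: inner_commute)
      have "closed_segment c y \<subseteq> cball 0 1"
        using y V c by (intro closed_segment_subset) auto
      then have nq: "norm q \<le> 1" using q by auto
      have qab: "q \<in> closed_segment ?a ?b"
        using disc_Int_chord_line[OF nq _ h, of \<mu>] q by (simp add: inner_commute)
      have "closed_segment ?a ?b \<subseteq> convex hull V"
        using ab by (intro closed_segment_subset hull_inc convex_convex_hull) auto
      then have qV: "q \<in> convex hull V" using qab by blast
      have "closed_segment ?a ?b \<subseteq> ?T"
        by (intro closed_segment_subset hull_inc convex_convex_hull) auto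
      then have qT: "q \<in> ?T" using qab by blast
      have "x \<in> closed_segment c q \<or> x \<in> closed_segment q y"
        using x q(1) Un_closed_segment by blast
      then show "x \<in> convex hull V \<union> ?T"
      proof
        assume "x \<in> closed_segment c q"
        moreover have "closed_segment c q \<subseteq> ?T"
          using qT by (intro closed_segment_subset) (auto intro: hull_inc)
        ultimately show ?thesis by auto
      next
        assume "x \<in> closed_segment q y"
        moreover have "closed_segment q y \<subseteq> convex hull V"
          using qV y by (intro closed_segment_subset) auto
        ultimately show ?thesis by auto
      qed
    qed
  qed
qed

text \<open>Induction on the number of vertices: a new last vertex lies beyond the chord joining the
  first vertex to the previous last one, so the polygon grows by one triangle on that chord. The
  inequalities between angles are weak, so repeated points are covered.\<close>

lemma polygon_area_cis_sorted:
  assumes "\<And>i. i < k \<Longrightarrow> \<phi> i \<le> \<phi> (Suc i)" and "\<phi> k \<le> \<phi> 0 + 2 * pi"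
  shows "polygon_area ((\<lambda>i. cis (\<phi> i)) ` {..k}) =
     ((\<Sum>i<k. sin (\<phi> (Suc i) - \<phi> i)) + sin (\<phi> 0 - \<phi> k)) / 2"
  using assms
proof (induction k)
  case 0
  then show ?case by (simp add: polygon_area_def)
next
  case (Suc k)
  have mono: "\<phi> i \<le> \<phi> j" if "i \<le> j" "j \<le> Suc k" for i j
    using that(1,2)
  proof (induction rule: dec_induct)
    case (step n) then show ?case using Suc.prems(1)[of n] by simp
  qed simp
  define V where "V = (\<lambda>i. cis (\<phi> i)) ` {..k}"
  define c where "c = cis (\<phi> (Suc k))"
  \<comment> \<open>Mid-direction and half-width of the arc from \<open>\<phi> 0\<close> to
    \<open>\<phi> k\<close>: the chord of this arc lies on the line
    \<open>x \<bullet> cis \<mu> = cos h\<close>.\<close>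
  define \<mu> where "\<mu> = (\<phi> 0 + \<phi> k) / 2"
  define h where "h = (\<phi> k - \<phi> 0) / 2"
  have mh: "\<mu> - h = \<phi> 0" "\<mu> + h = \<phi> k" by (simp_all add: \<mu>_def h_def field_simps)
  have k1: "\<phi> k \<le> \<phi> (Suc k)" and k0: "\<phi> 0 \<le> \<phi> k" using mono by auto
  have h: "0 \<le> h" "h \<le> pi" using k0 k1 Suc.prems(2) by (auto simp: h_def)
  have ins: "(\<lambda>i. cis (\<phi> i)) ` {..Suc k} = insert c V" by (auto simp: V_def c_def atMost_Suc)
  have finV: "finite V" by (simp add: V_def)
  have le: "cos h \<le> v \<bullet> cis \<mu>" if "v \<in> V" for v
  proof -
    from that obtain i where i: "i \<le> k" "v = cis (\<phi> i)" by (auto simp: V_def)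
    have "\<phi> 0 \<le> \<phi> i" "\<phi> i \<le> \<phi> k" using mono i by auto
    then have "\<bar>\<phi> i - \<mu>\<bar> \<le> h" by (auto simp: \<mu>_def h_def abs_le_iff field_simps)
    then have "cos h \<le> cos \<bar>\<phi> i - \<mu>\<bar>" using h by (intro cos_monotone_0_pi_le) auto
    then show ?thesis by (simp add: i inner_complex_def cos_diff)
  qed
  have lc: "c \<bullet> cis \<mu> \<le> cos h"
  proof -
    have "h \<le> \<phi> (Suc k) - \<mu>" "\<phi> (Suc k) - \<mu> \<le> 2 * pi - h"
      using k1 Suc.prems(2) by (auto simp: \<mu>_def h_def field_simps)
    moreover have "cos x \<le> cos h" if "h \<le> x" "x \<le> 2 * pi - h" for x
    proof (cases "x \<le> pi")
      case True then show ?thesis using that h by (intro cos_monotone_0_pi_le) auto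
    next
      case False
      then have "cos (2 * pi - x) \<le> cos h" using that h by (intro cos_monotone_0_pi_le) auto
      then show ?thesis by simp
    qed
    ultimately have "cos (\<phi> (Suc k) - \<mu>) \<le> cos h" by blast
    then show ?thesis by (simp add: c_def inner_complex_def cos_diff)
  qed
  have Vball: "convex hull V \<subseteq> cball 0 1"
    by (intro hull_minimal) (auto simp: V_def)
  have ab: "cis (\<mu> - h) \<in> V" "cis (\<mu> + h) \<in> V" by (auto simp: V_def mh)
  have V0: "V \<noteq> {}" using ab by auto
  have c1: "norm c \<le> 1" by (simp add: c_def)
  have sh: "sin h \<ge> 0" using h by (intro sin_ge_zero) auto
  have "\<forall>v\<in>V. cos h \<le> v \<bullet> cis \<mu>" using le by blast
  note hull = convex_hull_insert_across_line[OF V0 Vball c1 sh ab this lc, unfolded mh]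
  let ?T = "convex hull {cis (\<phi> 0), cis (\<phi> k), c}"
  have fm: "convex hull V \<in> fmeasurable lebesgue" "?T \<in> fmeasurable lebesgue"
    using finV by (auto intro!: lmeasurable_compact finite_imp_compact_convex_hull)
  \<comment> \<open>The old polygon and the new triangle lie on opposite sides of the chord line, so
    they overlap in a null set and their areas add.\<close>
  have "negligible {x. cis \<mu> \<bullet> x = cos h}"
    by (intro negligible_hyperplane) simp
  then have "AE x in lebesgue. x \<notin> {x. cis \<mu> \<bullet> x = cos h}"
    by (intro AE_not_in) (simp add: negligible_iff_null_sets)
  then have ae: "AE x in lebesgue. x \<notin> convex hull V \<or> x \<notin> ?T"
    by eventually_elim (use hull(2,3) in \<open>force simp: inner_commute\<close>)
  have "polygon_area (insert c V) = polygon_area V + measure lebesgue ?T"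
    unfolding polygon_area_def hull(1) by (rule measure_Un_AE[OF ae fm])
  also have "measure lebesgue ?T = (sin (\<phi> k - \<phi> 0) + sin (\<phi> (Suc k) - \<phi> k) + sin (\<phi> 0 - \<phi> (Suc k))) / 2"
  proof -
    define x where "x = (\<phi> k - \<phi> 0) / 2"
    define y where "y = (\<phi> (Suc k) - \<phi> k) / 2"
    have xy: "0 \<le> x" "0 \<le> y" "x + y \<le> pi" using k0 k1 Suc.prems(2) by (auto simp: x_def y_def field_simps)
    \<comment> \<open>The product form shows that the signed area is nonnegative, which removes the
      absolute value from the triangle formula.\<close>
    have A: "sin (2 * x) + sin (2 * y) + sin (- (2 * (x + y))) = 4 * sin x * sin y * sin (x + y)"
    proof -
      have 1: "sin (2 * x) + sin (2 * y) = 2 * sin (x + y) * cos (x - y)"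
      proof -
        have "sin (2 * x) = sin ((x + y) + (x - y))" "sin (2 * y) = sin ((x + y) - (x - y))" by simp_all
        then show ?thesis unfolding sin_add[of "x + y"] sin_diff[of "x + y"] by simp
      qed
      have 2: "cos (x - y) - cos (x + y) = 2 * sin x * sin y" by (simp add: cos_add cos_diff)
      have "sin (2 * x) + sin (2 * y) + sin (- (2 * (x + y))) = 2 * sin (x + y) * (cos (x - y) - cos (x + y))"
        unfolding 1 sin_minus sin_double[of "x + y"] by (simp add: algebra_simps)
      then show ?thesis unfolding 2 by simp
    qed
    have d: "2 * x = \<phi> k - \<phi> 0" "2 * y = \<phi> (Suc k) - \<phi> k" "- (2 * (x + y)) = \<phi> 0 - \<phi> (Suc k)"
      by (simp_all add: x_def y_def field_simps)
    have nn: "4 * sin x * sin y * sin (x + y) \<ge> 0"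
      using xy by (intro mult_nonneg_nonneg sin_ge_zero) auto
    have "Im (cnj (cis (\<phi> k) - cis (\<phi> 0)) * (c - cis (\<phi> 0))) =
       sin (\<phi> k - \<phi> 0) + sin (\<phi> (Suc k) - \<phi> k) + sin (\<phi> 0 - \<phi> (Suc k))"
      by (simp add: c_def sin_diff algebra_simps)
    then show ?thesis
      unfolding measure_complex_triangle using A nn unfolding d by simp
  qed
  also have "polygon_area V = ((\<Sum>i<k. sin (\<phi> (Suc i) - \<phi> i)) + sin (\<phi> 0 - \<phi> k)) / 2"
    unfolding V_def
  proof (rule Suc.IH)
    show "\<phi> k \<le> \<phi> 0 + 2 * pi" using Suc.prems(2) k1 by linarith
  qed (simp add: Suc.prems(1))
  finally show ?case
    unfolding ins sum.lessThan_Suc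
    using sin_minus[of "\<phi> k - \<phi> 0", unfolded minus_diff_eq] by argo
qed

text \<open>Strict separation of a point from finitely many points is an open condition on the
  direction, so directions from a dense set suffice. With a countable \<open>D\<close> the hull
  condition becomes jointly measurable in the point and the vertices.\<close>

lemma mem_convex_hull_finite_iff_dense:
  fixes f :: "'i \<Rightarrow> 'a::euclidean_space"
  assumes I: "finite I" and D: "\<And>X. open X \<Longrightarrow> X \<noteq> {} \<Longrightarrow> \<exists>d\<in>D. d \<in> X"
  shows "x \<in> convex hull (f ` I) \<longleftrightarrow> (\<forall>d\<in>D. \<exists>i\<in>I. d \<bullet> x \<le> d \<bullet> f i)"
proof
  assume x: "x \<in> convex hull (f ` I)"
  show "\<forall>d\<in>D. \<exists>i\<in>I. d \<bullet> x \<le> d \<bullet> f i"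
  proof (rule ccontr)
    assume "\<not> ?thesis"
    then obtain d where d: "\<forall>i\<in>I. d \<bullet> f i < d \<bullet> x" by (auto simp: not_le)
    have "convex hull (f ` I) \<subseteq> {y. d \<bullet> y < d \<bullet> x}"
      using d convex_halfspace_lt[where a = d and b = "d \<bullet> x"] by (intro hull_minimal) auto
    with x show False by auto
  qed
next
  assume *: "\<forall>d\<in>D. \<exists>i\<in>I. d \<bullet> x \<le> d \<bullet> f i"
  show "x \<in> convex hull (f ` I)"
  proof (rule ccontr)
    assume x: "x \<notin> convex hull (f ` I)"
    have "closed (convex hull (f ` I))"
      using I by (intro compact_imp_closed finite_imp_compact_convex_hull) simp
    then obtain a b where ab: "a \<bullet> x < b" "\<forall>y\<in>convex hull (f ` I). b < a \<bullet> y"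
      using separating_hyperplane_closed_point[OF convex_convex_hull _ x] by blast
    \<comment> \<open>All directions that separate \<open>x\<close> strictly from every
      \<open>f i\<close>; the set is open because \<open>I\<close> is finite, and it contains
      \<open>- a\<close>.\<close>
    define X where "X = (\<Inter>i\<in>I. {d. (f i - x) \<bullet> d < 0})"
    have "open X"
      unfolding X_def using I by (intro open_INT) (auto intro: open_halfspace_lt)
    moreover have "- a \<in> X"
    proof -
      have "a \<bullet> x < a \<bullet> f i" if "i \<in> I" for i
        using ab that hull_inc[of "f i" "f ` I" convex] by force
      then show ?thesis by (auto simp: X_def inner_diff inner_commute[of a])
    qed
    ultimately obtain d where "d \<in> D" "d \<in> X" using D by blast
    with * show False by (force simp: X_def inner_diff inner_commute[of d])
  qed
qed

text \<open>The area is the measure of a section of \<open>H\<close>, the set of pairs consisting of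
  a configuration and a point of its hull, so measurability of sections applies.\<close>

lemma borel_measurable_polygon_area [measurable]:
  assumes I: "finite I" "I \<subseteq> K"
  shows "(\<lambda>u. polygon_area (u ` I)) \<in> borel_measurable (Pi\<^sub>M K (\<lambda>_. borel))"
proof -
  obtain D :: "complex set" where D: "countable D" "\<And>X. open X \<Longrightarrow> X \<noteq> {} \<Longrightarrow> \<exists>d\<in>D. d \<in> X"
    by (rule countable_dense_setE) blast
  let ?N = "Pi\<^sub>M K (\<lambda>_. borel :: complex measure)"
  define H where "H = {p \<in> space (?N \<Otimes>\<^sub>M lborel). \<forall>d\<in>D. \<exists>i\<in>I. d \<bullet> snd p \<le> d \<bullet> fst p i}"
  have [measurable]: "(\<lambda>p. fst p i) \<in> borel_measurable (?N \<Otimes>\<^sub>M lborel)" if "i \<in> I" for i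
    using that I by (intro measurable_compose[OF measurable_fst measurable_component_singleton]) auto
  have H: "H \<in> sets (?N \<Otimes>\<^sub>M lborel)"
    unfolding H_def
  proof (intro sets.sets_Collect_countable_All' sets.sets_Collect_finite_Ex)
    fix d i assume "i \<in> I"
    then show "{p \<in> space (?N \<Otimes>\<^sub>M lborel). d \<bullet> snd p \<le> d \<bullet> fst p i} \<in> sets (?N \<Otimes>\<^sub>M lborel)"
      by measurable
  qed (use D(1) I(1) in auto)
  have sec: "Pair u -` H = convex hull (u ` I)" if "u \<in> space ?N" for u
    using that unfolding H_def
    by (auto simp: mem_convex_hull_finite_iff_dense[OF I(1) D(2)] space_pair_measure)
  have "(\<lambda>u. emeasure lborel (Pair u -` H)) \<in> borel_measurable ?N"
    using H by (rule lborel.measurable_emeasure_Pair)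
  then have "(\<lambda>u. enn2real (emeasure lborel (Pair u -` H))) \<in> borel_measurable ?N"
    by measurable
  also have "?this \<longleftrightarrow> ?thesis"
  proof (rule measurable_cong)
    fix u assume u: "u \<in> space ?N"
    have "convex hull (u ` I) \<in> sets borel"
      using I by (intro borel_closed compact_imp_closed finite_imp_compact_convex_hull) auto
    then show "enn2real (emeasure lborel (Pair u -` H)) = polygon_area (u ` I)"
      unfolding sec[OF u] by (simp add: polygon_area_def measure_def)
  qed
  finally show ?thesis .
qed

section \<open>Deficit in terms of the central angles\<close>

lemma sin_le_tangent:
  fixes a g :: real
  assumes "a \<in> {0..pi}" "g \<in> {0..pi}"
  shows "sin g \<le> sin a + (g - a) * cos a"
proof -
  have "- cos a * (g - a) \<le> - sin g - - sin a"
  proof (rule f''_imp_f'[where C = "{0..pi}" and f'' = sin])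
    show "((\<lambda>x. - sin x) has_real_derivative - cos x) (at x)" for x
      by (auto intro!: derivative_eq_intros)
    show "((\<lambda>x. - cos x) has_real_derivative sin x) (at x)" for x
      by (auto intro!: derivative_eq_intros)
  qed (use assms in \<open>auto intro: sin_ge_zero\<close>)
  then show ?thesis by (simp add: algebra_simps)
qed

lemma abs_sin_diff_le: "\<bar>sin x - x\<bar> \<le> \<bar>x\<bar> ^ 3 / (6 :: real)"
proof -
  have "(\<Sum>m<3. sin_coeff m * x ^ m) = x"
    by (simp add: eval_nat_numeral sin_coeff_def)
  then show ?thesis using Maclaurin_sin_bound[of x 3] by (simp add: fact_numeral)
qed

lemma pi_bounds: "3 < pi" "pi < 3.2" "pi\<^sup>2 < 10.24"
proof -
  show *: "3 < pi" "pi < 3.2" using pi_approx by auto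
  show "pi\<^sup>2 < 10.24" using power_strict_mono[of pi "3.2" 2] * by (simp add: power2_eq_square)
qed

text \<open>The constant comes from \<open>(pi / 2)^2 \<le> 2.56\<close> and
  \<open>1 - 2.56 / 6 > 0.57\<close>. What matters in its two uses is that it exceeds
  \<open>1 / 2\<close>.\<close>

lemma sin_ge_linear: "0 \<le> x \<Longrightarrow> x \<le> pi / 2 \<Longrightarrow> 0.57 * x \<le> sin (x :: real)"
proof -
  assume x: "0 \<le> x" "x \<le> pi / 2"
  then have "x\<^sup>2 \<le> (pi / 2)\<^sup>2" by (intro power_mono) auto
  then have "x\<^sup>2 \<le> 2.56" using pi_bounds(3) by (simp add: power_divide)
  then have "x * x\<^sup>2 \<le> x * 2.56" using x by (intro mult_left_mono)
  then have "x ^ 3 / 6 \<le> 0.43 * x" using x by (simp add: power3_eq_cube power2_eq_square)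
  then show ?thesis using abs_sin_diff_le[of x] x by (simp add: abs_if split: if_splits)
qed

lemma cos_ge_quadratic: "\<bar>x\<bar> \<le> pi \<Longrightarrow> x\<^sup>2 / 8 \<le> 1 - cos (x :: real)"
proof -
  assume x: "\<bar>x\<bar> \<le> pi"
  have "\<bar>x\<bar> / 4 \<le> 0.57 * (\<bar>x\<bar> / 2)" by simp
  also have "\<dots> \<le> sin (\<bar>x\<bar> / 2)" using x by (intro sin_ge_linear) auto
  finally have "(\<bar>x\<bar> / 4)\<^sup>2 \<le> (sin (\<bar>x\<bar> / 2))\<^sup>2" by (intro power_mono) auto
  moreover have "cos x = 1 - 2 * (sin (\<bar>x\<bar> / 2))\<^sup>2"
    using cos_double_sin[of "\<bar>x\<bar> / 2"] by simp
  ultimately show ?thesis by (simp add: power_divide)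
qed

text \<open>Strong concavity of sine, obtained at the midpoint:
  \<open>sin a + sin g = 2 * sin mid * cos ((g - a) / 2)\<close>, where \<open>sin mid\<close> lies
  below the tangent at \<open>a\<close> and is at least \<open>sin a / 2\<close>. The factor is
  \<open>2 * (1 / 2) * (1 / 4) * (1 / 8) = 1 / 32\<close>.\<close>

lemma sin_deficit_ge:
  fixes a g :: real
  assumes a: "0 < a" "a < pi" and g: "0 \<le> g" "g \<le> pi"
  shows "sin a / 32 * (g - a)\<^sup>2 \<le> sin a + (g - a) * cos a - sin g"
proof -
  define mid where "mid = (a + g) / 2"
  have mid: "0 \<le> mid" "mid \<le> pi" "a / 2 \<le> mid" "mid - pi / 2 \<le> a / 2"
    using a g by (auto simp: mid_def field_simps)
  have a2: "0 \<le> sin (a/2)" "0 \<le> cos (a/2)" using a by (auto intro: sin_ge_zero cos_ge_zero)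
  have sin_a: "sin a = 2 * sin (a/2) * cos (a/2)" using sin_double[of "a/2"] by simp
  have "sin a / 2 \<le> sin mid"
  proof (cases "mid \<le> pi / 2")
    case True
    have "sin (a / 2) \<le> sin mid" using True mid a by (intro sin_monotone_2pi_le) auto
    moreover have "sin (a/2) * cos (a/2) \<le> sin (a/2) * 1" using a2 by (intro mult_left_mono) auto
    ultimately show ?thesis using sin_a by simp
  next
    case False
    have "cos (a / 2) \<le> cos (mid - pi / 2)" using False mid a by (intro cos_monotone_0_pi_le) auto
    moreover have "cos (mid - pi / 2) = sin mid" by (simp add: cos_diff)
    moreover have "sin (a/2) * cos (a/2) \<le> 1 * cos (a/2)" using a2 by (intro mult_right_mono) auto
    ultimately show ?thesis using sin_a by simp
  qed
  moreover have q: "((g - a) / 2)\<^sup>2 / 8 \<le> 1 - cos ((g - a) / 2)"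
    using a g by (intro cos_ge_quadratic) (simp add: abs_le_iff)
  ultimately have "2 * (sin a / 2) * (((g - a) / 2)\<^sup>2 / 8) \<le> 2 * sin mid * (1 - cos ((g - a) / 2))"
    using a mid(1,2) by (intro mult_mono mult_nonneg_nonneg) (auto intro: sin_ge_zero)
  moreover have "sin a + sin g = 2 * sin mid * cos ((g - a) / 2)"
    using sin_plus_sin[of g a] by (simp add: mid_def add.commute)
  moreover have "sin mid \<le> sin a + (mid - a) * cos a"
    using mid a by (intro sin_le_tangent) auto
  then have "2 * sin mid \<le> 2 * sin a + (g - a) * cos a"
    by (simp add: mid_def field_simps)
  ultimately show ?thesis
    by (simp add: algebra_simps power_divide)
qed

lemma sin_deficit_cubic:
  fixes a x :: real
  shows "\<bar>sin a + x * cos a - sin (a + x) - sin a / 2 * x\<^sup>2\<bar> \<le> \<bar>x\<bar> ^ 3"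
proof -
  have s: "\<bar>sin x - x\<bar> \<le> \<bar>x\<bar> ^ 3 / 6" by (rule abs_sin_diff_le)
  have c: "\<bar>1 - cos x - x\<^sup>2 / 2\<bar> \<le> \<bar>x\<bar> ^ 3 / 6"
  proof -
    have "(\<Sum>m<3. cos_coeff m * x ^ m) = 1 - x\<^sup>2 / 2"
      by (simp add: eval_nat_numeral cos_coeff_def)
    moreover obtain t where "cos x = (\<Sum>m<3. cos_coeff m * x ^ m) + cos (t + 1/2 * real 3 * pi) / fact 3 * x ^ 3"
      using Maclaurin_cos_expansion[of x 3] by auto
    ultimately have "\<bar>1 - cos x - x\<^sup>2 / 2\<bar> = \<bar>cos (t + 1/2 * real 3 * pi)\<bar> * (\<bar>x\<bar> ^ 3 / 6)"
      by (simp add: fact_numeral abs_mult power_abs)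
    also have "\<dots> \<le> 1 * (\<bar>x\<bar> ^ 3 / 6)" by (intro mult_right_mono) auto
    finally show ?thesis by simp
  qed
  have "sin a + x * cos a - sin (a + x) - sin a / 2 * x\<^sup>2 = sin a * (1 - cos x - x\<^sup>2 / 2) - cos a * (sin x - x)"
    by (simp add: sin_add algebra_simps)
  also have "\<bar>\<dots>\<bar> \<le> \<bar>sin a * (1 - cos x - x\<^sup>2 / 2)\<bar> + \<bar>cos a * (sin x - x)\<bar>" by (rule abs_triangle_ineq4)
  also have "\<dots> \<le> 1 * (\<bar>x\<bar> ^ 3 / 6) + 1 * (\<bar>x\<bar> ^ 3 / 6)"
    unfolding abs_mult using s c by (intro add_mono mult_mono) auto
  also have "\<dots> \<le> \<bar>x\<bar> ^ 3" by simp
  finally show ?thesis .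
qed

section \<open>Deficit and quadratic variation of the central angles\<close>

definition gap_deficit :: "nat \<Rightarrow> (nat \<Rightarrow> real) \<Rightarrow> real" where
  "gap_deficit m g = (real m * sin (2 * pi / m) - (\<Sum>j<m. sin (g j))) / 2"

definition gap_variation :: "nat \<Rightarrow> (nat \<Rightarrow> real) \<Rightarrow> real" where
  "gap_variation m g = (\<Sum>j<m. (g j - 2 * pi / m)\<^sup>2)"

text \<open>The tangent terms sum to zero because the gaps add up to \<open>2 * pi\<close>.
  Including them makes every single summand a second-order quantity, so that estimates can be made
  term by term.\<close>

lemma gap_deficit_eq:
  assumes "m > 0" "(\<Sum>j<m. g j) = 2 * pi"
  shows "gap_deficit m g =
    (\<Sum>j<m. sin (2 * pi / m) + (g j - 2 * pi / m) * cos (2 * pi / m) - sin (g j)) / 2"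
proof -
  have "(\<Sum>j<m. (g j - 2 * pi / m) * cos (2 * pi / m)) = ((\<Sum>j<m. g j) - (\<Sum>j<m. 2 * pi / m)) * cos (2 * pi / m)"
    by (simp add: sum_subtractf sum_distrib_right left_diff_distrib)
  also have "\<dots> = 0" using assms by simp
  finally show ?thesis
    by (simp add: gap_deficit_def sum.distrib sum_subtractf)
qed

lemma gap_deficit_cubic:
  assumes "m > 0" "(\<Sum>j<m. g j) = 2 * pi"
  shows "\<bar>gap_deficit m g - sin (2 * pi / m) / 4 * gap_variation m g\<bar>
           \<le> real m * sqrt (gap_variation m g) ^ 3"
proof -
  let ?a = "2 * pi / m" and ?Q = "gap_variation m g"
  define e where "e j = sin ?a + (g j - ?a) * cos ?a - sin (g j) - sin ?a / 2 * (g j - ?a)\<^sup>2" for j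
  have e: "\<bar>e j\<bar> \<le> sqrt ?Q ^ 3" if "j < m" for j
  proof -
    have "(g j - ?a)\<^sup>2 \<le> ?Q" unfolding gap_variation_def
      using that by (intro member_le_sum[of j "{..<m}" "\<lambda>j. (g j - ?a)\<^sup>2"]) auto
    then have "\<bar>g j - ?a\<bar> \<le> sqrt ?Q" by (metis real_sqrt_abs real_sqrt_le_mono)
    then have "\<bar>g j - ?a\<bar> ^ 3 \<le> sqrt ?Q ^ 3" by (intro power_mono) auto
    moreover have "\<bar>e j\<bar> \<le> \<bar>g j - ?a\<bar> ^ 3"
      using sin_deficit_cubic[of ?a "g j - ?a"] by (simp add: e_def)
    ultimately show ?thesis by simp
  qed
  have "gap_deficit m g - sin ?a / 4 * ?Q = (\<Sum>j<m. e j) / 2"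
    unfolding gap_deficit_eq[OF assms] gap_variation_def e_def
    by (simp add: sum_subtractf sum.distrib sum_distrib_left diff_divide_distrib sum_divide_distrib)
  also have "\<bar>\<dots>\<bar> \<le> (\<Sum>j<m. \<bar>e j\<bar>) / 2" by (simp add: sum_abs)
  also have "\<dots> \<le> (\<Sum>j<m. sqrt ?Q ^ 3) / 2" using e by (intro divide_right_mono sum_mono) auto
  also have "\<dots> \<le> real m * sqrt ?Q ^ 3" by (simp add: gap_variation_def sum_nonneg)
  finally show ?thesis .
qed

lemma sin_regular_pos: "m \<ge> 3 \<Longrightarrow> sin (2 * pi / real m) > 0"
  by (intro sin_gt_zero) (auto simp: field_simps)

text \<open>A gap of at least \<open>pi\<close> contributes nothing positive and leaves at most
  \<open>pi\<close> for the others, so the sum is at most both \<open>m - 1\<close> and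
  \<open>pi\<close>. For \<open>m = 3\<close> the bound \<open>pi\<close> would exceed
  \<open>3 * sin (2 * pi / 3)\<close>, which is about \<open>2.6\<close>, hence the separate value
  \<open>2\<close>.\<close>

lemma sum_sin_long_gap_less:
  assumes m: "m \<ge> 3" and g: "\<And>j. j < m \<Longrightarrow> 0 \<le> g j" "(\<Sum>j<m. g j) = 2 * pi"
    and i: "i < m" "pi \<le> g i"
  shows "(\<Sum>j<m. sin (g j)) \<le> (if m = 3 then 2 else pi)"
    and "(if m = 3 then 2 else pi) < real m * sin (2 * pi / m)"
proof -
  have split: "(\<Sum>j<m. f j) = f i + (\<Sum>j\<in>{..<m} - {i}. f j)" for f :: "nat \<Rightarrow> real"
    using i by (simp add: sum.remove)
  have "(\<Sum>j\<in>{..<m} - {i}. g j) \<ge> 0" using g(1) by (intro sum_nonneg) auto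
  then have gi: "g i \<le> 2 * pi" using split[of g] g(2) by simp
  have s0: "sin (g i) \<le> 0"
    using i gi sin_le_zero[of "g i"] by (cases "g i = 2 * pi") auto
  have "(\<Sum>j\<in>{..<m} - {i}. sin (g j)) \<le> (\<Sum>j\<in>{..<m} - {i}. 1)" by (intro sum_mono) auto
  also have "\<dots> = real (m - 1)" using i by simp
  finally have 1: "(\<Sum>j\<in>{..<m} - {i}. sin (g j)) \<le> real (m - 1)" .
  have "(\<Sum>j\<in>{..<m} - {i}. sin (g j)) \<le> (\<Sum>j\<in>{..<m} - {i}. g j)"
    using g(1) by (intro sum_mono sin_x_le_x) auto
  also have "\<dots> \<le> pi" using split[of g] g(2) i by simp
  finally have 2: "(\<Sum>j\<in>{..<m} - {i}. sin (g j)) \<le> pi" .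
  show "(\<Sum>j<m. sin (g j)) \<le> (if m = 3 then 2 else pi)"
    using s0 1 2 split[of "\<lambda>j. sin (g j)"] by auto
  show "(if m = 3 then 2 else pi) < real m * sin (2 * pi / m)"
  proof (cases "m = 3")
    case True
    have "sin (2 * pi / 3) = sin (pi / 3)" using sin_pi_minus[of "pi / 3"] by (simp add: field_simps)
    then have "sin (2 * pi / 3) = sqrt 3 / 2" by (simp add: sin_60)
    moreover have "sqrt 3 > 1.5" by (rule real_less_rsqrt) (simp add: power2_eq_square)
    ultimately show ?thesis using True by simp
  next
    case False
    then have m4: "4 \<le> real m" using m by linarith
    have "0.57 * (2 * pi / m) \<le> sin (2 * pi / m)"
      using m4 by (intro sin_ge_linear) (auto simp: field_simps)
    then have "real m * (0.57 * (2 * pi / m)) \<le> real m * sin (2 * pi / m)" by (intro mult_left_mono) auto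
    then show ?thesis using m4 False pi_bounds(1) by simp
  qed
qed

text \<open>If all gaps are below \<open>pi\<close>, strong concavity gives the bound term by term.
  If some gap is at least \<open>pi\<close>, the deficit is at least a fixed \<open>d > 0\<close>,
  while the variation never exceeds \<open>m * (2 * pi)^2\<close>. This explains the two entries of
  the minimum defining \<open>c\<close>.\<close>

lemma gap_deficit_ge_variation:
  assumes m: "m \<ge> 3"
  obtains c where "c > 0"
    "\<And>g. (\<And>j. j < m \<Longrightarrow> 0 \<le> g j) \<Longrightarrow> (\<Sum>j<m. g j) = 2 * pi \<Longrightarrow> c * gap_variation m g \<le> gap_deficit m g"
proof -
  let ?a = "2 * pi / real m"
  define b where "b = (if m = 3 then 2 else pi)"
  define d where "d = (real m * sin ?a - b) / 2"
  have d: "d > 0"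
  proof -
    \<comment> \<open>One full gap \<open>2 * pi\<close> and otherwise zero gaps provide an instance
      for the comparison of the two constants.\<close>
    have "b < real m * sin (2 * pi / m)" unfolding b_def
      using m by (intro sum_sin_long_gap_less(2)[of m "\<lambda>j. if j = 0 then 2 * pi else 0" 0]) auto
    then show ?thesis by (simp add: d_def)
  qed
  have m0: "m > 0" using m by simp
  have sa: "sin ?a > 0" using sin_regular_pos[OF m] .
  have a: "0 < ?a" "?a < pi" using m by (auto simp: field_simps)
  define c where "c = min (sin ?a / 64) (d / (real m * (2 * pi)\<^sup>2))"
  have "c > 0" using sa d m by (auto simp: c_def)
  moreover have "c * gap_variation m g \<le> gap_deficit m g"
    if g: "\<And>j. j < m \<Longrightarrow> 0 \<le> g j" "(\<Sum>j<m. g j) = 2 * pi" for g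
  proof (cases "\<exists>i<m. pi \<le> g i")
    case True
    then obtain i where i: "i < m" "pi \<le> g i" by auto
    have "(\<Sum>j<m. sin (g j)) \<le> b" unfolding b_def
      using sum_sin_long_gap_less(1)[OF m g i] by simp
    then have D: "d \<le> gap_deficit m g" by (simp add: d_def gap_deficit_def)
    have "gap_variation m g \<le> (\<Sum>j<m. (2 * pi)\<^sup>2)"
      unfolding gap_variation_def
    proof (intro sum_mono)
      fix j assume j: "j \<in> {..<m}"
      have "g j \<le> 2 * pi" using member_le_sum[of j "{..<m}" g] j g by auto
      then have "\<bar>g j - ?a\<bar> \<le> \<bar>2 * pi\<bar>" using g(1)[of j] j a unfolding lessThan_iff abs_le_iff by linarith
      then show "(g j - ?a)\<^sup>2 \<le> (2 * pi)\<^sup>2" by (simp only: abs_le_square_iff)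
    qed
    then have "c * gap_variation m g \<le> c * (real m * (2 * pi)\<^sup>2)" using \<open>c > 0\<close> by (intro mult_left_mono) auto
    also have "\<dots> \<le> d / (real m * (2 * pi)\<^sup>2) * (real m * (2 * pi)\<^sup>2)"
      by (intro mult_right_mono) (auto simp: c_def)
    also have "\<dots> = d" using m by simp
    finally show ?thesis using D by simp
  next
    case False
    have "c * gap_variation m g \<le> sin ?a / 64 * gap_variation m g"
      by (intro mult_right_mono) (auto simp: c_def gap_variation_def sum_nonneg)
    also have "\<dots> = (\<Sum>j<m. sin ?a / 32 * (g j - ?a)\<^sup>2) / 2"
      by (simp add: gap_variation_def sum_distrib_left sum_divide_distrib)
    also have "\<dots> \<le> gap_deficit m g"
      unfolding gap_deficit_eq[OF m0 g(2)]
      using False g a by (intro divide_right_mono sum_mono sin_deficit_ge) auto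
    finally show ?thesis .
  qed
  ultimately show thesis using that by blast
qed

section \<open>Volume of the set of nearly regular configurations\<close>

text \<open>Radial profile of the volume of a \<open>k\<close>-dimensional ball in terms of its
  squared radius. For \<open>k = 0\<close> it is the indicator of \<open>0 \<le> x\<close>, which
  starts the induction in \<open>emeasure_bridge\<close>.\<close>

definition semicircle :: "nat \<Rightarrow> real \<Rightarrow> real" where
  "semicircle k x = (if 0 \<le> x then sqrt x ^ k else 0)"

lemma borel_measurable_semicircle [measurable]: "semicircle k \<in> borel_measurable borel"
  unfolding semicircle_def by measurable

lemma semicircle_nonneg [simp]: "0 \<le> semicircle k x"
  by (simp add: semicircle_def)

text \<open>Slicing a ball: the substitution \<open>z = z0 + \<rho> * w\<close> reduces the integral
  to the Beta integral over \<open>{-1..1}\<close>, and \<open>1 / \<beta>\<close> is the Jacobian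
  of the scaling.\<close>

lemma nn_integral_semicircle:
  assumes "\<beta> > 0"
  shows "(\<integral>\<^sup>+z. semicircle k (r - (\<beta> * (z - z0))\<^sup>2) \<partial>lborel)
    = ennreal (Beta (1 / 2) (real k / 2 + 1) / \<beta> * semicircle (Suc k) r)"
proof (cases "r > 0")
  case False
  \<comment> \<open>For \<open>r = 0\<close> and \<open>k = 0\<close> the integrand equals
    \<open>1\<close> at \<open>z0\<close>, so it vanishes only almost everywhere.\<close>
  have "AE z in lborel. z \<noteq> z0"
    using AE_lborel_singleton by blast
  then have "AE z in lborel. ennreal (semicircle k (r - (\<beta> * (z - z0))\<^sup>2)) = 0"
  proof eventually_elim
    case (elim z)
    then have "0 < (\<beta> * (z - z0))\<^sup>2" using assms by simp
    then have "\<not> 0 \<le> r - (\<beta> * (z - z0))\<^sup>2" using False by linarith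
    then show ?case by (simp add: semicircle_def)
  qed
  then have "(\<integral>\<^sup>+z. semicircle k (r - (\<beta> * (z - z0))\<^sup>2) \<partial>lborel) = 0"
    by (subst nn_integral_0_iff_AE) auto
  then show ?thesis using False by (simp add: semicircle_def)
next
  case True
  define \<rho> where "\<rho> = sqrt r / \<beta>"
  have \<rho>: "\<rho> > 0" "(\<beta> * \<rho>)\<^sup>2 = r" using True assms by (simp_all add: \<rho>_def)
  have "(\<integral>\<^sup>+z. semicircle k (r - (\<beta> * (z - z0))\<^sup>2) \<partial>lborel)
      = \<bar>\<rho>\<bar> * (\<integral>\<^sup>+w. semicircle k (r - (\<beta> * (z0 + \<rho> * w - z0))\<^sup>2) \<partial>lborel)"
    using \<rho>(1) by (subst nn_integral_real_affine[where c = \<rho> and t = z0]) auto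
  also have "(\<integral>\<^sup>+w. semicircle k (r - (\<beta> * (z0 + \<rho> * w - z0))\<^sup>2) \<partial>lborel)
     = (\<integral>\<^sup>+w. ennreal (sqrt r ^ k) * ennreal (indicator {-1..1} w * sqrt (1 - w\<^sup>2) ^ k) \<partial>lborel)"
  proof (intro nn_integral_cong)
    fix w :: real
    have "r - (\<beta> * (z0 + \<rho> * w - z0))\<^sup>2 = r - (\<beta> * \<rho>)\<^sup>2 * w\<^sup>2"
      by (simp add: power_mult_distrib)
    then have *: "r - (\<beta> * (z0 + \<rho> * w - z0))\<^sup>2 = r * (1 - w\<^sup>2)"
      unfolding \<rho>(2) by (simp add: algebra_simps)
    have "0 \<le> r * (1 - w\<^sup>2) \<longleftrightarrow> w \<in> {-1..1}"
      using True by (auto simp: zero_le_mult_iff abs_square_le_1 abs_le_iff)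
    then show "ennreal (semicircle k (r - (\<beta> * (z0 + \<rho> * w - z0))\<^sup>2)) =
        ennreal (sqrt r ^ k) * ennreal (indicator {-1..1} w * sqrt (1 - w\<^sup>2) ^ k)"
      unfolding * using True
      by (subst ennreal_mult'[symmetric]) (auto simp: semicircle_def real_sqrt_mult power_mult_distrib indicator_def)
  qed
  also have "\<dots> = ennreal (sqrt r ^ k) * ennreal (Beta (1 / 2) (real k / 2 + 1))"
    using emeasure_cball_aux_integral[of k] by (subst nn_integral_cmult) auto
  also have "ennreal \<bar>\<rho>\<bar> * \<dots> = ennreal (\<rho> * (sqrt r ^ k * Beta (1 / 2) (real k / 2 + 1)))"
    using \<rho> True by (simp add: ennreal_mult'[symmetric] Beta_def)
  also have "\<rho> * (sqrt r ^ k * Beta (1 / 2) (real k / 2 + 1)) = Beta (1 / 2) (real k / 2 + 1) / \<beta> * semicircle (Suc k) r"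
    using True by (simp add: \<rho>_def semicircle_def)
  finally show ?thesis .
qed

lemma unit_ball_vol_Suc:
  "unit_ball_vol (real k) * Beta (1 / 2) (real k / 2 + 1) = unit_ball_vol (real (Suc k))"
proof -
  have "Gamma (real k / 2 + 1) \<noteq> 0" by (intro Gamma_real_pos[THEN less_imp_neq, symmetric]) simp
  moreover have "1 / 2 + (real k / 2 + 1) = real (Suc k) / 2 + 1" by (simp add: field_simps)
  moreover have "pi powr (real (Suc k) / 2) = pi powr (real k / 2) * sqrt pi"
    by (simp add: powr_add add_divide_distrib powr_half_sqrt)
  ultimately show ?thesis
    unfolding unit_ball_vol_def Beta_def Gamma_one_half_real by simp
qed

abbreviation uniform_angle :: "real measure" where
  "uniform_angle \<equiv> uniform_measure lborel {0..<2 * pi}"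

lemma prob_space_uniform_angle: "prob_space uniform_angle"
  by (intro prob_space_uniform_measure) auto

text \<open>The quadratic form of the increments of the path \<open>0, \<phi> 1, \<dots>, \<phi> k, y\<close> about \<open>a\<close>, arranged so that
  the last coordinate can be integrated out by completing the square.\<close>

primrec bridge :: "real \<Rightarrow> nat \<Rightarrow> (nat \<Rightarrow> real) \<Rightarrow> real \<Rightarrow> real" where
  "bridge a 0 \<phi> y = (y - a)\<^sup>2"
| "bridge a (Suc k) \<phi> y = bridge a k \<phi> (\<phi> (Suc k)) + (y - \<phi> (Suc k) - a)\<^sup>2"

lemma bridge_cong: "(\<And>j. 1 \<le> j \<Longrightarrow> j \<le> k \<Longrightarrow> \<phi> j = \<phi>' j) \<Longrightarrow> bridge a k \<phi> y = bridge a k \<phi>' y"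
  by (induction k arbitrary: y) auto

lemma measurable_bridge:
  assumes "{1..k} \<subseteq> K" "f \<in> borel_measurable (Pi\<^sub>M K (\<lambda>_. borel))"
  shows "(\<lambda>\<phi>. bridge a k \<phi> (f \<phi>)) \<in> borel_measurable (Pi\<^sub>M K (\<lambda>_. borel))"
  using assms
proof (induction k arbitrary: f)
  case 0
  note [measurable] = 0(2)
  show ?case by simp
next
  case (Suc k)
  note [measurable] = Suc.prems(2)
  have [measurable]: "(\<lambda>\<phi>. \<phi> (Suc k)) \<in> borel_measurable (Pi\<^sub>M K (\<lambda>_. borel))"
    using Suc.prems(1) by (intro measurable_component_singleton) auto
  have [measurable]: "(\<lambda>\<phi>. bridge a k \<phi> (\<phi> (Suc k))) \<in> borel_measurable (Pi\<^sub>M K (\<lambda>_. borel))"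
    using Suc.prems(1) by (intro Suc.IH) auto
  show ?case by simp
qed

text \<open>With \<open>n = k + 1\<close> and deviations \<open>u\<close>, \<open>v\<close> of
  \<open>y\<close>, \<open>z\<close> from their ideal positions, the identity is \<open>(u - v)^2 +
  v^2 / n = u^2 / (n + 1) + (n + 1) / n * (v - n * u / (n + 1))^2\<close>.\<close>

lemma bridge_complete_square:
  fixes a y z :: real and k :: nat
  defines "\<beta> \<equiv> sqrt ((real k + 2) / (real k + 1))"
    and "z0 \<equiv> (real k + 1) * a + (real k + 1) / (real k + 2) * (y - (real k + 2) * a)"
  shows "R - (y - z - a)\<^sup>2 - (z - (real k + 1) * a)\<^sup>2 / (real k + 1)
    = R - (y - (real k + 2) * a)\<^sup>2 / (real k + 2) - (\<beta> * (z - z0))\<^sup>2"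
proof -
  define n u v where "n = real k + 1" and "u = y - (real k + 2) * a" and "v = z - (real k + 1) * a"
  have n: "n > 0" "n + 1 > 0" by (auto simp: n_def)
  have "y - z - a = u - v" by (simp add: u_def v_def algebra_simps)
  moreover have "z - z0 = v - n / (n + 1) * u" by (simp add: z0_def u_def v_def n_def add.commute)
  moreover have "\<beta>\<^sup>2 = (n + 1) / n" by (simp add: \<beta>_def n_def)
  moreover have "(u - v)\<^sup>2 + v\<^sup>2 / n = u\<^sup>2 / (n + 1) + (n + 1) / n * (v - n / (n + 1) * u)\<^sup>2"
    using n by (simp add: divide_simps power2_eq_square) (simp add: algebra_simps)
  ultimately show ?thesis
    unfolding power_mult_distrib by (simp add: u_def[symmetric] v_def[symmetric]) (simp add: n_def add.commute u_def v_def)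
qed

text \<open>Induction on \<open>k\<close>, integrating out the last coordinate. The scale factors
  \<open>\<beta>\<close> telescope to \<open>sqrt (k + 1)\<close>, the root of the determinant of
  the quadratic form, and the Beta factors build up the ball volume. The hypothesis
  \<open>R < a^2\<close> keeps the ellipsoid inside the cube of angles, so that the full volume is
  seen.\<close>

lemma emeasure_bridge:
  assumes "0 < a" "R < a\<^sup>2" "y \<le> 2 * pi"
  shows "emeasure (Pi\<^sub>M {1..k} (\<lambda>_. uniform_angle)) {\<phi> \<in> space (Pi\<^sub>M {1..k} (\<lambda>_. uniform_angle)). bridge a k \<phi> y \<le> R}
    = ennreal (unit_ball_vol k / ((2 * pi) ^ k * sqrt (real k + 1))
               * semicircle k (R - (y - (real k + 1) * a)\<^sup>2 / (real k + 1)))"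
  using assms
proof (induction k arbitrary: y R)
  case 0
  show ?case by (simp add: space_PiM semicircle_def unit_ball_vol_def emeasure_PiM_empty)
next
  case (Suc k)
  interpret A: prob_space uniform_angle by (rule prob_space_uniform_angle)
  interpret product_sigma_finite "\<lambda>_::nat. uniform_angle" by standard
  let ?P = "\<lambda>k::nat. Pi\<^sub>M {1..k} (\<lambda>_. uniform_angle)"
  define C where "C = unit_ball_vol (real k) / ((2 * pi) ^ k * sqrt (real k + 1))"
  define \<beta> where "\<beta> = sqrt ((real k + 2) / (real k + 1))"
  define z0 where "z0 = (real k + 1) * a + (real k + 1) / (real k + 2) * (y - (real k + 2) * a)"
  define R' where "R' = R - (y - (real k + 2) * a)\<^sup>2 / (real k + 2)"
  define G where "G z = semicircle k (R - (y - z - a)\<^sup>2 - (z - (real k + 1) * a)\<^sup>2 / (real k + 1))" for z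
  have C0: "C \<ge> 0" by (simp add: C_def)
  have sets: "sets (Pi\<^sub>M K (\<lambda>_. uniform_angle)) = sets (Pi\<^sub>M K (\<lambda>_. borel))" for K :: "nat set"
    by (intro sets_PiM_cong) auto
  have sp: "space (Pi\<^sub>M K (\<lambda>_. uniform_angle)) = space (Pi\<^sub>M K (\<lambda>_. borel))" for K :: "nat set"
    by (rule sets_eq_imp_space_eq[OF sets])
  have ins: "{1..Suc k} = insert (Suc k) {1..k}" by auto
  have m: "{\<phi> \<in> space (?P k). bridge a k \<phi> y \<le> R} \<in> sets (?P k)" for k y R
  proof -
    have [measurable]: "(\<lambda>\<phi>. bridge a k \<phi> y) \<in> borel_measurable (Pi\<^sub>M {1..k} (\<lambda>_. borel))"
      by (rule measurable_bridge) auto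
    show ?thesis unfolding sets sp by measurable
  qed
  have "emeasure (?P (Suc k)) {\<phi> \<in> space (?P (Suc k)). bridge a (Suc k) \<phi> y \<le> R}
     = (\<integral>\<^sup>+\<phi>. indicator {\<phi> \<in> space (?P (Suc k)). bridge a (Suc k) \<phi> y \<le> R} \<phi> \<partial>?P (Suc k))"
    by (subst nn_integral_indicator[OF m]) simp
  also have "\<dots> = (\<integral>\<^sup>+z. \<integral>\<^sup>+\<phi>. indicator {\<phi> \<in> space (?P (Suc k)). bridge a (Suc k) \<phi> y \<le> R} (\<phi>(Suc k := z)) \<partial>?P k \<partial>uniform_angle)"
    unfolding ins using m[of "Suc k"] unfolding ins by (intro product_nn_integral_insert_rev) auto
  also have "\<dots> = (\<integral>\<^sup>+z. emeasure (?P k) {\<phi> \<in> space (?P k). bridge a k \<phi> z \<le> R - (y - z - a)\<^sup>2} \<partial>uniform_angle)"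
  proof (intro nn_integral_cong)
    fix z
    have "(\<integral>\<^sup>+\<phi>. indicator {\<phi> \<in> space (?P (Suc k)). bridge a (Suc k) \<phi> y \<le> R} (\<phi>(Suc k := z)) \<partial>?P k)
      = (\<integral>\<^sup>+\<phi>. indicator {\<phi> \<in> space (?P k). bridge a k \<phi> z \<le> R - (y - z - a)\<^sup>2} \<phi> \<partial>?P k)"
    proof (intro nn_integral_cong)
      fix \<phi> assume \<phi>: "\<phi> \<in> space (?P k)"
      then have "\<phi>(Suc k := z) \<in> space (?P (Suc k))"
        unfolding ins by (auto simp: space_PiM PiE_iff extensional_def)
      moreover have "bridge a k (\<phi>(Suc k := z)) z = bridge a k \<phi> z"
        by (rule bridge_cong) auto
      ultimately show "(indicator {\<phi> \<in> space (?P (Suc k)). bridge a (Suc k) \<phi> y \<le> R} (\<phi>(Suc k := z)) :: ennreal)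
         = indicator {\<phi> \<in> space (?P k). bridge a k \<phi> z \<le> R - (y - z - a)\<^sup>2} \<phi>"
        using \<phi> by (auto simp: indicator_def)
    qed
    then show "(\<integral>\<^sup>+\<phi>. indicator {\<phi> \<in> space (?P (Suc k)). bridge a (Suc k) \<phi> y \<le> R} (\<phi>(Suc k := z)) \<partial>?P k)
      = emeasure (?P k) {\<phi> \<in> space (?P k). bridge a k \<phi> z \<le> R - (y - z - a)\<^sup>2}"
      by (simp only: nn_integral_indicator[OF m])
  qed
  also have "\<dots> = (\<integral>\<^sup>+z. ennreal C * ennreal (G z) \<partial>uniform_angle)"
  proof (intro nn_integral_cong_AE AE_uniform_measureI AE_I2 impI)
    fix z :: real assume z: "z \<in> {0..<2 * pi}"
    have "R - (y - z - a)\<^sup>2 < a\<^sup>2" using Suc.prems(2) zero_le_power2[of "y - z - a"] by linarith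
    then have "emeasure (?P k) {\<phi> \<in> space (?P k). bridge a k \<phi> z \<le> R - (y - z - a)\<^sup>2} = ennreal (C * G z)"
      unfolding C_def G_def using z Suc.prems(1) by (intro Suc.IH) auto
    then show "emeasure (?P k) {\<phi> \<in> space (?P k). bridge a k \<phi> z \<le> R - (y - z - a)\<^sup>2} = ennreal C * ennreal (G z)"
      using C0 by (simp add: ennreal_mult')
  qed simp
  also have "\<dots> = (\<integral>\<^sup>+z. ennreal C * ennreal (G z) * indicator {0..<2 * pi} z \<partial>lborel) / ennreal (2 * pi)"
    unfolding G_def by (subst nn_integral_uniform_measure) auto
  also have "(\<integral>\<^sup>+z. ennreal C * ennreal (G z) * indicator {0..<2 * pi} z \<partial>lborel)
      = (\<integral>\<^sup>+z. ennreal C * ennreal (G z) \<partial>lborel)"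
  proof (intro nn_integral_cong)
    fix z :: real
    \<comment> \<open>A point \<open>z\<close> outside the angle range would make a single square,
      or the completed square of the earlier increments, reach \<open>a^2 > R\<close>.\<close>
    have supp: "z \<in> {0..<2 * pi}" if "G z \<noteq> 0"
    proof -
      define q where "q = (z - (real k + 1) * a)\<^sup>2 / (real k + 1)"
      have nn: "0 \<le> R - (y - z - a)\<^sup>2 - q" using that by (auto simp: G_def semicircle_def q_def split: if_splits)
      moreover have q0: "q \<ge> 0" by (simp add: q_def)
      ultimately have "(y - z - a)\<^sup>2 < a\<^sup>2" using Suc.prems by linarith
      then have "\<bar>y - z - a\<bar> < \<bar>a\<bar>" using Suc.prems(1) by (metis abs_le_square_iff linorder_not_le)
      then have 1: "z < 2 * pi" using Suc.prems by linarith
      have "q < a\<^sup>2" using nn Suc.prems(2) zero_le_power2[of "y - z - a"] by linarith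
      then have "(z - (real k + 1) * a)\<^sup>2 < a\<^sup>2 * (real k + 1)" by (simp add: q_def field_simps)
      also have "\<dots> \<le> a\<^sup>2 * (real k + 1) * (real k + 1)" using mult_left_mono[of 1 "real k + 1" "a\<^sup>2 * (real k + 1)"] by simp
      also have "\<dots> = ((real k + 1) * a)\<^sup>2" by (simp add: power2_eq_square)
      finally have "\<bar>z - (real k + 1) * a\<bar> < \<bar>(real k + 1) * a\<bar>" by (metis abs_le_square_iff linorder_not_le)
      moreover have "0 < (real k + 1) * a" using Suc.prems by simp
      ultimately have "z \<ge> 0" by linarith
      with 1 show ?thesis by simp
    qed
    show "ennreal C * ennreal (G z) * indicator {0..<2 * pi} z = ennreal C * ennreal (G z)"
      using supp by (cases "G z = 0") auto
  qed
  also have "\<dots> = ennreal C * (\<integral>\<^sup>+z. semicircle k (R' - (\<beta> * (z - z0))\<^sup>2) \<partial>lborel)"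
    unfolding G_def R'_def z0_def \<beta>_def bridge_complete_square by (subst nn_integral_cmult) auto
  also have "\<dots> = ennreal C * ennreal (Beta (1 / 2) (real k / 2 + 1) / \<beta> * semicircle (Suc k) R')"
    by (subst nn_integral_semicircle) (auto simp: \<beta>_def)
  also have "\<dots> / ennreal (2 * pi) = ennreal (C * (Beta (1 / 2) (real k / 2 + 1) / \<beta> * semicircle (Suc k) R') / (2 * pi))"
    using C0 by (subst ennreal_mult[symmetric], simp, simp add: \<beta>_def Beta_def) (subst divide_ennreal; simp add: \<beta>_def Beta_def)
  also have "C * (Beta (1 / 2) (real k / 2 + 1) / \<beta> * semicircle (Suc k) R') / (2 * pi) =
      unit_ball_vol (real (Suc k)) / ((2 * pi) ^ Suc k * sqrt (real (Suc k) + 1))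
               * semicircle (Suc k) (R - (y - (real (Suc k) + 1) * a)\<^sup>2 / (real (Suc k) + 1))"
  proof -
    have e: "real (Suc k) + 1 = real k + 2" by simp
    have "sqrt (real k + 1) * \<beta> = sqrt (real k + 2)"
      by (simp add: \<beta>_def real_sqrt_mult[symmetric])
    moreover have "C * (Beta (1 / 2) (real k / 2 + 1) / \<beta> * semicircle (Suc k) R') / (2 * pi) =
       (unit_ball_vol (real k) * Beta (1 / 2) (real k / 2 + 1)) / ((2 * pi) ^ Suc k * (sqrt (real k + 1) * \<beta>)) * semicircle (Suc k) R'"
      by (simp add: C_def mult_ac)
    ultimately show ?thesis unfolding e R'_def unit_ball_vol_Suc by simp
  qed
  finally show ?case .
qed

section \<open>Cyclic gaps\<close>

definition cyclic_gaps :: "nat \<Rightarrow> (nat \<Rightarrow> real) \<Rightarrow> nat \<Rightarrow> real" where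
  "cyclic_gaps k \<phi> j = (if j < k then \<phi> (Suc j) else \<phi> 0 + 2 * pi) - \<phi> j"

lemma sum_cyclic_gaps: "(\<Sum>j<Suc k. cyclic_gaps k \<phi> j) = 2 * pi"
proof -
  have "(\<Sum>j<k. cyclic_gaps k \<phi> j) = (\<Sum>j<k. \<phi> (Suc j) - \<phi> j)"
    by (intro sum.cong) (auto simp: cyclic_gaps_def)
  then show ?thesis by (simp add: sum_lessThan_telescope) (simp add: cyclic_gaps_def)
qed

lemma polygon_area_cyclic_gaps:
  assumes "\<And>j. j \<le> k \<Longrightarrow> 0 \<le> cyclic_gaps k \<phi> j"
  shows "real (Suc k) / 2 * sin (2 * pi / real (Suc k)) - polygon_area ((\<lambda>j. cis (\<phi> j)) ` {..k})
    = gap_deficit (Suc k) (cyclic_gaps k \<phi>)"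
proof -
  have "polygon_area ((\<lambda>j. cis (\<phi> j)) ` {..k}) = ((\<Sum>j<k. sin (\<phi> (Suc j) - \<phi> j)) + sin (\<phi> 0 - \<phi> k)) / 2"
  proof (rule polygon_area_cis_sorted)
    show "\<phi> j \<le> \<phi> (Suc j)" if "j < k" for j using assms[of j] that by (simp add: cyclic_gaps_def)
    show "\<phi> k \<le> \<phi> 0 + 2 * pi" using assms[of k] by (simp add: cyclic_gaps_def)
  qed
  also have "sin (\<phi> 0 - \<phi> k) = sin (cyclic_gaps k \<phi> k)"
    using sin_periodic[of "\<phi> 0 - \<phi> k"] by (simp add: cyclic_gaps_def algebra_simps)
  also have "(\<Sum>j<k. sin (\<phi> (Suc j) - \<phi> j)) = (\<Sum>j<k. sin (cyclic_gaps k \<phi> j))"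
    by (intro sum.cong) (auto simp: cyclic_gaps_def)
  finally show ?thesis by (simp add: gap_deficit_def diff_divide_distrib)
qed

lemma bridge_eq_gap_variation:
  assumes "\<phi> 0 = 0"
  shows "bridge (2 * pi / real (Suc k)) k \<phi> (2 * pi) = gap_variation (Suc k) (cyclic_gaps k \<phi>)"
proof -
  have *: "bridge a k \<phi> y = (\<Sum>j<k. (\<phi> (Suc j) - \<phi> j - a)\<^sup>2) + (y - \<phi> k - a)\<^sup>2" for a y
    using assms by (induction k arbitrary: y) auto
  have "(\<Sum>j<k. (\<phi> (Suc j) - \<phi> j - a)\<^sup>2) = (\<Sum>j<k. (cyclic_gaps k \<phi> j - a)\<^sup>2)" for a
    by (intro sum.cong) (auto simp: cyclic_gaps_def)
  then show ?thesis
    unfolding * gap_variation_def using assms by (simp add: cyclic_gaps_def)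
qed

lemma sorted_enumeration:
  fixes f :: "'a \<Rightarrow> 'b::linorder"
  assumes "finite A"
  obtains e where "bij_betw e {..<card A} A" "\<And>i j. i \<le> j \<Longrightarrow> j < card A \<Longrightarrow> f (e i) \<le> f (e j)"
proof -
  obtain ys where ys: "set ys = A" "distinct ys" using finite_distinct_list[OF assms] by blast
  define xs where "xs = sort_key f ys"
  have xs: "set xs = A" "distinct xs" "sorted (map f xs)"
    using ys by (auto simp: xs_def)
  then have len: "length xs = card A" using distinct_card by fastforce
  show thesis
  proof
    show "bij_betw ((!) xs) {..<card A} A"
      using xs(1,2) len by (intro bij_betw_nth) auto
    show "f (xs ! i) \<le> f (xs ! j)" if "i \<le> j" "j < card A" for i j
      using sorted_nth_mono[OF xs(3) that(1)] that len by simp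
  qed
qed

lemma norm_cis_minus_one_le: "norm (cis x - 1) \<le> \<bar>x\<bar>"
proof -
  have "(norm (cis x - 1))\<^sup>2 = 2 - 2 * cos x"
    by (simp add: cmod_power2 power2_diff sin_squared_eq)
  also have "\<dots> = 4 * (sin (x / 2))\<^sup>2" using cos_double_sin[of "x / 2"] by simp
  also have "\<dots> \<le> 4 * (\<bar>x\<bar> / 2)\<^sup>2"
    using abs_sin_x_le_abs_x[of "x / 2"] power_mono[of "\<bar>sin (x / 2)\<bar>" "\<bar>x\<bar> / 2" 2] by simp
  also have "\<dots> = \<bar>x\<bar>\<^sup>2" by (simp add: power_divide)
  finally show ?thesis by (rule power2_le_imp_le) simp
qed

text \<open>In the order of arguments, neighbouring points differ by the angle
  \<open>2 * pi / m\<close> up to \<open>sqrt (s / c)\<close>. Taking m-th powers turns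
  \<open>2 * pi / m\<close> into a full turn and leaves only the error, which is then summed along
  the chain of vertices.\<close>

lemma polygon_area_large_imp_powers_close:
  assumes m: "m \<ge> 3"
  obtains C where "C > 0"
    "\<And>(u :: 'i \<Rightarrow> complex) I s i j. card I = m \<Longrightarrow> (\<And>i. i \<in> I \<Longrightarrow> norm (u i) = 1) \<Longrightarrow> 0 \<le> s \<Longrightarrow>
       real m / 2 * sin (2 * pi / m) - s \<le> polygon_area (u ` I) \<Longrightarrow>
       i \<in> I \<Longrightarrow> j \<in> I \<Longrightarrow> norm (u i ^ m - u j ^ m) \<le> C * sqrt s"
proof -
  obtain c where c: "c > 0"
    "\<And>g. (\<And>j. j < m \<Longrightarrow> 0 \<le> g j) \<Longrightarrow> (\<Sum>j<m. g j) = 2 * pi \<Longrightarrow> c * gap_variation m g \<le> gap_deficit m g"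
    using gap_deficit_ge_variation[OF m] by blast
  \<comment> \<open>One factor \<open>m\<close> comes from the exponent, the other from at most
    \<open>m\<close> steps between neighbours.\<close>
  define C where "C = real m * real m / sqrt c"
  have "C > 0" using c(1) m by (simp add: C_def)
  moreover have "norm (u i ^ m - u j ^ m) \<le> C * sqrt s"
    if I: "card I = m" and u: "\<And>i. i \<in> I \<Longrightarrow> norm (u i) = 1" and s: "0 \<le> s"
      and area: "real m / 2 * sin (2 * pi / m) - s \<le> polygon_area (u ` I)" and ij: "i \<in> I" "j \<in> I"
    for u :: "'i \<Rightarrow> complex" and I s i j
  proof -
    have finI: "finite I" using I m card.infinite by fastforce
    obtain e where e: "bij_betw e {..<m} I"
      and sorted: "\<And>i j. i \<le> j \<Longrightarrow> j < m \<Longrightarrow> Arg2pi (u (e i)) \<le> Arg2pi (u (e j))"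
      using sorted_enumeration[OF finI, of "\<lambda>i. Arg2pi (u i)"] unfolding I by blast
    obtain k where k: "m = Suc k" using m by (cases m) auto
    define \<phi> where "\<phi> i = Arg2pi (u (e i))" for i
    have u_eq: "u (e i) = cis (\<phi> i)" if "i < m" for i
    proof -
      have "norm (u (e i)) = 1" using u e that by (auto dest: bij_betwE)
      then show ?thesis using Arg2pi_eq[of "u (e i)"] by (simp add: \<phi>_def cis_conv_exp)
    qed
    have gaps: "0 \<le> cyclic_gaps k \<phi> i" if "i \<le> k" for i
      using sorted[of i "Suc i"] that k Arg2pi_lt_2pi[of "u (e i)"] Arg2pi_ge_0[of "u (e 0)"]
      by (auto simp: cyclic_gaps_def \<phi>_def less_eq_real_def add_increasing)
    have "u ` I = (u \<circ> e) ` {..k}" using e k by (auto simp: bij_betw_def lessThan_Suc_atMost image_comp)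
    also have "\<dots> = (\<lambda>i. cis (\<phi> i)) ` {..k}" using u_eq k by (intro image_cong) auto
    finally have uI: "u ` I = (\<lambda>i. cis (\<phi> i)) ` {..k}" .
    have "gap_deficit m (cyclic_gaps k \<phi>) \<le> s"
      using area polygon_area_cyclic_gaps[of k \<phi>, OF gaps] unfolding uI k by simp
    moreover have "c * gap_variation m (cyclic_gaps k \<phi>) \<le> gap_deficit m (cyclic_gaps k \<phi>)"
      using gaps sum_cyclic_gaps k by (intro c(2)) auto
    ultimately have var: "gap_variation m (cyclic_gaps k \<phi>) \<le> s / c"
      using c(1) by (simp add: field_simps)
    have step_le: "norm (u (e (Suc i)) ^ m - u (e i) ^ m) \<le> real m * sqrt (s / c)" if "i < k" for i
    proof -
      let ?x = "\<phi> (Suc i) - \<phi> i - 2 * pi / m"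
      have "?x\<^sup>2 \<le> gap_variation m (cyclic_gaps k \<phi>)"
        unfolding gap_variation_def
        using that k member_le_sum[of i "{..<m}" "\<lambda>j. (cyclic_gaps k \<phi> j - 2 * pi / m)\<^sup>2"]
        by (auto simp: cyclic_gaps_def)
      also note var
      finally have x: "\<bar>?x\<bar> \<le> sqrt (s / c)" using real_sqrt_le_mono by fastforce
      have "real m * ?x + 2 * pi + real m * \<phi> i = real m * \<phi> (Suc i)" using m by (simp add: right_diff_distrib)
      moreover have "u (e i) = cis (\<phi> i)" "u (e (Suc i)) = cis (\<phi> (Suc i))"
        using u_eq[of i] u_eq[of "Suc i"] that k by simp_all
      ultimately have "u (e (Suc i)) ^ m = cis (real m * ?x + 2 * pi) * u (e i) ^ m"
        by (simp only: Complex.DeMoivre cis_mult)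
      then have "u (e (Suc i)) ^ m - u (e i) ^ m = (cis (real m * ?x) - 1) * u (e i) ^ m"
        by (simp add: cis_mult[symmetric] left_diff_distrib)
      then have "norm (u (e (Suc i)) ^ m - u (e i) ^ m) = norm (cis (real m * ?x) - 1)"
        using that k by (simp add: norm_mult norm_power u_eq)
      also have "\<dots> \<le> \<bar>real m * ?x\<bar>" by (rule norm_cis_minus_one_le)
      also have "\<dots> \<le> real m * sqrt (s / c)" using x by (simp add: abs_mult mult_left_mono)
      finally show ?thesis .
    qed
    have chain: "norm (u (e j) ^ m - u (e i) ^ m) \<le> real m * real m * sqrt (s / c)" if "i \<le> j" "j < m" for i j
    proof -
      have "norm (u (e j) ^ m - u (e i) ^ m) \<le> real (j - i) * (real m * sqrt (s / c))"
        using that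
      proof (induction rule: dec_induct)
        case (step n)
        have "norm (u (e (Suc n)) ^ m - u (e i) ^ m)
           \<le> norm (u (e (Suc n)) ^ m - u (e n) ^ m) + norm (u (e n) ^ m - u (e i) ^ m)"
          using norm_triangle_ineq[of "u (e (Suc n)) ^ m - u (e n) ^ m" "u (e n) ^ m - u (e i) ^ m"] by simp
        also have "\<dots> \<le> real m * sqrt (s / c) + real (n - i) * (real m * sqrt (s / c))"
          using step k by (intro add_mono step_le) auto
        also have "\<dots> = real (Suc n - i) * (real m * sqrt (s / c))"
          using step by (simp add: Suc_diff_le algebra_simps)
        finally show ?case .
      qed simp
      also have "\<dots> \<le> real m * (real m * sqrt (s / c))"
        using that c(1) s by (intro mult_right_mono) auto
      finally show ?thesis by simp
    qed
    obtain p q where pq: "p < m" "q < m" "i = e p" "j = e q"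
      using ij e by (auto simp: bij_betw_def)
    have "norm (u i ^ m - u j ^ m) \<le> real m * real m * sqrt (s / c)"
      using chain[of p q] chain[of q p] pq by (cases "p \<le> q") (auto simp: norm_minus_commute)
    then show ?thesis by (simp add: C_def real_sqrt_divide)
  qed
  ultimately show thesis by (rule that)
qed

section \<open>The uniform distribution on the circle\<close>

lemma sets_uniform_circle [measurable_cong, simp]: "sets uniform_circle = sets borel"
  by (simp add: uniform_circle_def)

lemma measurable_cis [measurable]: "cis \<in> borel_measurable borel"
  by (intro borel_measurable_continuous_onI continuous_intros)

lemma prob_space_uniform_circle: "prob_space uniform_circle"
  unfolding uniform_circle_def using prob_space_uniform_angle
  by (rule prob_space.prob_space_distr) measurable

text \<open>By periodicity the part of the shifted interval beyond \<open>2 * pi\<close> can be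
  moved back to the start.\<close>

lemma nn_integral_uniform_angle_shift:
  fixes f :: "real \<Rightarrow> ennreal"
  assumes [measurable]: "f \<in> borel_measurable borel" and per: "\<And>x. f (x + 2 * pi) = f x"
    and \<alpha>: "0 \<le> \<alpha>" "\<alpha> < 2 * pi"
  shows "(\<integral>\<^sup>+\<theta>. f (\<theta> + \<alpha>) \<partial>uniform_angle) = (\<integral>\<^sup>+\<theta>. f \<theta> \<partial>uniform_angle)"
proof -
  have "(\<integral>\<^sup>+\<theta>. f (\<theta> + \<alpha>) * indicator {0..<2 * pi} \<theta> \<partial>lborel)
      = (\<integral>\<^sup>+\<theta>. f \<theta> * indicator {\<alpha>..<\<alpha> + 2 * pi} \<theta> \<partial>lborel)"
    by (subst (2) nn_integral_real_affine[where c = 1 and t = \<alpha>])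
       (auto intro!: nn_integral_cong simp: indicator_def add.commute)
  also have "\<dots> = (\<integral>\<^sup>+\<theta>. f \<theta> * indicator {\<alpha>..<2 * pi} \<theta> + f \<theta> * indicator {2 * pi..<\<alpha> + 2 * pi} \<theta> \<partial>lborel)"
    using \<alpha> by (intro nn_integral_cong) (auto simp: indicator_def)
  also have "\<dots> = (\<integral>\<^sup>+\<theta>. f \<theta> * indicator {\<alpha>..<2 * pi} \<theta> \<partial>lborel)
      + (\<integral>\<^sup>+\<theta>. f \<theta> * indicator {2 * pi..<\<alpha> + 2 * pi} \<theta> \<partial>lborel)"
    by (rule nn_integral_add) auto
  also have "(\<integral>\<^sup>+\<theta>. f \<theta> * indicator {2 * pi..<\<alpha> + 2 * pi} \<theta> \<partial>lborel)
      = (\<integral>\<^sup>+\<theta>. f \<theta> * indicator {0..<\<alpha>} \<theta> \<partial>lborel)"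
    by (subst nn_integral_real_affine[where c = 1 and t = "2 * pi"])
       (auto intro!: nn_integral_cong simp: indicator_def per add.commute[of "2 * pi"])
  also have "(\<integral>\<^sup>+\<theta>. f \<theta> * indicator {\<alpha>..<2 * pi} \<theta> \<partial>lborel) + \<dots>
     = (\<integral>\<^sup>+\<theta>. f \<theta> * indicator {\<alpha>..<2 * pi} \<theta> + f \<theta> * indicator {0..<\<alpha>} \<theta> \<partial>lborel)"
    by (rule nn_integral_add[symmetric]) auto
  also have "\<dots> = (\<integral>\<^sup>+\<theta>. f \<theta> * indicator {0..<2 * pi} \<theta> \<partial>lborel)"
    using \<alpha> by (intro nn_integral_cong) (auto simp: indicator_def)
  finally show ?thesis by (simp add: nn_integral_uniform_measure)
qed

lemma uniform_circle_rotate: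
  assumes "norm w = 1"
  shows "distr uniform_angle borel (\<lambda>\<theta>. w * cis \<theta>) = uniform_circle"
proof (rule measure_eqI)
  fix B assume "B \<in> sets (distr uniform_angle borel (\<lambda>\<theta>. w * cis \<theta>))"
  then have B [measurable]: "B \<in> sets borel" by simp
  define \<alpha> where "\<alpha> = Arg2pi w"
  have w: "w = cis \<alpha>" using Arg2pi_eq[of w] assms by (simp add: \<alpha>_def cis_conv_exp)
  have \<alpha>: "0 \<le> \<alpha>" "\<alpha> < 2 * pi" by (auto simp: \<alpha>_def Arg2pi_ge_0 Arg2pi_lt_2pi)
  have "emeasure (distr uniform_angle borel (\<lambda>\<theta>. w * cis \<theta>)) B
    = (\<integral>\<^sup>+x. indicator B x \<partial>distr uniform_angle borel (\<lambda>\<theta>. w * cis \<theta>))"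
    by simp
  also have "\<dots> = (\<integral>\<^sup>+\<theta>. indicator B (cis (\<theta> + \<alpha>)) \<partial>uniform_angle)"
    by (subst nn_integral_distr) (auto simp: w cis_mult add.commute)
  also have "\<dots> = (\<integral>\<^sup>+\<theta>. indicator B (cis \<theta>) \<partial>uniform_angle)"
    using \<alpha> by (intro nn_integral_uniform_angle_shift[where f = "\<lambda>\<theta>. indicator B (cis \<theta>)"])
      (auto simp: cis_mult[symmetric])
  also have "\<dots> = (\<integral>\<^sup>+x. indicator B x \<partial>uniform_circle)"
    unfolding uniform_circle_def by (subst nn_integral_distr) auto
  finally show "emeasure (distr uniform_angle borel (\<lambda>\<theta>. w * cis \<theta>)) B = emeasure uniform_circle B"
    by simp
qed simp

lemma norm_cis_minus_one_ge: "\<bar>x\<bar> \<le> pi \<Longrightarrow> \<bar>x\<bar> / 2 \<le> norm (cis x - 1)"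
proof -
  assume "\<bar>x\<bar> \<le> pi"
  from cos_ge_quadratic[OF this] have "(\<bar>x\<bar> / 2)\<^sup>2 \<le> 2 - 2 * cos x" by (simp add: power_divide)
  also have "\<dots> = (norm (cis x - 1))\<^sup>2"
    by (simp add: cmod_power2 power2_diff sin_squared_eq)
  finally show ?thesis by (rule power2_le_imp_le) simp
qed

text \<open>After rotation to \<open>w = 1\<close>, the angle must lie near a multiple of
  \<open>2 * pi / m\<close>. The total length is at most \<open>(m + 1) * 4 * \<delta> / m\<close>,
  and division by \<open>2 * pi\<close> leaves less than \<open>2 * \<delta>\<close>.\<close>

lemma emeasure_uniform_circle_powers_close:
  assumes m: "m \<ge> 1" and w: "norm w = 1" and \<delta>: "\<delta> \<ge> 0"
  shows "emeasure uniform_circle {z. norm (z ^ m - w ^ m) \<le> \<delta>} \<le> ennreal (2 * \<delta>)"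
proof -
  \<comment> \<open>The half-width \<open>2 * \<delta> / m\<close> reflects
    \<open>\<bar>x\<bar> / 2 \<le> norm (cis x - 1)\<close>. There are \<open>m + 1\<close>
    intervals because angles just below \<open>2 * pi\<close> belong to
    \<open>k = m\<close>.\<close>
  define X where "X k = {2 * pi * real k / m - 2 * \<delta> / m..2 * pi * real k / m + 2 * \<delta> / m}" for k
  have [measurable]: "{z. norm (z ^ m - w ^ m) \<le> \<delta>} \<in> sets borel"
    by (intro borel_closed closed_Collect_le continuous_intros)
  have eq: "{\<theta>. norm ((w * cis \<theta>) ^ m - w ^ m) \<le> \<delta>} = {\<theta>. norm (cis (real m * \<theta>) - 1) \<le> \<delta>}"
  proof -
    have "(w * cis \<theta>) ^ m - w ^ m = w ^ m * (cis (real m * \<theta>) - 1)" for \<theta>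
      by (simp add: power_mult_distrib Complex.DeMoivre algebra_simps)
    then show ?thesis using w by (simp add: norm_mult norm_power)
  qed
  have [measurable]: "{\<theta>. norm (cis (real m * \<theta>) - 1) \<le> \<delta>} \<in> sets borel"
    by (intro borel_closed closed_Collect_le continuous_intros)
  have sub: "{0..<2 * pi} \<inter> {\<theta>. norm (cis (real m * \<theta>) - 1) \<le> \<delta>} \<subseteq> (\<Union>k\<le>m. X k)"
  proof
    fix \<theta> assume "\<theta> \<in> {0..<2 * pi} \<inter> {\<theta>. norm (cis (real m * \<theta>) - 1) \<le> \<delta>}"
    then have \<theta>: "0 \<le> \<theta>" "\<theta> < 2 * pi" "norm (cis (real m * \<theta>) - 1) \<le> \<delta>" by auto
    \<comment> \<open>Rounding to the nearest multiple leaves a remainder \<open>e\<close> of size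
      at most \<open>pi\<close>, the range in which \<open>norm_cis_minus_one_ge\<close>
      holds.\<close>
    define y where "y = real m * \<theta> / (2 * pi)"
    define k where "k = nat (round y)"
    have y: "0 \<le> y" "y < m" using \<theta> m by (auto simp: y_def field_simps)
    have "0 \<le> round y" using round_mono[OF y(1)] by simp
    then have k: "real k = of_int (round y)" by (simp add: k_def)
    have "round y \<le> int m" using round_mono[of y "real m"] y by simp
    then have "k \<le> m" by (simp add: k_def)
    define e where "e = real m * \<theta> - 2 * pi * real k"
    have "e = 2 * pi * (y - real k)" by (simp add: e_def y_def right_diff_distrib)
    moreover have "\<bar>y - real k\<bar> \<le> 1 / 2" using of_int_round_abs_le[of y] k by (simp add: abs_minus_commute)
    ultimately have "\<bar>e\<bar> \<le> pi" by (simp add: abs_mult)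
    then have "\<bar>e\<bar> / 2 \<le> norm (cis e - 1)" by (rule norm_cis_minus_one_ge)
    also have "cis e = cis (real m * \<theta>)"
    proof -
      have "cis (2 * pi * real k) = 1" using cis_multiple_2pi[of "real k"] by simp
      moreover have "cis (real m * \<theta>) = cis e * cis (2 * pi * real k)"
        by (simp only: e_def cis_mult diff_add_cancel)
      ultimately show ?thesis by simp
    qed
    finally have "\<bar>e\<bar> \<le> 2 * \<delta>" using \<theta> by simp
    then have "\<theta> \<in> X k" using m by (auto simp: X_def e_def abs_le_iff field_simps)
    then show "\<theta> \<in> (\<Union>k\<le>m. X k)" using \<open>k \<le> m\<close> by auto
  qed
  have "emeasure uniform_circle {z. norm (z ^ m - w ^ m) \<le> \<delta>}
     = emeasure uniform_angle {\<theta>. norm (cis (real m * \<theta>) - 1) \<le> \<delta>}"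
    unfolding uniform_circle_rotate[OF w, symmetric] eq[symmetric]
    by (subst emeasure_distr) (auto simp: vimage_def)
  also have "\<dots> = emeasure lborel ({0..<2 * pi} \<inter> {\<theta>. norm (cis (real m * \<theta>) - 1) \<le> \<delta>}) / ennreal (2 * pi)"
    by (subst emeasure_uniform_measure) auto
  also have "\<dots> \<le> ennreal (real (Suc m) * (4 * \<delta> / m)) / ennreal (2 * pi)"
  proof (intro divide_right_mono_ennreal)
    have "emeasure lborel ({0..<2 * pi} \<inter> {\<theta>. norm (cis (real m * \<theta>) - 1) \<le> \<delta>}) \<le> emeasure lborel (\<Union>k\<le>m. X k)"
      using sub by (intro emeasure_mono) (auto simp: X_def)
    also have "\<dots> \<le> (\<Sum>k\<le>m. emeasure lborel (X k))"
      by (intro emeasure_subadditive_finite) (auto simp: X_def)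
    also have "\<dots> = (\<Sum>k\<le>m. ennreal (4 * \<delta> / m))"
      using \<delta> by (intro sum.cong) (auto simp: X_def)
    also have "\<dots> = ennreal (\<Sum>k\<le>m. 4 * \<delta> / m)"
      using \<delta> by (intro sum_ennreal) auto
    also have "(\<Sum>k\<le>m. 4 * \<delta> / m) = real (Suc m) * (4 * \<delta> / m)" by simp
    finally show "emeasure lborel ({0..<2 * pi} \<inter> {\<theta>. norm (cis (real m * \<theta>) - 1) \<le> \<delta>}) \<le> ennreal (real (Suc m) * (4 * \<delta> / m))" .
  qed
  also have "\<dots> = ennreal (real (Suc m) * (4 * \<delta> / m) / (2 * pi))"
    using \<delta> by (subst divide_ennreal) auto
  also have "\<dots> \<le> ennreal (2 * \<delta>)"
  proof (rule ennreal_leI)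
    have "real (Suc m) / m \<le> 2" using m by (simp add: field_simps)
    then have "(real (Suc m) / m) * (4 * \<delta>) \<le> 2 * (4 * \<delta>)" using \<delta> by (intro mult_right_mono) auto
    also have "\<dots> \<le> 2 * \<delta> * (2 * pi)" using \<delta> pi_bounds(1) mult_left_mono[of 2 pi "4 * \<delta>"] by (simp add: mult_ac)
    finally have "real (Suc m) * (4 * \<delta> / m) \<le> 2 * \<delta> * (2 * pi)" by simp
    then show "real (Suc m) * (4 * \<delta> / m) / (2 * pi) \<le> 2 * \<delta>" by (subst pos_divide_le_eq) auto
  qed
  finally show ?thesis .
qed

lemma sets_PiM_uniform_circle: "sets (Pi\<^sub>M K (\<lambda>_. uniform_circle)) = sets (Pi\<^sub>M K (\<lambda>_. borel))"
  by (intro sets_PiM_cong) auto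

lemma space_PiM_uniform_circle: "space (Pi\<^sub>M K (\<lambda>_. uniform_circle)) = space (Pi\<^sub>M K (\<lambda>_. borel))"
  by (rule sets_eq_imp_space_eq[OF sets_PiM_uniform_circle])

lemma AE_uniform_circle_norm: "AE w in uniform_circle. norm w = 1"
  unfolding uniform_circle_def by (subst AE_distr_iff) auto

text \<open>Once the coordinate \<open>i\<close> is fixed at \<open>w\<close>, the conditions on the
  other coordinates are independent and each has probability at most
  \<open>2 * \<delta>\<close>.\<close>

lemma emeasure_PiM_powers_close:
  assumes m: "m \<ge> 1" and \<delta>: "\<delta> \<ge> 0" and S: "finite S" "i \<notin> S"
  shows "emeasure (Pi\<^sub>M (insert i S) (\<lambda>_. uniform_circle))
      {u \<in> space (Pi\<^sub>M (insert i S) (\<lambda>_. borel)). \<forall>j\<in>S. norm (u j ^ m - u i ^ m) \<le> \<delta>}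
    \<le> ennreal ((2 * \<delta>) ^ card S)"
proof -
  interpret C: prob_space uniform_circle by (rule prob_space_uniform_circle)
  interpret product_sigma_finite "\<lambda>_. uniform_circle" by standard
  let ?P = "\<lambda>K. Pi\<^sub>M K (\<lambda>_. uniform_circle)"
  let ?B = "{u \<in> space (Pi\<^sub>M (insert i S) (\<lambda>_. borel :: complex measure)). \<forall>j\<in>S. norm (u j ^ m - u i ^ m) \<le> \<delta>}"
  have B: "?B \<in> sets (?P (insert i S))"
    unfolding sets_PiM_uniform_circle using S(1) by measurable
  have "emeasure (?P (insert i S)) ?B = (\<integral>\<^sup>+u. indicator ?B u \<partial>?P (insert i S))"
    by (simp only: nn_integral_indicator[OF B])
  also have "\<dots> = (\<integral>\<^sup>+w. \<integral>\<^sup>+u. indicator ?B (u(i := w)) \<partial>?P S \<partial>uniform_circle)"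
    using B S by (intro product_nn_integral_insert_rev) auto
  also have "\<dots> = (\<integral>\<^sup>+w. emeasure (?P S) (Pi\<^sub>E S (\<lambda>_. {z. norm (z ^ m - w ^ m) \<le> \<delta>})) \<partial>uniform_circle)"
  proof (intro nn_integral_cong)
    fix w :: complex
    have [measurable]: "{z. norm (z ^ m - w ^ m) \<le> \<delta>} \<in> sets borel"
      by (intro borel_closed closed_Collect_le continuous_intros)
    have "(\<integral>\<^sup>+u. indicator ?B (u(i := w)) \<partial>?P S) = (\<integral>\<^sup>+u. indicator (Pi\<^sub>E S (\<lambda>_. {z. norm (z ^ m - w ^ m) \<le> \<delta>})) u \<partial>?P S)"
    proof (intro nn_integral_cong)
      fix u assume "u \<in> space (?P S)"
      then have "u \<in> extensional S" by (simp add: space_PiM PiE_iff)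
      then have "u(i := w) \<in> ?B \<longleftrightarrow> u \<in> Pi\<^sub>E S (\<lambda>_. {z. norm (z ^ m - w ^ m) \<le> \<delta>})"
        using S(2) by (auto simp: space_PiM PiE_iff extensional_def)
      then show "(indicator ?B (u(i := w)) :: ennreal) = indicator (Pi\<^sub>E S (\<lambda>_. {z. norm (z ^ m - w ^ m) \<le> \<delta>})) u"
        by (simp add: indicator_def)
    qed
    then show "(\<integral>\<^sup>+u. indicator ?B (u(i := w)) \<partial>?P S) = emeasure (?P S) (Pi\<^sub>E S (\<lambda>_. {z. norm (z ^ m - w ^ m) \<le> \<delta>}))"
      using S(1) by (subst (asm) nn_integral_indicator) auto
  qed
  also have "\<dots> \<le> (\<integral>\<^sup>+w. ennreal ((2 * \<delta>) ^ card S) \<partial>uniform_circle)"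
  proof (rule nn_integral_mono_AE)
    show "AE w in uniform_circle. emeasure (?P S) (Pi\<^sub>E S (\<lambda>_. {z. norm (z ^ m - w ^ m) \<le> \<delta>})) \<le> ennreal ((2 * \<delta>) ^ card S)"
      using AE_uniform_circle_norm
    proof eventually_elim
      case (elim w)
      have "{z. norm (z ^ m - w ^ m) \<le> \<delta>} \<in> sets borel"
        by (intro borel_closed closed_Collect_le continuous_intros)
      then have "emeasure (?P S) (Pi\<^sub>E S (\<lambda>_. {z. norm (z ^ m - w ^ m) \<le> \<delta>})) = (\<Prod>j\<in>S. emeasure uniform_circle {z. norm (z ^ m - w ^ m) \<le> \<delta>})"
        using S(1) by (intro emeasure_PiM) auto
      also have "\<dots> \<le> (\<Prod>j\<in>S. ennreal (2 * \<delta>))"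
        using emeasure_uniform_circle_powers_close[OF m elim \<delta>] by (intro prod_mono_ennreal) auto
      also have "\<dots> = ennreal ((2 * \<delta>) ^ card S)" using \<delta> by (simp add: ennreal_power)
      finally show ?case .
    qed
  qed
  also have "\<dots> = ennreal ((2 * \<delta>) ^ card S)" by (simp add: C.emeasure_space_1)
  finally show ?thesis .
qed

section \<open>Probability that a random inscribed polygon has nearly maximal area\<close>

text \<open>The sorted area formula does not require angles in \<open>{0..<2 * pi}\<close>, so
  adding \<open>\<alpha>\<close> to all of them preserves its assumptions and its value.\<close>

lemma polygon_area_rotate:
  assumes V: "finite V" "V \<noteq> {}" "\<And>v. v \<in> V \<Longrightarrow> norm v = 1"
  shows "polygon_area ((\<lambda>v. cis \<alpha> * v) ` V) = polygon_area V"
proof -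
  obtain e where e: "bij_betw e {..<card V} V"
    and sorted: "\<And>i j. i \<le> j \<Longrightarrow> j < card V \<Longrightarrow> Arg2pi (e i) \<le> Arg2pi (e j)"
    using sorted_enumeration[OF V(1), of Arg2pi] by blast
  obtain k where k: "card V = Suc k" using V by (cases "card V") auto
  define \<phi> where "\<phi> i = Arg2pi (e i)" for i
  have e_eq: "e i = cis (\<phi> i)" if "i \<le> k" for i
    using Arg2pi_eq[of "e i"] V(3)[of "e i"] e k that
    by (auto simp: \<phi>_def cis_conv_exp dest: bij_betwE)
  have 1: "V = (\<lambda>i. cis (\<phi> i)) ` {..k}"
  proof -
    have "V = e ` {..k}" using e k by (auto simp: bij_betw_def lessThan_Suc_atMost)
    then show ?thesis using e_eq by (auto simp: image_iff)
  qed
  have 2: "(\<lambda>v. cis \<alpha> * v) ` V = (\<lambda>i. cis (\<alpha> + \<phi> i)) ` {..k}"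
    unfolding 1 image_image by (simp add: cis_mult)
  have le: "\<phi> i \<le> \<phi> (Suc i)" if "i < k" for i using sorted[of i "Suc i"] that k by (simp add: \<phi>_def)
  have "\<phi> k \<le> \<phi> 0 + 2 * pi"
    using Arg2pi_lt_2pi[of "e k"] Arg2pi_ge_0[of "e 0"] by (simp add: \<phi>_def)
  then have "polygon_area ((\<lambda>i. cis (\<alpha> + \<phi> i)) ` {..k}) = polygon_area ((\<lambda>i. cis (\<phi> i)) ` {..k})"
    using le polygon_area_cis_sorted[of k "\<lambda>i. \<alpha> + \<phi> i"] polygon_area_cis_sorted[of k \<phi>] by simp
  then show ?thesis unfolding 2 unfolding 1 .
qed

text \<open>A set of functions on the whole index type that depends only on the values on
  \<open>I\<close>. The same set thus serves samples and product spaces over any larger index set,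
  after intersection with the space.\<close>

definition near_maximal :: "'i set \<Rightarrow> real \<Rightarrow> ('i \<Rightarrow> complex) set" where
  "near_maximal I s = {u. real (card I) / 2 * sin (2 * pi / card I) - s \<le> polygon_area (u ` I)}"

lemma sets_near_maximal:
  assumes "finite I" "I \<subseteq> K"
  shows "near_maximal I s \<inter> space (Pi\<^sub>M K (\<lambda>_. borel)) \<in> sets (Pi\<^sub>M K (\<lambda>_. borel))"
proof -
  note [measurable] = borel_measurable_polygon_area[OF assms]
  have "{u \<in> space (Pi\<^sub>M K (\<lambda>_. borel)). real (card I) / 2 * sin (2 * pi / card I) - s \<le> polygon_area (u ` I)} \<in> sets (Pi\<^sub>M K (\<lambda>_. borel))"
    by measurable
  then show ?thesis by (simp add: near_maximal_def Int_def conj_commute)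
qed

lemma sets_PiM_uniform_angle: "sets (Pi\<^sub>M K (\<lambda>_. uniform_angle)) = sets (Pi\<^sub>M K (\<lambda>_. borel))"
  by (intro sets_PiM_cong) auto

lemma space_PiM_uniform_angle: "space (Pi\<^sub>M K (\<lambda>_. uniform_angle)) = space (Pi\<^sub>M K (\<lambda>_. borel))"
  by (rule sets_eq_imp_space_eq[OF sets_PiM_uniform_angle])

text \<open>Given that vertex \<open>0\<close> is at \<open>w\<close>, rotation invariance
  represents the other vertices as \<open>w * cis (\<phi> j)\<close> with uniform angles, and the
  area does not change under rotation by \<open>w\<close>. The inner integral is therefore the same
  for almost every \<open>w\<close>.\<close>

lemma
  fixes k :: nat
  shows emeasure_near_maximal_fix_base: "emeasure (Pi\<^sub>M {..k} (\<lambda>_. uniform_circle)) (near_maximal {..k} s \<inter> space (Pi\<^sub>M {..k} (\<lambda>_. borel)))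
   = emeasure (Pi\<^sub>M {1..k} (\<lambda>_. uniform_angle))
       {\<phi> \<in> space (Pi\<^sub>M {1..k} (\<lambda>_. uniform_angle)). (\<lambda>j. cis ((\<phi>(0 := 0)) j)) \<in> near_maximal {..k} s}"
    (is "emeasure _ ?B = emeasure _ ?E")
    and sets_near_maximal_angles:
    "{\<phi> \<in> space (Pi\<^sub>M {1..k} (\<lambda>_. uniform_angle)). (\<lambda>j. cis ((\<phi>(0 := 0)) j)) \<in> near_maximal {..k} s}
       \<in> sets (Pi\<^sub>M {1..k} (\<lambda>_. uniform_angle))"
proof -
  interpret C: prob_space uniform_circle by (rule prob_space_uniform_circle)
  interpret A: prob_space uniform_angle by (rule prob_space_uniform_angle)
  interpret product_sigma_finite "\<lambda>_. uniform_circle" by standard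
  let ?K = "{1..k}"
  let ?P = "\<lambda>K. Pi\<^sub>M K (\<lambda>_. uniform_circle)"
  let ?Q = "Pi\<^sub>M ?K (\<lambda>_. uniform_angle)"
  have [measurable]: "?B \<in> sets (Pi\<^sub>M {..k} (\<lambda>_. borel))"
    by (rule sets_near_maximal) auto
  then have B: "?B \<in> sets (?P {..k})" by (simp add: sets_PiM_uniform_circle)
  have ins: "{..k} = insert 0 ?K" by auto
  have upd: "(\<lambda>u. u(0 := w)) \<in> Pi\<^sub>M ?K (\<lambda>_. borel) \<rightarrow>\<^sub>M Pi\<^sub>M {..k} (\<lambda>_. borel)" for w :: complex
    unfolding ins by (rule measurable_fun_upd[where J = ?K]) auto
  have comp: "(\<lambda>\<phi>. compose ?K f \<phi>) \<in> Pi\<^sub>M ?K (\<lambda>_. borel) \<rightarrow>\<^sub>M Pi\<^sub>M ?K (\<lambda>_. borel)"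
    if [measurable]: "f \<in> borel_measurable borel" for f :: "real \<Rightarrow> complex"
    unfolding compose_def by measurable
  have mem_iff: "(compose ?K (\<lambda>\<theta>. w * cis \<theta>) \<phi>)(0 := w) \<in> ?B \<longleftrightarrow> (\<lambda>j. cis ((\<phi>(0 := 0)) j)) \<in> near_maximal {..k} s"
    if w: "norm w = 1" for w \<phi>
  proof -
    have w_cis: "w = cis (Arg2pi w)" using Arg2pi_eq[of w] w by (simp add: cis_conv_exp)
    have "(compose ?K (\<lambda>\<theta>. w * cis \<theta>) \<phi>)(0 := w) ` {..k} = (\<lambda>j. w * cis ((\<phi>(0 := 0)) j)) ` {..k}"
      by (intro image_cong) (auto simp: compose_def)
    also have "\<dots> = (\<lambda>v. cis (Arg2pi w) * v) ` (\<lambda>j. cis ((\<phi>(0 := 0)) j)) ` {..k}"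
      by (subst w_cis) (simp add: image_image)
    finally have "polygon_area ((compose ?K (\<lambda>\<theta>. w * cis \<theta>) \<phi>)(0 := w) ` {..k}) = polygon_area ((\<lambda>j. cis ((\<phi>(0 := 0)) j)) ` {..k})"
      by (simp only:) (rule polygon_area_rotate; auto)
    moreover have "(compose ?K (\<lambda>\<theta>. w * cis \<theta>) \<phi>)(0 := w) \<in> space (Pi\<^sub>M {..k} (\<lambda>_. borel))"
      by (auto simp: space_PiM PiE_iff compose_def extensional_def)
    ultimately show ?thesis by (simp add: near_maximal_def)
  qed
  show E: "?E \<in> sets ?Q"
  proof -
    have "(\<lambda>\<phi>. (compose ?K (\<lambda>\<theta>. 1 * cis \<theta>) \<phi>)(0 := 1)) -` ?B \<inter> space (Pi\<^sub>M ?K (\<lambda>_. borel)) \<in> sets (Pi\<^sub>M ?K (\<lambda>_. borel))"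
      by (rule measurable_sets[OF measurable_compose[OF comp upd]]) measurable
    also have "(\<lambda>\<phi>. (compose ?K (\<lambda>\<theta>. 1 * cis \<theta>) \<phi>)(0 := 1)) -` ?B \<inter> space (Pi\<^sub>M ?K (\<lambda>_. borel)) = ?E"
      unfolding space_PiM_uniform_angle using mem_iff[of 1] by auto
    finally show ?thesis by (simp add: sets_PiM_uniform_angle)
  qed
  have "emeasure (?P {..k}) ?B = (\<integral>\<^sup>+u. indicator ?B u \<partial>?P {..k})"
    by (simp only: nn_integral_indicator[OF B])
  also have "\<dots> = (\<integral>\<^sup>+w. \<integral>\<^sup>+u. indicator ?B (u(0 := w)) \<partial>?P ?K \<partial>uniform_circle)"
    unfolding ins using B unfolding ins by (intro product_nn_integral_insert_rev) auto
  also have "\<dots> = (\<integral>\<^sup>+w. emeasure ?Q ?E \<partial>uniform_circle)"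
  proof (intro nn_integral_cong_AE)
    show "AE w in uniform_circle. (\<integral>\<^sup>+u. indicator ?B (u(0 := w)) \<partial>?P ?K) = emeasure ?Q ?E"
      using AE_uniform_circle_norm
    proof eventually_elim
      case (elim w)
      have "distr uniform_angle uniform_circle (\<lambda>\<theta>. w * cis \<theta>) = uniform_circle"
        using uniform_circle_rotate[OF elim] distr_cong[OF refl sets_uniform_circle refl] by metis
      moreover have "distr ?Q (?P ?K) (compose ?K (\<lambda>\<theta>. w * cis \<theta>)) = Pi\<^sub>M ?K (\<lambda>_. distr uniform_angle uniform_circle (\<lambda>\<theta>. w * cis \<theta>))"
        by (intro distr_PiM_finite_prob_space')
          (auto simp: prob_space_uniform_angle prob_space_uniform_circle measurable_cong_sets[OF refl sets_uniform_circle])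
      ultimately have eq: "?P ?K = distr ?Q (?P ?K) (compose ?K (\<lambda>\<theta>. w * cis \<theta>))" by simp
      have T: "compose ?K (\<lambda>\<theta>. w * cis \<theta>) \<in> ?Q \<rightarrow>\<^sub>M ?P ?K"
        using comp[of "\<lambda>\<theta>. w * cis \<theta>"]
        by (simp add: measurable_cong_sets[OF sets_PiM_uniform_angle sets_PiM_uniform_circle])
      have F: "(\<lambda>u. indicator ?B (u(0 := w)) :: ennreal) \<in> borel_measurable (?P ?K)"
        using measurable_compose[OF upd, of "indicator ?B" borel w]
        by (simp add: measurable_cong_sets[OF sets_PiM_uniform_circle refl])
      have "(\<integral>\<^sup>+u. indicator ?B (u(0 := w)) \<partial>?P ?K)
          = (\<integral>\<^sup>+u. indicator ?B (u(0 := w)) \<partial>distr ?Q (?P ?K) (compose ?K (\<lambda>\<theta>. w * cis \<theta>)))"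
        by (simp only: eq[symmetric])
      also have "\<dots> = (\<integral>\<^sup>+\<phi>. indicator ?B ((compose ?K (\<lambda>\<theta>. w * cis \<theta>) \<phi>)(0 := w)) \<partial>?Q)"
        using T F by (intro nn_integral_distr) auto
      also have "\<dots> = (\<integral>\<^sup>+\<phi>. indicator ?E \<phi> \<partial>?Q)"
        by (intro nn_integral_cong) (simp only: indicator_def mem_iff[OF elim], simp)
      also have "\<dots> = emeasure ?Q ?E" by (simp only: nn_integral_indicator[OF E])
      finally show ?case .
    qed
  qed
  also have "\<dots> = emeasure ?Q ?E" by (simp add: C.emeasure_space_1)
  finally show "emeasure (?P {..k}) ?B = emeasure ?Q ?E" .
qed

section \<open>Sorting the angles after the base vertex\<close>

lemma permutes_image_atMost:
  assumes "\<sigma> permutes {1..k}"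
  shows "\<sigma> ` {..k} = {..k :: nat}" "\<sigma> 0 = 0"
proof -
  have "\<sigma> permutes {..k}" using assms by (rule permutes_subset) auto
  then show "\<sigma> ` {..k} = {..k}" by (rule permutes_image)
  show "\<sigma> 0 = 0" using assms by (rule permutes_not_in) auto
qed

lemma near_maximal_permute:
  fixes k :: nat
  assumes "\<sigma> permutes {1..k}"
  shows "(\<lambda>j. cis (\<phi> j)) \<in> near_maximal {..k} s \<longleftrightarrow> (\<lambda>j. cis ((\<phi> \<circ> \<sigma>) j)) \<in> near_maximal {..k} s"
proof -
  have "(\<lambda>j. cis ((\<phi> \<circ> \<sigma>) j)) ` {..k} = (\<lambda>j. cis (\<phi> j)) ` \<sigma> ` {..k}"
    by (simp add: image_image)
  then show ?thesis by (simp add: near_maximal_def permutes_image_atMost[OF assms])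
qed

text \<open>A point of \<open>angle_space k\<close> carries no meaningful angle at index
  \<open>0\<close>. The update \<open>\<phi>(0 := 0)\<close> puts the base vertex there for
  \<open>cyclic_gaps\<close>, while \<open>bridge\<close> reads only the indices from
  \<open>1\<close> on.\<close>

lemma bridge_permute:
  fixes k :: nat
  assumes "\<sigma> permutes {1..k}"
  shows "bridge (2 * pi / real (Suc k)) k (\<phi> \<circ> \<sigma>) (2 * pi)
    = gap_variation (Suc k) (cyclic_gaps k (\<phi>(0 := 0) \<circ> \<sigma>))"
proof -
  have "bridge (2 * pi / real (Suc k)) k (\<phi> \<circ> \<sigma>) (2 * pi) = bridge (2 * pi / real (Suc k)) k (\<phi>(0 := 0) \<circ> \<sigma>) (2 * pi)"
  proof (rule bridge_cong)
    fix j assume "1 \<le> j" "j \<le> k"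
    then have "\<sigma> j \<in> {1..k}" using permutes_in_image[OF assms, of j] by auto
    then show "(\<phi> \<circ> \<sigma>) j = (\<phi>(0 := 0) \<circ> \<sigma>) j" by auto
  qed
  also have "\<dots> = gap_variation (Suc k) (cyclic_gaps k (\<phi>(0 := 0) \<circ> \<sigma>))"
    using permutes_image_atMost(2)[OF assms] by (intro bridge_eq_gap_variation) simp
  finally show ?thesis .
qed

lemma near_maximal_iff_gap_deficit:
  fixes k :: nat
  assumes "\<sigma> permutes {1..k}" and "\<And>j. j \<le> k \<Longrightarrow> 0 \<le> cyclic_gaps k (\<phi> \<circ> \<sigma>) j"
  shows "(\<lambda>j. cis (\<phi> j)) \<in> near_maximal {..k} s \<longleftrightarrow> gap_deficit (Suc k) (cyclic_gaps k (\<phi> \<circ> \<sigma>)) \<le> s"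
proof -
  have "(\<lambda>j. cis (\<phi> j)) \<in> near_maximal {..k} s \<longleftrightarrow> (\<lambda>j. cis ((\<phi> \<circ> \<sigma>) j)) \<in> near_maximal {..k} s"
    by (rule near_maximal_permute[OF assms(1)])
  also have "\<dots> \<longleftrightarrow> gap_deficit (Suc k) (cyclic_gaps k (\<phi> \<circ> \<sigma>)) \<le> s"
  proof -
    have "real (Suc k) / 2 * sin (2 * pi / real (Suc k)) - polygon_area ((\<lambda>j. cis ((\<phi> \<circ> \<sigma>) j)) ` {..k})
       = gap_deficit (Suc k) (cyclic_gaps k (\<phi> \<circ> \<sigma>))"
      by (rule polygon_area_cyclic_gaps) (rule assms(2))
    then show ?thesis
      unfolding near_maximal_def mem_Collect_eq card_atMost by linarith
  qed
  finally show ?thesis .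
qed

lemma exists_sorting_permutation:
  fixes k :: nat
  assumes \<phi>0: "\<phi> 0 = 0" and \<phi>: "\<And>j. j \<in> {1..k} \<Longrightarrow> \<phi> j \<in> {0..<2 * pi}"
  obtains \<sigma> where "\<sigma> permutes {1..k}" "\<And>j. j \<le> k \<Longrightarrow> 0 \<le> cyclic_gaps k (\<phi> \<circ> \<sigma>) j"
proof -
  obtain e where e: "bij_betw e {..<card {1..k}} {1..k}"
    and sorted: "\<And>i j. i \<le> j \<Longrightarrow> j < card {1..k} \<Longrightarrow> \<phi> (e i) \<le> \<phi> (e j)"
    using sorted_enumeration[of "{1..k}" \<phi>] by blast
  \<comment> \<open>The enumeration \<open>e\<close> starts at index \<open>0\<close>, whereas the
    free angles start at \<open>1\<close>; index \<open>0\<close> is kept for the base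
    vertex.\<close>
  define \<sigma> where "\<sigma> j = (if j \<in> {1..k} then e (j - 1) else j)" for j
  have "bij_betw (e \<circ> (\<lambda>j. j - 1)) {1..k} {1..k}"
  proof (rule bij_betw_trans)
    show "bij_betw (\<lambda>j. j - 1) {1..k} {..<k}"
      by (rule bij_betw_byWitness[where f' = Suc]) auto
    show "bij_betw e {..<k} {1..k}" using e by simp
  qed
  then have "bij_betw \<sigma> {1..k} {1..k}"
    by (rule bij_betw_cong[THEN iffD1, rotated]) (auto simp: \<sigma>_def)
  then have perm: "\<sigma> permutes {1..k}"
    by (rule bij_imp_permutes) (auto simp: \<sigma>_def)
  have in_K: "e i \<in> {1..k}" if "i < k" for i using e that by (auto dest: bij_betwE)
  have "0 \<le> cyclic_gaps k (\<phi> \<circ> \<sigma>) j" if j: "j \<le> k" for j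
  proof -
    have s0: "(\<phi> \<circ> \<sigma>) 0 = 0" by (simp add: \<sigma>_def \<phi>0)
    have sj: "(\<phi> \<circ> \<sigma>) i = \<phi> (e (i - 1))" if "1 \<le> i" "i \<le> k" for i
      using that by (simp add: \<sigma>_def)
    have le: "(\<phi> \<circ> \<sigma>) j \<le> 2 * pi"
      proof (cases "j = 0")
      case False
      then have "j - 1 < k" using j by linarith
      then show ?thesis using \<phi>[OF in_K[of "j - 1"]] sj[of j] False j by simp
    qed (simp add: s0[unfolded o_apply])
    show ?thesis
    proof (cases "j < k")
      case True
      have "(\<phi> \<circ> \<sigma>) j \<le> (\<phi> \<circ> \<sigma>) (Suc j)"
      proof (cases "j = 0")
        case True
        then show ?thesis using s0 sj[of 1] \<open>j < k\<close> \<phi>[OF in_K[of 0]] by simp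
      next
        case False
        then show ?thesis using sj[of j] sj[of "Suc j"] \<open>j < k\<close> sorted[of "j - 1" j] by simp
      qed
      then show ?thesis using True by (simp add: cyclic_gaps_def)
    next
      case False
      then show ?thesis using le s0 by (simp add: cyclic_gaps_def)
    qed
  qed
  with perm show thesis by (rule that)
qed

text \<open>A single nonpositive gap would already contribute \<open>(2 * pi / m)^2\<close> to the
  variation.\<close>

lemma cyclic_gaps_pos_of_small_variation:
  fixes k :: nat
  assumes "gap_variation (Suc k) (cyclic_gaps k \<psi>) < (2 * pi / real (Suc k))\<^sup>2" "j \<le> k"
  shows "0 < cyclic_gaps k \<psi> j"
proof -
  have "(cyclic_gaps k \<psi> j - 2 * pi / real (Suc k))\<^sup>2 \<le> gap_variation (Suc k) (cyclic_gaps k \<psi>)"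
    unfolding gap_variation_def using assms(2)
    by (intro member_le_sum[of j "{..<Suc k}" "\<lambda>j. (cyclic_gaps k \<psi> j - 2 * pi / real (Suc k))\<^sup>2"]) auto
  also note assms(1)
  finally have "\<bar>cyclic_gaps k \<psi> j - 2 * pi / real (Suc k)\<bar> < \<bar>2 * pi / real (Suc k)\<bar>"
    by (metis abs_le_square_iff linorder_not_le)
  moreover have "0 < 2 * pi / real (Suc k)" by simp
  ultimately show ?thesis by linarith
qed

text \<open>Strictly increasing lists with the same set of entries coincide, and strictness also
  makes \<open>\<phi>\<close> injective, so the permutation can be recovered. This is what makes the
  ellipsoids for different orders disjoint.\<close>

lemma sorting_permutation_unique:
  fixes k :: nat
  assumes perm: "\<sigma> permutes {1..k}" "\<tau> permutes {1..k}"
    and pos: "\<And>j. j \<le> k \<Longrightarrow> 0 < cyclic_gaps k (\<phi> \<circ> \<sigma>) j"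
      "\<And>j. j \<le> k \<Longrightarrow> 0 < cyclic_gaps k (\<phi> \<circ> \<tau>) j"
  shows "\<sigma> = \<tau>"
proof -
  have sorted: "sorted_wrt (<) (map (\<phi> \<circ> \<rho>) [0..<Suc k])"
    if "\<And>j. j \<le> k \<Longrightarrow> 0 < cyclic_gaps k (\<phi> \<circ> \<rho>) j" for \<rho>
  proof -
    define x where "x = \<phi> \<circ> \<rho>"
    have step: "x j < x (Suc j)" if "j < k" for j
      using \<open>\<And>j. j \<le> k \<Longrightarrow> 0 < cyclic_gaps k (\<phi> \<circ> \<rho>) j\<close>[of j] that by (simp add: cyclic_gaps_def x_def)
    have "x i < x j" if "i < j" "j \<le> k" for i j
      using that
    proof (induction j)
      case (Suc j)
      then show ?case using step[of j] by (cases "i = j") auto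
    qed simp
    then show ?thesis unfolding x_def[symmetric] sorted_wrt_iff_nth_less by (simp del: upt_Suc)
  qed
  have set: "set (map (\<phi> \<circ> \<rho>) [0..<Suc k]) = \<phi> ` {..k}" if "\<rho> permutes {1..k}" for \<rho>
  proof -
    have "set (map (\<phi> \<circ> \<rho>) [0..<Suc k]) = \<phi> ` \<rho> ` {..k}"
      by (simp add: image_comp atLeast0LessThan lessThan_Suc_atMost del: upt_Suc)
    then show ?thesis by (simp only: permutes_image_atMost[OF that])
  qed
  have eq: "map (\<phi> \<circ> \<sigma>) [0..<Suc k] = map (\<phi> \<circ> \<tau>) [0..<Suc k]"
    using sorted[OF pos(1)] sorted[OF pos(2)] set[OF perm(1)] set[OF perm(2)]
    unfolding strict_sorted_iff by (metis sorted_distinct_set_unique)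
  have "inj_on \<phi> {..k}"
  proof -
    have "distinct (map (\<phi> \<circ> \<sigma>) [0..<Suc k])" using sorted[OF pos(1)] strict_sorted_iff by blast
    then have "inj_on (\<phi> \<circ> \<sigma>) {..k}"
      by (simp add: distinct_map atLeast0LessThan lessThan_Suc_atMost del: upt_Suc)
    then have "inj_on \<phi> (\<sigma> ` {..k})" by (rule inj_on_imageI)
    then show ?thesis by (simp only: permutes_image_atMost[OF perm(1)])
  qed
  show ?thesis
  proof
    fix j
    show "\<sigma> j = \<tau> j"
    proof (cases "j \<in> {1..k}")
      case True
      have "\<phi> (\<sigma> j) = \<phi> (\<tau> j)" using eq True by (simp add: map_eq_conv del: upt_Suc)
      moreover have "\<sigma> j \<in> {..k}" "\<tau> j \<in> {..k}"
        using True permutes_in_image[OF perm(1), of j] permutes_in_image[OF perm(2), of j] by auto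
      ultimately show ?thesis using \<open>inj_on \<phi> {..k}\<close> by (auto dest: inj_onD)
    next
      case False
      then show ?thesis using permutes_not_in[OF perm(1) False] permutes_not_in[OF perm(2) False] by simp
    qed
  qed
qed

section \<open>Ellipsoids of nearly regular configurations, one for each order of the points\<close>

abbreviation (input) angle_space :: "nat \<Rightarrow> (nat \<Rightarrow> real) measure" where
  "angle_space k \<equiv> Pi\<^sub>M {1..k} (\<lambda>_. uniform_angle)"

definition near_regular :: "nat \<Rightarrow> real \<Rightarrow> (nat \<Rightarrow> nat) \<Rightarrow> (nat \<Rightarrow> real) set" where
  "near_regular k c \<sigma> = {\<phi> \<in> space (angle_space k). bridge (2 * pi / real (Suc k)) k (\<phi> \<circ> \<sigma>) (2 * pi) \<le> c}"

lemma prob_space_angle_space: "prob_space (angle_space k)"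
  by (intro prob_space_PiM prob_space_uniform_angle)

lemma sets_near_regular_id: "near_regular k c id \<in> sets (angle_space k)"
proof -
  have [measurable]: "(\<lambda>\<phi>. bridge (2 * pi / real (Suc k)) k \<phi> (2 * pi)) \<in> borel_measurable (Pi\<^sub>M {1..k} (\<lambda>_. borel))"
    by (rule measurable_bridge) auto
  show ?thesis unfolding near_regular_def sets_PiM_uniform_angle space_PiM_uniform_angle comp_id
    by measurable
qed

text \<open>Permuting coordinates preserves the product measure, and the ellipsoid of
  \<open>\<sigma>\<close> is the preimage of the one for the identity.\<close>

lemma near_regular_permute:
  assumes "\<sigma> permutes {1..k}"
  shows "near_regular k c \<sigma> \<in> sets (angle_space k)"
    and "emeasure (angle_space k) (near_regular k c \<sigma>) = emeasure (angle_space k) (near_regular k c id)"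
proof -
  let ?f = "\<lambda>\<phi>. \<lambda>n\<in>{1..k}. \<phi> (\<sigma> n)"
  have distr: "distr (angle_space k) (angle_space k) ?f = angle_space k"
    using assms prob_space_uniform_angle permutes_in_image[OF assms]
    by (intro distr_PiM_reindex) (auto simp: permutes_inj_on)
  have f: "?f \<in> angle_space k \<rightarrow>\<^sub>M angle_space k"
  proof (rule measurable_restrict)
    fix n assume "n \<in> {1..k}"
    then have "\<sigma> n \<in> {1..k}" using permutes_in_image[OF assms] by blast
    then show "(\<lambda>\<phi>. \<phi> (\<sigma> n)) \<in> angle_space k \<rightarrow>\<^sub>M uniform_angle"
      by (rule measurable_component_singleton)
  qed
  have eq: "near_regular k c \<sigma> = ?f -` near_regular k c id \<inter> space (angle_space k)"
  proof -
    have "bridge (2 * pi / real (Suc k)) k (?f \<phi>) (2 * pi) = bridge (2 * pi / real (Suc k)) k (\<phi> \<circ> \<sigma>) (2 * pi)" for \<phi>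
      by (rule bridge_cong) auto
    then show ?thesis using measurable_space[OF f] by (auto simp: near_regular_def)
  qed
  show "near_regular k c \<sigma> \<in> sets (angle_space k)"
    unfolding eq using f sets_near_regular_id by (rule measurable_sets)
  have "emeasure (angle_space k) (near_regular k c id) = emeasure (distr (angle_space k) (angle_space k) ?f) (near_regular k c id)"
    by (simp only: distr)
  also have "\<dots> = emeasure (angle_space k) (near_regular k c \<sigma>)"
    unfolding eq using f sets_near_regular_id by (rule emeasure_distr)
  finally show "emeasure (angle_space k) (near_regular k c \<sigma>) = emeasure (angle_space k) (near_regular k c id)" ..
qed

text \<open>Ball volume over the volume \<open>(2 * pi) ^ k\<close> of the cube of angles and the
  root \<open>sqrt (k + 1)\<close> of the determinant of the quadratic form.\<close>

definition near_regular_const :: "nat \<Rightarrow> real" where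
  "near_regular_const k = unit_ball_vol k / ((2 * pi) ^ k * sqrt (real k + 1))"

lemma measure_near_regular:
  assumes "\<sigma> permutes {1..k}" "0 \<le> c" "c < (2 * pi / real (Suc k))\<^sup>2"
  shows "measure (angle_space k) (near_regular k c \<sigma>) = near_regular_const k * sqrt c ^ k"
proof -
  have "emeasure (angle_space k) (near_regular k c \<sigma>) = emeasure (angle_space k) (near_regular k c id)"
    by (rule near_regular_permute(2)[OF assms(1)])
  also have "\<dots> = ennreal (near_regular_const k * semicircle k (c - (2 * pi - (real k + 1) * (2 * pi / real (Suc k)))\<^sup>2 / (real k + 1)))"
    unfolding near_regular_def near_regular_const_def comp_id
    using assms by (intro emeasure_bridge) auto
  also have "(real k + 1) * (2 * pi / real (Suc k)) = 2 * pi" by (simp add: field_simps)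
  finally show ?thesis using assms(2) by (simp add: measure_def semicircle_def near_regular_const_def)
qed

lemma near_maximal_as_angles:
  "measure (Pi\<^sub>M {..k} (\<lambda>_. uniform_circle)) (near_maximal {..k} s \<inter> space (Pi\<^sub>M {..k} (\<lambda>_. borel)))
   = measure (angle_space k) {\<phi> \<in> space (angle_space k). (\<lambda>j. cis ((\<phi>(0 := 0)) j)) \<in> near_maximal {..k :: nat} s}"
  unfolding measure_def emeasure_near_maximal_fix_base ..

lemma card_permutations_atLeastAtMost: "card {\<sigma>. \<sigma> permutes {1..k :: nat}} = fact k"
  by (rule card_permutations) auto

text \<open>Sorting the angles puts every nearly maximal configuration into the ellipsoid of some
  order. Ties are harmless here, since a union bound tolerates overlaps.\<close>

lemma measure_near_maximal_le:
  fixes k :: nat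
  assumes c: "0 \<le> c" "c < (2 * pi / real (Suc k))\<^sup>2"
    and H: "\<And>g. (\<And>j. j \<le> k \<Longrightarrow> 0 \<le> g j) \<Longrightarrow> (\<Sum>j<Suc k. g j) = 2 * pi \<Longrightarrow>
        gap_deficit (Suc k) g \<le> s \<Longrightarrow> gap_variation (Suc k) g \<le> c"
  shows "measure (Pi\<^sub>M {..k} (\<lambda>_. uniform_circle)) (near_maximal {..k} s \<inter> space (Pi\<^sub>M {..k} (\<lambda>_. borel)))
    \<le> fact k * near_regular_const k * sqrt c ^ k"
proof -
  interpret Q: prob_space "angle_space k" by (rule prob_space_angle_space)
  let ?E = "{\<phi> \<in> space (angle_space k). (\<lambda>j. cis ((\<phi>(0 := 0)) j)) \<in> near_maximal {..k} s}"
  let ?U = "\<Union>\<sigma>\<in>{\<sigma>. \<sigma> permutes {1..k}}. near_regular k c \<sigma>"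
  have fin: "finite {\<sigma>. \<sigma> permutes {1..k}}" by (simp add: finite_permutations)
  have U: "?U \<in> sets (angle_space k)"
    using fin near_regular_permute(1) by auto
  \<comment> \<open>The underlying space of \<open>uniform_angle\<close> is the whole line, so the
    angles lie in \<open>{0..<2 * pi}\<close> only almost surely.\<close>
  have "AE \<phi> in angle_space k. \<forall>j\<in>{1..k}. \<phi> j \<in> {0..<2 * pi}"
  proof (rule AE_finite_allI)
    fix j assume j: "j \<in> {1..k}"
    have "AE x in uniform_angle. x \<in> {0..<2 * pi}"
      by (intro AE_uniform_measureI) auto
    then show "AE \<phi> in angle_space k. \<phi> j \<in> {0..<2 * pi}"
      using j by (intro AE_PiM_component) (auto simp: prob_space_uniform_angle)
  qed simp
  then have "AE \<phi> in angle_space k. \<phi> \<in> ?E \<longrightarrow> \<phi> \<in> ?U"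
  proof eventually_elim
    case (elim \<phi>)
    show ?case
    proof
      assume E: "\<phi> \<in> ?E"
      let ?\<psi> = "\<phi>(0 := 0)"
      obtain \<sigma> where \<sigma>: "\<sigma> permutes {1..k}" and gaps: "\<And>j. j \<le> k \<Longrightarrow> 0 \<le> cyclic_gaps k (?\<psi> \<circ> \<sigma>) j"
        using exists_sorting_permutation[of ?\<psi> k] elim by auto
      have "gap_deficit (Suc k) (cyclic_gaps k (?\<psi> \<circ> \<sigma>)) \<le> s"
        using near_maximal_iff_gap_deficit[of \<sigma> k ?\<psi> s] \<sigma> gaps E by blast
      then have "gap_variation (Suc k) (cyclic_gaps k (?\<psi> \<circ> \<sigma>)) \<le> c"
        using H[OF gaps sum_cyclic_gaps] by blast
      then have "\<phi> \<in> near_regular k c \<sigma>"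
        using E by (simp only: near_regular_def bridge_permute[OF \<sigma>]) simp
      then show "\<phi> \<in> ?U" using \<sigma> by blast
    qed
  qed
  then have "measure (angle_space k) ?E \<le> measure (angle_space k) ?U"
    using U by (rule Q.finite_measure_mono_AE)
  also have "\<dots> \<le> (\<Sum>\<sigma>\<in>{\<sigma>. \<sigma> permutes {1..k}}. measure (angle_space k) (near_regular k c \<sigma>))"
    using fin near_regular_permute(1) by (intro Q.finite_measure_subadditive_finite) auto
  also have "\<dots> = (\<Sum>\<sigma>\<in>{\<sigma>. \<sigma> permutes {1..k}}. near_regular_const k * sqrt c ^ k)"
    using measure_near_regular[OF _ c] by (intro sum.cong) auto
  also have "\<dots> = fact k * near_regular_const k * sqrt c ^ k"
    by (simp only: sum_constant card_permutations_atLeastAtMost) simp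
  finally show ?thesis unfolding near_maximal_as_angles .
qed

text \<open>Small variation makes all gaps positive, so each ellipsoid consists of correctly sorted,
  nearly maximal configurations. The ellipsoids are disjoint and their probabilities add up
  exactly.\<close>

lemma measure_near_maximal_ge:
  fixes k :: nat
  assumes c: "0 \<le> c" "c < (2 * pi / real (Suc k))\<^sup>2"
    and H: "\<And>g. (\<Sum>j<Suc k. g j) = 2 * pi \<Longrightarrow>
        gap_variation (Suc k) g \<le> c \<Longrightarrow> gap_deficit (Suc k) g \<le> s"
  shows "fact k * near_regular_const k * sqrt c ^ k
    \<le> measure (Pi\<^sub>M {..k} (\<lambda>_. uniform_circle)) (near_maximal {..k} s \<inter> space (Pi\<^sub>M {..k} (\<lambda>_. borel)))"
proof -
  interpret Q: prob_space "angle_space k" by (rule prob_space_angle_space)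
  let ?E = "{\<phi> \<in> space (angle_space k). (\<lambda>j. cis ((\<phi>(0 := 0)) j)) \<in> near_maximal {..k} s}"
  let ?U = "\<Union>\<sigma>\<in>{\<sigma>. \<sigma> permutes {1..k}}. near_regular k c \<sigma>"
  have fin: "finite {\<sigma>. \<sigma> permutes {1..k}}" by (simp add: finite_permutations)
  have pos: "0 < cyclic_gaps k (\<phi>(0 := 0) \<circ> \<sigma>) j"
    and var: "gap_variation (Suc k) (cyclic_gaps k (\<phi>(0 := 0) \<circ> \<sigma>)) \<le> c"
    if "\<sigma> permutes {1..k}" "\<phi> \<in> near_regular k c \<sigma>" "j \<le> k" for \<sigma> \<phi> j
  proof -
    show *: "gap_variation (Suc k) (cyclic_gaps k (\<phi>(0 := 0) \<circ> \<sigma>)) \<le> c"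
      using that(2) unfolding near_regular_def bridge_permute[OF that(1)] by simp
    show "0 < cyclic_gaps k (\<phi>(0 := 0) \<circ> \<sigma>) j"
      using * c(2) that(3) by (intro cyclic_gaps_pos_of_small_variation) auto
  qed
  have sub: "?U \<subseteq> ?E"
  proof
    fix \<phi> assume "\<phi> \<in> ?U"
    then obtain \<sigma> where \<sigma>: "\<sigma> permutes {1..k}" "\<phi> \<in> near_regular k c \<sigma>" by blast
    have "gap_deficit (Suc k) (cyclic_gaps k (\<phi>(0 := 0) \<circ> \<sigma>)) \<le> s"
      using H[OF sum_cyclic_gaps] var[OF \<sigma>] by blast
    then have "(\<lambda>j. cis ((\<phi>(0 := 0)) j)) \<in> near_maximal {..k} s"
      using near_maximal_iff_gap_deficit[of \<sigma> k "\<phi>(0 := 0)" s] \<sigma>(1) pos[OF \<sigma>] less_imp_le by blast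
    then show "\<phi> \<in> ?E" using \<sigma>(2) by (simp add: near_regular_def)
  qed
  have E: "?E \<in> sets (angle_space k)" by (rule sets_near_maximal_angles)
  have "(\<Sum>\<sigma>\<in>{\<sigma>. \<sigma> permutes {1..k}}. near_regular_const k * sqrt c ^ k)
    = (\<Sum>\<sigma>\<in>{\<sigma>. \<sigma> permutes {1..k}}. measure (angle_space k) (near_regular k c \<sigma>))"
    using measure_near_regular[OF _ c] by (intro sum.cong) auto
  also have "\<dots> = measure (angle_space k) ?U"
  proof (rule Q.finite_measure_finite_Union[symmetric, OF fin])
    show "disjoint_family_on (near_regular k c) {\<sigma>. \<sigma> permutes {1..k}}"
      unfolding disjoint_family_on_def
    proof (intro ballI impI)
      fix \<sigma> \<tau> assume "\<sigma> \<in> {\<sigma>. \<sigma> permutes {1..k}}" "\<tau> \<in> {\<sigma>. \<sigma> permutes {1..k}}" "\<sigma> \<noteq> \<tau>"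
      then show "near_regular k c \<sigma> \<inter> near_regular k c \<tau> = {}"
        using sorting_permutation_unique[of \<sigma> k \<tau>] pos by blast
    qed
  qed (use near_regular_permute(1) in auto)
  also have "\<dots> \<le> measure (angle_space k) ?E"
    using sub E by (rule Q.finite_measure_mono)
  finally show ?thesis unfolding near_maximal_as_angles
    by (simp only: sum_constant card_permutations_atLeastAtMost) simp
qed

text \<open>Linearises the volume of the enlarged ellipsoid. A coefficient \<open>3 ^ k\<close>
  survives the induction because \<open>1 + c + c * x \<le> 3 * c\<close> for
  \<open>c \<ge> 1\<close> and \<open>x \<le> 1\<close>.\<close>

lemma sqrt_one_plus_power_le: "0 \<le> x \<Longrightarrow> x \<le> 1 \<Longrightarrow> sqrt (1 + x) ^ k \<le> 1 + 3 ^ k * x"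
proof -
  assume x: "0 \<le> x" "x \<le> 1"
  have "sqrt (1 + x) \<le> 1 + x" using x by (intro real_le_lsqrt) (auto simp: power2_eq_square algebra_simps)
  then have "sqrt (1 + x) ^ k \<le> (1 + x) ^ k" using x by (intro power_mono) auto
  also have "\<dots> \<le> 1 + 3 ^ k * x"
  proof (induction k)
    case (Suc k)
    have "(1 + x) ^ Suc k \<le> (1 + 3 ^ k * x) * (1 + x)" using Suc x by (simp add: mult.commute mult_left_mono)
    moreover have "(1 + 3 ^ k * x) * (1 + x) = 1 + x + 3 ^ k * x + 3 ^ k * x * x" by (simp add: algebra_simps)
    moreover have "3 ^ k * x * x \<le> 3 ^ k * x * 1" using x by (intro mult_left_mono) auto
    moreover have "1 * x \<le> 3 ^ k * x" using x by (intro mult_right_mono) auto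
    moreover have "3 ^ Suc k * x = 3 * (3 ^ k * x)" by simp
    ultimately show ?case by linarith
  qed (use x in simp)
  finally show ?thesis .
qed

lemma sqrt_one_minus_power_ge: "0 \<le> x \<Longrightarrow> x \<le> 1 \<Longrightarrow> 1 - 3 ^ k * x \<le> sqrt (1 - x) ^ k"
proof -
  assume x: "0 \<le> x" "x \<le> 1"
  have "1 - x \<le> sqrt (1 - x)" using x by (intro real_le_rsqrt) (auto simp: power2_eq_square algebra_simps mult_left_le)
  then have "(1 - x) ^ k \<le> sqrt (1 - x) ^ k" using x by (intro power_mono) auto
  moreover have "1 + real k * (- x) \<le> (1 + - x) ^ k" using x by (intro Bernoulli_inequality) auto
  moreover have "real k * x \<le> 3 ^ k * x"
  proof (intro mult_right_mono)
    have "real k \<le> 2 ^ k" using of_nat_less_two_power[of k, where 'a = real] by simp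
    also have "\<dots> \<le> 3 ^ k" by (rule power_mono) auto
    finally show "real k \<le> 3 ^ k" .
  qed (use x in auto)
  ultimately show ?thesis by simp
qed

text \<open>To leading order, deficit at most \<open>\<delta>^2\<close> means
  \<open>Q \<le> 4 * \<delta>^2 / sin (2 * pi / m)\<close>. The root of this radius bound gives the
  last factor, and \<open>fact k\<close> counts the orders.\<close>

definition near_maximal_const :: "nat \<Rightarrow> real" where
  "near_maximal_const k = fact k * near_regular_const k * sqrt (4 / sin (2 * pi / real (Suc k))) ^ k"

lemma near_regular_const_pos: "0 < near_regular_const k"
  by (simp add: near_regular_const_def)

text \<open>The event is enclosed between the ellipsoids
  \<open>Q \<le> b * \<delta>^2 * (1 - L * \<delta>)\<close> and
  \<open>Q \<le> b * \<delta>^2 * (1 + L * \<delta>)\<close>.\<close>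

lemma measure_near_maximal_asymptotics:
  assumes k: "k \<ge> 2"
  obtains C \<delta>0 where "\<delta>0 > 0"
    "\<And>\<delta>. 0 < \<delta> \<Longrightarrow> \<delta> < \<delta>0 \<Longrightarrow>
      \<bar>measure (Pi\<^sub>M {..k} (\<lambda>_. uniform_circle)) (near_maximal {..k} (\<delta>\<^sup>2) \<inter> space (Pi\<^sub>M {..k} (\<lambda>_. borel)))
        - near_maximal_const k * \<delta> ^ k\<bar> \<le> C * \<delta> ^ Suc k"
proof -
  let ?m = "Suc k"
  let ?a = "2 * pi / real ?m"
  define b where "b = 4 / sin ?a"
  have m: "?m \<ge> 3" using k by simp
  have b: "b > 0" using sin_regular_pos[OF m] by (simp add: b_def)
  obtain c where c: "c > 0"
    "\<And>g. (\<And>j. j < ?m \<Longrightarrow> 0 \<le> g j) \<Longrightarrow> (\<Sum>j<?m. g j) = 2 * pi \<Longrightarrow> c * gap_variation ?m g \<le> gap_deficit ?m g"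
    using gap_deficit_ge_variation[OF m] by blast
  have cubic: "\<bar>gap_deficit ?m g - gap_variation ?m g / b\<bar> \<le> real ?m * (q * \<delta>) ^ 3"
    if "(\<Sum>j<?m. g j) = 2 * pi" "gap_variation ?m g \<le> (q * \<delta>)\<^sup>2" "0 \<le> q * \<delta>" for g q \<delta>
  proof -
    have "sqrt (gap_variation ?m g) \<le> q * \<delta>" using that(2,3) by (rule real_le_lsqrt[rotated])
    then have "real ?m * sqrt (gap_variation ?m g) ^ 3 \<le> real ?m * (q * \<delta>) ^ 3"
      by (intro mult_left_mono power_mono) (auto simp: gap_variation_def sum_nonneg)
    moreover have "sin ?a / 4 * gap_variation ?m g = gap_variation ?m g / b" by (simp add: b_def)
    ultimately show ?thesis using gap_deficit_cubic[OF zero_less_Suc that(1)] by (metis order_trans)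
  qed
  \<comment> \<open>The first summand serves the upper bound, where
    \<open>Q \<le> \<delta>^2 / c\<close> is known from the global estimate. The second serves the
    lower bound, where \<open>Q \<le> b * \<delta>^2\<close>.\<close>
  define L where "L = real ?m * (1 / sqrt c) ^ 3 + real ?m * sqrt b ^ 3"
  have L: "0 < L" "real ?m * (1 / sqrt c) ^ 3 \<le> L" "real ?m * sqrt b ^ 3 \<le> L"
    using b c(1) by (auto simp: L_def add_pos_pos)
  \<comment> \<open>The first entry gives \<open>L * \<delta> \<le> 1\<close>; the second keeps even
    \<open>2 * b * \<delta>^2\<close> below \<open>?a^2\<close>, the limit for the exact ellipsoid
    volume.\<close>
  define \<delta>0 where "\<delta>0 = min (1 / L) (?a / sqrt (2 * b))"
  define \<kappa> where "\<kappa> = near_maximal_const k"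
  have \<kappa>: "\<kappa> = fact k * near_regular_const k * sqrt b ^ k" by (simp add: \<kappa>_def near_maximal_const_def b_def)
  have \<kappa>0: "\<kappa> \<ge> 0" using b near_regular_const_pos[of k] by (simp add: \<kappa>)
  have \<delta>0: "\<delta>0 > 0" using L b by (simp add: \<delta>0_def)
  moreover have "\<bar>measure (Pi\<^sub>M {..k} (\<lambda>_. uniform_circle)) (near_maximal {..k} (\<delta>\<^sup>2) \<inter> space (Pi\<^sub>M {..k} (\<lambda>_. borel)))
        - near_maximal_const k * \<delta> ^ k\<bar> \<le> \<kappa> * 3 ^ k * L * \<delta> ^ Suc k"
    (is "\<bar>?p - _\<bar> \<le> _") if \<delta>: "0 < \<delta>" "\<delta> < \<delta>0" for \<delta>
  proof -
    have L\<delta>: "0 \<le> L * \<delta>" "L * \<delta> \<le> 1" using \<delta> L by (auto simp: \<delta>0_def field_simps)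
    have sum_le: "b * \<delta>\<^sup>2 * (1 + x) < ?a\<^sup>2" if "x \<le> 1" for x
    proof -
      have "\<delta> < ?a / sqrt (2 * b)" using \<delta> by (simp add: \<delta>0_def)
      then have "\<delta> * sqrt (2 * b) < ?a" using b by (simp add: pos_less_divide_eq mult_ac)
      then have "(\<delta> * sqrt (2 * b))\<^sup>2 < ?a\<^sup>2" using \<delta> b by (intro power_strict_mono) auto
      then have "b * \<delta>\<^sup>2 * 2 < ?a\<^sup>2" using b by (simp add: power_mult_distrib mult_ac)
      moreover have "b * \<delta>\<^sup>2 * (1 + x) \<le> b * \<delta>\<^sup>2 * 2" using b that by (intro mult_left_mono) auto
      ultimately show ?thesis by linarith
    qed
    have sqrt_eq: "fact k * near_regular_const k * sqrt (b * \<delta>\<^sup>2 * (1 + x)) ^ k = \<kappa> * \<delta> ^ k * sqrt (1 + x) ^ k" for x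
      using \<delta>(1) by (simp add: \<kappa> real_sqrt_mult power_mult_distrib)
    have cube_le: "real ?m * (q * \<delta>) ^ 3 \<le> \<delta>\<^sup>2 * (L * \<delta>)" if "real ?m * q ^ 3 \<le> L" for q
    proof -
      have "real ?m * q ^ 3 * \<delta> ^ 3 \<le> L * \<delta> ^ 3" using that \<delta> by (intro mult_right_mono) auto
      then show ?thesis by (simp add: power_mult_distrib power2_eq_square power3_eq_cube mult_ac)
    qed
    have upper: "?p \<le> \<kappa> * \<delta> ^ k * sqrt (1 + L * \<delta>) ^ k"
      unfolding sqrt_eq[symmetric]
    proof (rule measure_near_maximal_le)
      show "0 \<le> b * \<delta>\<^sup>2 * (1 + L * \<delta>)" using b L\<delta> by simp
      show "b * \<delta>\<^sup>2 * (1 + L * \<delta>) < ?a\<^sup>2" using L\<delta> by (intro sum_le)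
      fix g :: "nat \<Rightarrow> real"
      assume g: "\<And>j. j \<le> k \<Longrightarrow> 0 \<le> g j" "(\<Sum>j<?m. g j) = 2 * pi" "gap_deficit ?m g \<le> \<delta>\<^sup>2"
      have "c * gap_variation ?m g \<le> \<delta>\<^sup>2" using c(2)[of g] g by force
      then have "gap_variation ?m g \<le> (1 / sqrt c * \<delta>)\<^sup>2"
        using c(1) by (simp add: power_mult_distrib power_divide field_simps)
      then have "\<bar>gap_deficit ?m g - gap_variation ?m g / b\<bar> \<le> \<delta>\<^sup>2 * (L * \<delta>)"
        using cubic[OF g(2), of "1 / sqrt c" \<delta>] cube_le[OF L(2)] c(1) \<delta>(1) by fastforce
      then have "gap_variation ?m g / b \<le> \<delta>\<^sup>2 * (1 + L * \<delta>)"
        using g(3) by (simp only: distrib_left mult_1_right)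
      then show "gap_variation ?m g \<le> b * \<delta>\<^sup>2 * (1 + L * \<delta>)"
        using b by (simp add: pos_divide_le_eq mult_ac)
    qed
    have lower: "\<kappa> * \<delta> ^ k * sqrt (1 + - (L * \<delta>)) ^ k \<le> ?p"
      unfolding sqrt_eq[symmetric]
    proof (rule measure_near_maximal_ge)
      show "0 \<le> b * \<delta>\<^sup>2 * (1 + - (L * \<delta>))" using b L\<delta> by simp
      show "b * \<delta>\<^sup>2 * (1 + - (L * \<delta>)) < ?a\<^sup>2" using L\<delta> by (intro sum_le) auto
      fix g :: "nat \<Rightarrow> real"
      assume g: "(\<Sum>j<?m. g j) = 2 * pi" "gap_variation ?m g \<le> b * \<delta>\<^sup>2 * (1 + - (L * \<delta>))"
      have "b * \<delta>\<^sup>2 * (1 + - (L * \<delta>)) \<le> b * \<delta>\<^sup>2 * 1" using b L\<delta> by (intro mult_left_mono) auto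
      also have "b * \<delta>\<^sup>2 * 1 = (sqrt b * \<delta>)\<^sup>2" using b by (simp add: power_mult_distrib)
      finally have "gap_variation ?m g \<le> (sqrt b * \<delta>)\<^sup>2" using g(2) by linarith
      then have "\<bar>gap_deficit ?m g - gap_variation ?m g / b\<bar> \<le> \<delta>\<^sup>2 * (L * \<delta>)"
        using cubic[OF g(1), of "sqrt b" \<delta>] cube_le[OF L(3)] b \<delta>(1) by fastforce
      moreover have "gap_variation ?m g / b \<le> \<delta>\<^sup>2 * (1 + - (L * \<delta>))"
        using g(2) b by (simp add: pos_divide_le_eq mult_ac)
      then have "gap_variation ?m g / b \<le> \<delta>\<^sup>2 - \<delta>\<^sup>2 * (L * \<delta>)" by (simp add: algebra_simps)
      ultimately show "gap_deficit ?m g \<le> \<delta>\<^sup>2" by linarith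
    qed
    have "?p \<le> \<kappa> * \<delta> ^ k * (1 + 3 ^ k * (L * \<delta>))"
      using upper mult_left_mono[OF sqrt_one_plus_power_le[OF L\<delta>, of k], of "\<kappa> * \<delta> ^ k"] \<kappa>0 \<delta>(1) by simp
    moreover have "\<kappa> * \<delta> ^ k * (1 - 3 ^ k * (L * \<delta>)) \<le> ?p"
      using lower mult_left_mono[OF sqrt_one_minus_power_ge[OF L\<delta>, of k], of "\<kappa> * \<delta> ^ k"] \<kappa>0 \<delta>(1) by simp
    moreover have "\<kappa> * \<delta> ^ k * (3 ^ k * (L * \<delta>)) = \<kappa> * 3 ^ k * L * \<delta> ^ Suc k" by simp
    ultimately show ?thesis
      unfolding \<kappa>_def[symmetric] abs_le_iff by (simp only: distrib_left right_diff_distrib mult_1_right) linarith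
  qed
  ultimately show thesis by (rule that)
qed

lemma measure_near_maximal_reindex:
  assumes I: "finite I" "card I = Suc k"
  shows "measure (Pi\<^sub>M I (\<lambda>_. uniform_circle)) (near_maximal I s \<inter> space (Pi\<^sub>M I (\<lambda>_. borel)))
    = measure (Pi\<^sub>M {..k} (\<lambda>_. uniform_circle)) (near_maximal {..k} s \<inter> space (Pi\<^sub>M {..k} (\<lambda>_. borel)))"
proof -
  let ?P = "\<lambda>K. Pi\<^sub>M K (\<lambda>_. uniform_circle)"
  obtain e where e: "bij_betw e {..k} I"
    using I by (metis bij_betw_iff_card card_atMost finite_atMost)
  let ?f = "\<lambda>u. \<lambda>n\<in>{..k}. u (e n)"
  have distr: "distr (?P I) (?P {..k}) ?f = ?P {..k}"
    using e prob_space_uniform_circle by (intro distr_PiM_reindex) (auto simp: bij_betw_def)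
  have f: "?f \<in> ?P I \<rightarrow>\<^sub>M ?P {..k}"
  proof (rule measurable_restrict)
    fix n assume "n \<in> {..k}"
    then have "e n \<in> I" using e by (auto dest: bij_betwE)
    then show "(\<lambda>u. u (e n)) \<in> ?P I \<rightarrow>\<^sub>M uniform_circle" by (rule measurable_component_singleton)
  qed
  let ?B = "near_maximal {..k} s \<inter> space (Pi\<^sub>M {..k} (\<lambda>_. borel))"
  have B: "?B \<in> sets (?P {..k})" unfolding sets_PiM_uniform_circle by (rule sets_near_maximal) auto
  have eq: "?f -` ?B \<inter> space (?P I) = near_maximal I s \<inter> space (Pi\<^sub>M I (\<lambda>_. borel))"
  proof -
    have "?f u ` {..k} = u ` I" for u :: "_ \<Rightarrow> complex" using e by (force simp: bij_betw_def)
    then have "?f u \<in> near_maximal {..k} s \<longleftrightarrow> u \<in> near_maximal I s" for u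
      by (simp only: near_maximal_def mem_Collect_eq I(2) card_atMost)
    then show ?thesis using measurable_space[OF f] unfolding space_PiM_uniform_circle by blast
  qed
  have "measure (?P {..k}) ?B = measure (distr (?P I) (?P {..k}) ?f) ?B" by (simp only: distr)
  also have "\<dots> = measure (?P I) (?f -` ?B \<inter> space (?P I))" using f B by (rule measure_distr)
  finally show ?thesis unfolding eq ..
qed

section \<open>Poisson approximation by the Chen--Stein method\<close>

text \<open>\<open>G k = stein_solution l k\<close> is the integral of \<open>u ^ k * exp (- l * u)\<close> over \<open>[0, 1]\<close>, expanded as a
  series. It solves \<open>l * G k = k * G (k - 1) + indicator {0} k - exp (- l)\<close>, the Stein equation of the event
  \<open>{0}\<close>, with the usual solution shifted by one index.\<close>

definition stein_solution :: "real \<Rightarrow> nat \<Rightarrow> real" where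
  "stein_solution l k = exp (- l) * (\<Sum>i. l ^ i * (fact k / fact (k + 1 + i)))"

lemma fact_ratio_le: "fact k / fact (k + 1 + i) \<le> (1 / fact i :: real)"
proof -
  have "fact k * fact i \<le> (fact (k + i) :: real)"
    using fact_fact_dvd_fact[of k i] by (metis dvd_imp_le fact_gt_zero of_nat_fact of_nat_le_iff of_nat_mult)
  also have "\<dots> \<le> fact (k + 1 + i)" by (intro fact_mono) auto
  finally show ?thesis by (simp add: field_simps del: fact_Suc)
qed

lemma summable_stein_solution:
  assumes "0 \<le> l"
  shows "summable (\<lambda>i. l ^ i * (fact k / fact (k + 1 + i)) :: real)"
proof (rule summable_comparison_test'[OF summable_exp[of l]])
  fix n show "norm (l ^ n * (fact k / fact (k + 1 + n)) :: real) \<le> inverse (fact n) * l ^ n"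
    using mult_left_mono[OF fact_ratio_le[of k n], of "l ^ n"] assms
    by (simp add: abs_mult power_abs divide_inverse mult_ac del: fact_Suc)
qed

lemma stein_solution_bounds:
  assumes "0 \<le> l"
  shows "0 \<le> stein_solution l k" "stein_solution l k \<le> 1"
proof -
  show "0 \<le> stein_solution l k"
    unfolding stein_solution_def using assms summable_stein_solution[OF assms]
    by (intro mult_nonneg_nonneg suminf_nonneg) auto
  have "(\<Sum>i. l ^ i * (fact k / fact (k + 1 + i))) \<le> (\<Sum>i. l ^ i * (1 / fact i))"
    using summable_exp[of l] fact_ratio_le[of k] assms
    by (intro suminf_le summable_stein_solution mult_left_mono) (auto simp: field_simps simp del: fact_Suc)
  also have "\<dots> = exp l" by (simp add: exp_def divide_inverse mult.commute)
  finally have "stein_solution l k \<le> exp (- l) * exp l"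
    unfolding stein_solution_def by (intro mult_left_mono) auto
  then show "stein_solution l k \<le> 1" by (simp add: exp_minus)
qed

lemma stein_solution_0:
  assumes "0 \<le> l"
  shows "l * stein_solution l 0 = 1 - exp (- l)"
proof -
  have s: "summable (\<lambda>i. l ^ i * (1 / fact i))" using summable_exp[of l] by (simp add: field_simps)
  have "l * (\<Sum>i. l ^ i * (fact 0 / fact (0 + 1 + i))) = (\<Sum>i. l ^ Suc i * (1 / fact (Suc i)))"
    by (subst suminf_mult[symmetric, OF summable_stein_solution[OF assms]]) (simp add: mult.assoc)
  also have "\<dots> = (\<Sum>i. l ^ i * (1 / fact i)) - 1"
    using suminf_split_head[OF s] by simp
  also have "(\<Sum>i. l ^ i * (1 / fact i)) = exp l" by (simp add: exp_def divide_inverse mult.commute)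
  finally have "l * stein_solution l 0 = exp (- l) * (exp l - 1)"
    unfolding stein_solution_def by (metis mult.left_commute)
  then show ?thesis by (simp add: exp_minus right_diff_distrib)
qed

lemma stein_solution_Suc:
  assumes "0 \<le> l"
  shows "l * stein_solution l (Suc k) = real (Suc k) * stein_solution l k - exp (- l)"
proof -
  note s = summable_stein_solution[OF assms]
  have f: "real (Suc k) * (fact k / fact (k + 1 + i)) = fact (Suc k) / fact (k + 1 + i)" for i
    by simp
  have "real (Suc k) * (\<Sum>i. l ^ i * (fact k / fact (k + 1 + i)))
     = (\<Sum>i. l ^ i * (fact (Suc k) / fact (k + 1 + i)))"
    unfolding f[symmetric] by (subst suminf_mult[symmetric, OF s]) (simp only: mult.left_commute)
  also have "\<dots> = 1 + (\<Sum>i. l ^ Suc i * (fact (Suc k) / fact (k + 1 + Suc i)))"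
  proof -
    have "summable (\<lambda>i. l ^ i * (fact (Suc k) / fact (k + 1 + i)))"
      unfolding f[symmetric] using summable_mult[OF s, of "real (Suc k)"] by (simp only: mult.left_commute)
    from suminf_split_head[OF this] show ?thesis by simp
  qed
  also have "(\<Sum>i. l ^ Suc i * (fact (Suc k) / fact (k + 1 + Suc i))) = l * (\<Sum>i. l ^ i * (fact (Suc k) / fact (Suc k + 1 + i)))"
    by (subst suminf_mult[symmetric, OF s]) (simp add: mult.assoc)
  finally have "exp (- l) * (real (Suc k) * (\<Sum>i. l ^ i * (fact k / fact (k + 1 + i))))
     = exp (- l) + exp (- l) * (l * (\<Sum>i. l ^ i * (fact (Suc k) / fact (Suc k + 1 + i))))"
    by (simp only: distrib_left mult_1_right)
  then show ?thesis unfolding stein_solution_def by (simp add: mult.left_commute)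
qed

context prob_space
begin

lemma abs_integral_diff_le_prob:
  fixes f g :: "'a \<Rightarrow> real"
  assumes [measurable]: "f \<in> borel_measurable M" "g \<in> borel_measurable M" and B: "B \<in> events"
    and f: "\<And>\<omega>. f \<omega> \<in> {0..1}" and g: "\<And>\<omega>. g \<omega> \<in> {0..1}"
    and eq: "\<And>\<omega>. \<omega> \<in> space M \<Longrightarrow> \<omega> \<notin> B \<Longrightarrow> f \<omega> = g \<omega>"
  shows "\<bar>expectation f - expectation g\<bar> \<le> prob B"
proof -
  have i: "integrable M f" "integrable M g"
    using f g by (auto intro!: integrable_const_bound[where B = 1])
  have "\<bar>expectation f - expectation g\<bar> = \<bar>expectation (\<lambda>\<omega>. f \<omega> - g \<omega>)\<bar>" using i by simp
  also have "\<dots> \<le> expectation (\<lambda>\<omega>. \<bar>f \<omega> - g \<omega>\<bar>)" by (rule integral_abs_bound)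
  also have "\<dots> \<le> expectation (indicator B)"
  proof (rule integral_mono)
    fix \<omega> assume "\<omega> \<in> space M"
    then show "\<bar>f \<omega> - g \<omega>\<bar> \<le> indicator B \<omega>"
      using f[of \<omega>] g[of \<omega>] eq[of \<omega>] by (cases "\<omega> \<in> B") auto
  qed (use i B in \<open>auto intro: integrable_real_indicator simp: emeasure_eq_measure\<close>)
  also have "\<dots> = prob B" using B by simp
  finally show ?thesis .
qed

lemma prob_Int_UN_le:
  assumes "finite J" "B \<in> events" "\<And>j. j \<in> J \<Longrightarrow> A j \<in> events"
  shows "prob (B \<inter> (\<Union>j\<in>J. A j)) \<le> (\<Sum>j\<in>J. prob (B \<inter> A j))"
  unfolding Int_UN_distrib using assms by (intro finite_measure_subadditive_finite) auto

text \<open>Taking expectations in the Stein equation for the count \<open>W J\<close> writes the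
  error as the sum of \<open>prob (A i) * E G(W) - E (indicator (A i) * G(W - 1))\<close>. Both
  arguments are replaced by the count outside \<open>N i\<close>, which is independent of
  \<open>A i\<close>, so the remainders cancel. As \<open>G\<close> takes values in
  \<open>{0..1}\<close>, each replacement costs at most the probability that the argument
  changes.\<close>

lemma chen_stein_no_event:
  assumes J: "finite J" and A: "\<And>i. i \<in> J \<Longrightarrow> A i \<in> events"
    and N: "\<And>i. i \<in> J \<Longrightarrow> i \<in> N i" "\<And>i. i \<in> J \<Longrightarrow> N i \<subseteq> J"
    and indep: "\<And>i k. i \<in> J \<Longrightarrow>
        prob (A i \<inter> {\<omega> \<in> space M. card {j \<in> J - N i. \<omega> \<in> A j} = k})
          = prob (A i) * prob {\<omega> \<in> space M. card {j \<in> J - N i. \<omega> \<in> A j} = k}"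
  shows "\<bar>prob (space M - (\<Union>i\<in>J. A i)) - exp (- (\<Sum>i\<in>J. prob (A i)))\<bar>
    \<le> (\<Sum>i\<in>J. (\<Sum>j\<in>N i. prob (A i) * prob (A j)) + (\<Sum>j\<in>N i - {i}. prob (A i \<inter> A j)))"
proof -
  define l where "l = (\<Sum>i\<in>J. prob (A i))"
  have l: "0 \<le> l" by (simp add: l_def sum_nonneg)
  define G where "G = stein_solution l"
  have G: "G k \<in> {0..1}" for k using stein_solution_bounds[OF l] by (auto simp: G_def)
  define W where "W S \<omega> = card {j \<in> S. \<omega> \<in> A j}" for S \<omega>
  have W_sum: "W S \<omega> = (\<Sum>j\<in>S. indicator (A j) \<omega>)" if "finite S" for S \<omega>
    using that by (simp add: W_def indicator_def sum.If_cases Int_def)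
  have meas: "W S \<in> measurable M (count_space UNIV)" if "S \<subseteq> J" for S
  proof -
    have "finite S" using that J finite_subset by blast
    moreover have [measurable]: "A j \<in> events" if "j \<in> S" for j using A that \<open>S \<subseteq> J\<close> by auto
    then have "(\<lambda>\<omega>. \<Sum>j\<in>S. if \<omega> \<in> A j then 1 else 0 :: nat) \<in> measurable M (count_space UNIV)"
      by measurable
    moreover have "W S = (\<lambda>\<omega>. \<Sum>j\<in>S. if \<omega> \<in> A j then 1 else 0)" if "finite S"
      using that by (intro ext) (simp add: W_sum indicator_def of_bool_def)
    ultimately show ?thesis by simp
  qed
  have meas_G [measurable]: "(\<lambda>\<omega>. G (f (W S \<omega>))) \<in> borel_measurable M" if "S \<subseteq> J" for S f
    using measurable_compose[OF meas[OF that], of "\<lambda>k. G (f k)"] by simp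
  have int_G: "integrable M (\<lambda>\<omega>. G (f (W S \<omega>)))" if "S \<subseteq> J" for S f
    using G meas_G[OF that] by (intro integrable_const_bound[where B = 1]) auto
  have int_1G: "integrable M (\<lambda>\<omega>. indicator (A i) \<omega> * G (f (W S \<omega>)))" if "S \<subseteq> J" "i \<in> J" for S i f
    using integrable_real_mult_indicator[OF A[OF that(2)] int_G[OF that(1)]] by (simp add: mult.commute)
  have W0: "space M - (\<Union>i\<in>J. A i) = {\<omega> \<in> space M. W J \<omega> = 0}"
    using J by (auto simp: W_def)
  have W0_ev: "{\<omega> \<in> space M. W J \<omega> = 0} \<in> events"
    unfolding W0[symmetric] using A J by auto
  \<comment> \<open>The truncated difference \<open>W J \<omega> - 1\<close> is harmless at
    \<open>W J \<omega> = 0\<close>, because every indicator in the sum is then zero.\<close>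
  have eq: "l * G (W J \<omega>) = (indicator {\<omega> \<in> space M. W J \<omega> = 0} \<omega> - exp (- l))
     + (\<Sum>i\<in>J. indicator (A i) \<omega> * G (W J \<omega> - 1))" if "\<omega> \<in> space M" for \<omega>
  proof -
    have "(\<Sum>i\<in>J. indicator (A i) \<omega> * G (W J \<omega> - 1)) = real (W J \<omega>) * G (W J \<omega> - 1)"
      unfolding W_sum[OF J] sum_distrib_right[symmetric] by (simp add: of_nat_sum indicator_def if_distrib cong: if_cong)
    then show ?thesis
      using that stein_solution_0[OF l] stein_solution_Suc[OF l] by (cases "W J \<omega>") (auto simp: G_def)
  qed
  have "l * expectation (\<lambda>\<omega>. G (W J \<omega>)) = expectation (\<lambda>\<omega>. l * G (W J \<omega>))" by simp
  also have "\<dots> = expectation (\<lambda>\<omega>. (indicator {\<omega> \<in> space M. W J \<omega> = 0} \<omega> - exp (- l))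
     + (\<Sum>i\<in>J. indicator (A i) \<omega> * G (W J \<omega> - 1)))"
    by (intro Bochner_Integration.integral_cong eq) auto
  also have "\<dots> = (prob {\<omega> \<in> space M. W J \<omega> = 0} - exp (- l))
      + (\<Sum>i\<in>J. expectation (\<lambda>\<omega>. indicator (A i) \<omega> * G (W J \<omega> - 1)))"
  proof -
    have "integrable M (indicator {\<omega> \<in> space M. W J \<omega> = 0} :: _ \<Rightarrow> real)"
      using W0_ev by (intro integrable_real_indicator) (auto simp: emeasure_eq_measure)
    moreover have "integrable M (\<lambda>\<omega>. indicator (A i) \<omega> * G (W J \<omega> - 1))" if "i \<in> J" for i
      using int_1G[of J i "\<lambda>k. k - 1"] that by simp
    ultimately show ?thesis using W0_ev by (simp add: prob_space)
  qed
  finally have main: "prob {\<omega> \<in> space M. W J \<omega> = 0} - exp (- l)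
      = (\<Sum>i\<in>J. prob (A i) * expectation (\<lambda>\<omega>. G (W J \<omega>)) - expectation (\<lambda>\<omega>. indicator (A i) \<omega> * G (W J \<omega> - 1)))"
    by (simp add: l_def sum_subtractf sum_distrib_right)
  have bound: "\<bar>prob (A i) * expectation (\<lambda>\<omega>. G (W J \<omega>)) - expectation (\<lambda>\<omega>. indicator (A i) \<omega> * G (W J \<omega> - 1))\<bar>
    \<le> (\<Sum>j\<in>N i. prob (A i) * prob (A j)) + (\<Sum>j\<in>N i - {i}. prob (A i \<inter> A j))" if i: "i \<in> J" for i
  proof -
    let ?S = "J - N i"
    have finN: "finite (N i)" using N(2)[OF i] J finite_subset by blast
    have NA: "A j \<in> events" if "j \<in> N i" for j using that N(2)[OF i] A by auto
    have "\<bar>expectation (\<lambda>\<omega>. G (W J \<omega>)) - expectation (\<lambda>\<omega>. G (W ?S \<omega>))\<bar> \<le> prob (\<Union>j\<in>N i. A j)"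
    proof (rule abs_integral_diff_le_prob)
      show "G (W J \<omega>) = G (W ?S \<omega>)" if "\<omega> \<notin> (\<Union>j\<in>N i. A j)" for \<omega>
      proof -
        have "{j \<in> J. \<omega> \<in> A j} = {j \<in> ?S. \<omega> \<in> A j}" using that by auto
        then show ?thesis by (simp add: W_def)
      qed
    qed (use G finN NA meas_G[of J "\<lambda>k. k"] meas_G[of ?S "\<lambda>k. k"] in auto)
    also have "\<dots> \<le> (\<Sum>j\<in>N i. prob (A j))"
      using finN NA by (intro finite_measure_subadditive_finite) auto
    finally have 1: "\<bar>prob (A i) * expectation (\<lambda>\<omega>. G (W J \<omega>)) - prob (A i) * expectation (\<lambda>\<omega>. G (W ?S \<omega>))\<bar>
        \<le> (\<Sum>j\<in>N i. prob (A i) * prob (A j))"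
      by (simp add: right_diff_distrib[symmetric] abs_mult sum_distrib_left[symmetric] mult_left_mono)
    have "\<bar>expectation (\<lambda>\<omega>. indicator (A i) \<omega> * G (W J \<omega> - 1)) - expectation (\<lambda>\<omega>. indicator (A i) \<omega> * G (W ?S \<omega>))\<bar>
       \<le> prob (A i \<inter> (\<Union>j\<in>N i - {i}. A j))"
    proof (rule abs_integral_diff_le_prob)
      show "indicator (A i) \<omega> * G (W J \<omega> - 1) = indicator (A i) \<omega> * G (W ?S \<omega>)"
        if "\<omega> \<notin> A i \<inter> (\<Union>j\<in>N i - {i}. A j)" for \<omega>
      proof (cases "\<omega> \<in> A i")
        case True
        then have "{j \<in> J. \<omega> \<in> A j} = insert i {j \<in> ?S. \<omega> \<in> A j}" using that i by auto
        moreover have "i \<notin> {j \<in> ?S. \<omega> \<in> A j}" using N(1)[OF i] by auto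
        ultimately have "W J \<omega> - 1 = W ?S \<omega>" using J by (simp add: W_def)
        then show ?thesis by simp
      qed auto
      show "indicator (A i) \<omega> * G (W J \<omega> - 1) \<in> {0..1}" "indicator (A i) \<omega> * G (W ?S \<omega>) \<in> {0..1}" for \<omega>
        using G by (auto simp: indicator_def)
      show "(\<lambda>\<omega>. indicator (A i) \<omega> * G (W J \<omega> - 1)) \<in> borel_measurable M"
        using int_1G[of J i "\<lambda>k. k - 1"] i by auto
      show "(\<lambda>\<omega>. indicator (A i) \<omega> * G (W ?S \<omega>)) \<in> borel_measurable M"
        using int_1G[of ?S i "\<lambda>k. k"] i by auto
      show "A i \<inter> (\<Union>j\<in>N i - {i}. A j) \<in> events" using A[OF i] NA finN by auto
    qed
    also have "\<dots> \<le> (\<Sum>j\<in>N i - {i}. prob (A i \<inter> A j))"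
      using finN NA A[OF i] by (intro prob_Int_UN_le) auto
    finally have 2: "\<bar>expectation (\<lambda>\<omega>. indicator (A i) \<omega> * G (W J \<omega> - 1)) - expectation (\<lambda>\<omega>. indicator (A i) \<omega> * G (W ?S \<omega>))\<bar>
       \<le> (\<Sum>j\<in>N i - {i}. prob (A i \<inter> A j))" .
    have "expectation (\<lambda>\<omega>. indicator (A i) \<omega> * G (W ?S \<omega>)) = prob (A i) * expectation (\<lambda>\<omega>. G (W ?S \<omega>))"
    proof -
      define E where "E k = {\<omega> \<in> space M. W ?S \<omega> = k}" for k
      have E: "E k \<in> events" for k
        unfolding E_def using meas[of ?S] by measurable
      have le: "W ?S \<omega> \<le> card J" for \<omega>
        unfolding W_def using J by (intro card_mono) auto
      have sum_E: "G (W ?S \<omega>) = (\<Sum>k\<le>card J. G k * indicator (E k) \<omega>)" if "\<omega> \<in> space M" for \<omega>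
      proof -
        have "(\<Sum>k\<le>card J. G k * indicator (E k) \<omega>) = (\<Sum>k\<le>card J. if k = W ?S \<omega> then G k else 0)"
          using that by (intro sum.cong) (auto simp: E_def)
        then show ?thesis using le[of \<omega>] by simp
      qed
      have "expectation (\<lambda>\<omega>. indicator (A i) \<omega> * G (W ?S \<omega>)) = expectation (\<lambda>\<omega>. \<Sum>k\<le>card J. G k * indicator (A i \<inter> E k) \<omega>)"
        by (intro Bochner_Integration.integral_cong refl)
           (simp only: sum_E sum_distrib_left indicator_inter_arith mult_ac)
      also have "\<dots> = (\<Sum>k\<le>card J. G k * prob (A i \<inter> E k))"
        using E A[OF i] by (subst Bochner_Integration.integral_sum) (auto simp: emeasure_eq_measure)
      also have "\<dots> = prob (A i) * (\<Sum>k\<le>card J. G k * prob (E k))"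
        using indep[OF i] unfolding E_def W_def by (simp add: sum_distrib_left mult_ac)
      also have "(\<Sum>k\<le>card J. G k * prob (E k)) = expectation (\<lambda>\<omega>. \<Sum>k\<le>card J. G k * indicator (E k) \<omega>)"
        using E by (subst Bochner_Integration.integral_sum) (auto simp: emeasure_eq_measure)
      also have "\<dots> = expectation (\<lambda>\<omega>. G (W ?S \<omega>))"
        by (intro Bochner_Integration.integral_cong refl) (simp add: sum_E)
      finally show ?thesis .
    qed
    with 1 2 show ?thesis by linarith
  qed
  have "\<bar>prob {\<omega> \<in> space M. W J \<omega> = 0} - exp (- l)\<bar>
    \<le> (\<Sum>i\<in>J. \<bar>prob (A i) * expectation (\<lambda>\<omega>. G (W J \<omega>)) - expectation (\<lambda>\<omega>. indicator (A i) \<omega> * G (W J \<omega> - 1))\<bar>)"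
    unfolding main by (rule sum_abs)
  also have "\<dots> \<le> (\<Sum>i\<in>J. (\<Sum>j\<in>N i. prob (A i) * prob (A j)) + (\<Sum>j\<in>N i - {i}. prob (A i \<inter> A j)))"
    by (intro sum_mono bound)
  finally show ?thesis unfolding W0 l_def .
qed

end

section \<open>Counting nearly maximal polygons in a sample\<close>

lemma binomial_fact_lower:
  assumes "m \<le> n"
  shows "real n * (real n ^ m - fact m * real (n choose m)) \<le> (real m)\<^sup>2 * real n ^ m"
  using assms
proof (induction m)
  case (Suc m)
  have "Suc m * (n choose Suc m) = (n - m) * (n choose m)"
    using binomial_absorb_comp[of n m] Suc_times_binomial_eq[of "n - 1" m] Suc.prems
    by (cases n) (auto simp: Suc_times_binomial_eq binomial_absorb_comp)
  then have "real (Suc m) * real (n choose Suc m) = (real n - real m) * real (n choose m)"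
    using Suc.prems by (metis Suc_leD of_nat_diff of_nat_mult)
  then have f: "fact (Suc m) * real (n choose Suc m) = (real n - real m) * (fact m * real (n choose m))"
    by (simp add: mult_ac)
  have le: "fact m * real (n choose m) \<le> real n ^ m"
    using binomial_fact_pow[of n m] by (metis mult.commute of_nat_fact of_nat_le_iff of_nat_mult of_nat_power)
  have "real n ^ Suc m - fact (Suc m) * real (n choose Suc m)
    = real n * (real n ^ m - fact m * real (n choose m)) + real m * (fact m * real (n choose m))"
    unfolding f by (simp add: algebra_simps)
  also have "\<dots> \<le> (real m)\<^sup>2 * real n ^ m + real m * real n ^ m"
    using Suc le by (intro add_mono mult_left_mono) auto
  also have "\<dots> \<le> (real (Suc m))\<^sup>2 * real n ^ m"
    unfolding distrib_right[symmetric] by (intro mult_right_mono) (auto simp: power2_eq_square algebra_simps)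
  finally have "real n * (real n ^ Suc m - fact (Suc m) * real (n choose Suc m)) \<le> real n * ((real (Suc m))\<^sup>2 * real n ^ m)"
    by (intro mult_left_mono) auto
  then show ?case by (simp add: mult_ac)
qed simp

lemma sum_pairs_card_Un_le:
  fixes f :: "nat \<Rightarrow> real"
  assumes X: "finite X" and f: "\<And>r. 0 \<le> f r"
    and S: "\<And>I J. (I, J) \<in> S \<Longrightarrow> I \<subseteq> X \<and> J \<subseteq> X \<and> card (I \<union> J) \<in> {a..b}"
  shows "(\<Sum>(I, J)\<in>S. f (card (I \<union> J))) \<le> 4 ^ b * (\<Sum>r=a..b. real (card X) ^ r * f r)"
proof -
  have "S \<subseteq> Pow X \<times> Pow X" using S by auto
  then have finS: "finite S" using X finite_subset by blast
  let ?R = "{R. R \<subseteq> X \<and> card R \<in> {a..b}}"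
  have finR: "finite ?R" using X by simp
  have "(\<Sum>(I, J)\<in>S. f (card (I \<union> J))) = (\<Sum>R\<in>?R. \<Sum>(I, J)\<in>{p \<in> S. fst p \<union> snd p = R}. f (card (I \<union> J)))"
    using finS finR
  proof (rule sum.group[symmetric])
    show "(\<lambda>p. fst p \<union> snd p) ` S \<subseteq> ?R" using S by force
  qed
  also have "\<dots> \<le> (\<Sum>R\<in>?R. 4 ^ b * f (card R))"
  proof (rule sum_mono)
    fix R assume R: "R \<in> ?R"
    then have finR: "finite R" using X finite_subset by blast
    have "(\<Sum>(I, J)\<in>{p \<in> S. fst p \<union> snd p = R}. f (card (I \<union> J))) = (\<Sum>p\<in>{p \<in> S. fst p \<union> snd p = R}. f (card R))"
      by (intro sum.cong) auto
    also have "\<dots> = real (card {p \<in> S. fst p \<union> snd p = R}) * f (card R)" by simp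
    also have "real (card {p \<in> S. fst p \<union> snd p = R}) \<le> real (card (Pow R \<times> Pow R))"
      using finR by (intro of_nat_mono card_mono) auto
    also have "\<dots> = 4 ^ card R"
      using finR by (simp add: card_cartesian_product card_Pow power_mult_distrib[symmetric])
    also have "\<dots> \<le> 4 ^ b" using R by (intro power_increasing) auto
    finally show "(\<Sum>(I, J)\<in>{p \<in> S. fst p \<union> snd p = R}. f (card (I \<union> J))) \<le> 4 ^ b * f (card R)"
      using f by (simp add: mult_right_mono)
  qed
  also have "\<dots> = 4 ^ b * (\<Sum>R\<in>?R. f (card R))" by (simp add: sum_distrib_left)
  also have "(\<Sum>R\<in>?R. f (card R)) = (\<Sum>r=a..b. \<Sum>R\<in>{R \<in> ?R. card R = r}. f (card R))"
    using finR by (subst sum.group) auto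
  also have "\<dots> \<le> (\<Sum>r=a..b. real (card X) ^ r * f r)"
  proof (rule sum_mono)
    fix r assume r: "r \<in> {a..b}"
    have "{R \<in> ?R. card R = r} = {R. R \<subseteq> X \<and> card R = r}" using r by auto
    then have "(\<Sum>R\<in>{R \<in> ?R. card R = r}. f (card R)) = real (card X choose r) * f r"
      using n_subsets[OF X, of r] by simp
    also have "real (card X choose r) \<le> real (card X) ^ r"
    proof (cases "r \<le> card X")
      case True
      then show ?thesis using binomial_le_pow[of r "card X"] by (metis of_nat_le_iff of_nat_power)
    qed (simp add: binomial_eq_0)
    finally show "(\<Sum>R\<in>{R \<in> ?R. card R = r}. f (card R)) \<le> real (card X) ^ r * f r"
      using f by (simp add: mult_right_mono)
  qed
  finally show ?thesis by (simp add: mult_left_mono)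
qed

locale uniform_circle_sample = prob_space M for M :: "'a measure" +
  fixes U :: "nat \<Rightarrow> 'a \<Rightarrow> complex"
  assumes indep_U: "indep_vars (\<lambda>_. borel) U {1..}"
    and distr_U: "\<And>i. i \<ge> 1 \<Longrightarrow> distr M borel (U i) = uniform_circle"
begin

lemma measurable_U [measurable]: "i \<ge> 1 \<Longrightarrow> U i \<in> borel_measurable M"
  using indep_U by (auto simp: indep_vars_def)

lemma distr_sample:
  assumes "I \<subseteq> {1..}" "I \<noteq> {}"
  shows "distr M (Pi\<^sub>M I (\<lambda>_. borel)) (\<lambda>\<omega>. \<lambda>i\<in>I. U i \<omega>) = Pi\<^sub>M I (\<lambda>_. uniform_circle)"
proof -
  have "indep_vars (\<lambda>_. borel) U I" using indep_U assms(1) by (rule indep_vars_subset)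
  then have "distr M (Pi\<^sub>M I (\<lambda>_. borel)) (\<lambda>\<omega>. \<lambda>i\<in>I. U i \<omega>) = (\<Pi>\<^sub>M i\<in>I. distr M borel (U i))"
    using assms by (subst (asm) indep_vars_iff_distr_eq_PiM') auto
  also have "\<dots> = Pi\<^sub>M I (\<lambda>_. uniform_circle)"
    using assms(1) distr_U by (intro PiM_cong) auto
  finally show ?thesis .
qed

lemma measurable_sample: "I \<subseteq> {1..} \<Longrightarrow> (\<lambda>\<omega>. \<lambda>i\<in>I. U i \<omega>) \<in> M \<rightarrow>\<^sub>M Pi\<^sub>M I (\<lambda>_. borel)"
  by (intro measurable_restrict measurable_U) auto

lemma prob_sample:
  assumes "I \<subseteq> {1..}" "I \<noteq> {}" "B \<in> sets (Pi\<^sub>M I (\<lambda>_. borel))"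
  shows "prob {\<omega> \<in> space M. (\<lambda>i\<in>I. U i \<omega>) \<in> B} = measure (Pi\<^sub>M I (\<lambda>_. uniform_circle)) B"
  unfolding distr_sample[OF assms(1,2), symmetric]
  using measure_distr[OF measurable_sample[OF assms(1)] assms(3)]
  by (simp add: vimage_def Int_def conj_commute)

definition large :: "real \<Rightarrow> nat set \<Rightarrow> 'a set" where
  "large s I = {\<omega> \<in> space M. (\<lambda>i. U i \<omega>) \<in> near_maximal I s}"

lemma near_maximal_cong: "(\<And>i. i \<in> I \<Longrightarrow> u i = v i) \<Longrightarrow> u \<in> near_maximal I s \<longleftrightarrow> v \<in> near_maximal I s"
  by (simp add: near_maximal_def cong: image_cong)

lemma large_eq:
  assumes "I \<subseteq> J"
  shows "large s I = {\<omega> \<in> space M. (\<lambda>i\<in>J. U i \<omega>) \<in> near_maximal I s \<inter> space (Pi\<^sub>M J (\<lambda>_. borel))}"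
proof -
  have "(\<lambda>i. U i \<omega>) \<in> near_maximal I s \<longleftrightarrow> (\<lambda>i\<in>J. U i \<omega>) \<in> near_maximal I s" for \<omega>
    using assms by (intro near_maximal_cong) auto
  then show ?thesis by (auto simp: large_def space_PiM)
qed

lemma large_event:
  assumes "finite I" "I \<subseteq> {1..}"
  shows "large s I \<in> events"
proof -
  have "(\<lambda>\<omega>. \<lambda>i\<in>I. U i \<omega>) -` (near_maximal I s \<inter> space (Pi\<^sub>M I (\<lambda>_. borel))) \<inter> space M \<in> events"
    using measurable_sample[OF assms(2)] sets_near_maximal[OF assms(1) order_refl] by (rule measurable_sets)
  then show ?thesis unfolding large_eq[OF order_refl] by (simp add: vimage_def Int_def conj_commute)
qed

lemma prob_large:
  assumes "finite I" "I \<subseteq> {1..}" "card I = Suc k"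
  shows "prob (large s I) = measure (Pi\<^sub>M {..k} (\<lambda>_. uniform_circle)) (near_maximal {..k} s \<inter> space (Pi\<^sub>M {..k} (\<lambda>_. borel)))"
proof -
  have "I \<noteq> {}" using assms(3) by auto
  then have "prob (large s I) = measure (Pi\<^sub>M I (\<lambda>_. uniform_circle)) (near_maximal I s \<inter> space (Pi\<^sub>M I (\<lambda>_. borel)))"
    unfolding large_eq[OF order_refl] using assms sets_near_maximal[OF assms(1) order_refl]
    by (intro prob_sample) auto
  then show ?thesis using measure_near_maximal_reindex[OF assms(1,3)] by simp
qed

lemma AE_U_norm: "AE \<omega> in M. \<forall>i\<in>{1..}. norm (U i \<omega>) = 1"
proof (rule AE_ball_countable')
  fix i :: nat assume i: "i \<in> {1..}"
  have "AE w in distr M borel (U i). norm w = 1"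
    using AE_uniform_circle_norm distr_U[of i] i by (metis atLeast_iff)
  then show "AE \<omega> in M. norm (U i \<omega>) = 1"
    using i by (subst (asm) AE_distr_iff) auto
qed simp

lemma prob_powers_close_le:
  assumes "m \<ge> 1" "\<delta> \<ge> 0" "finite S" "i \<notin> S" "insert i S \<subseteq> {1..}"
  shows "{\<omega> \<in> space M. \<forall>j\<in>S. norm (U j \<omega> ^ m - U i \<omega> ^ m) \<le> \<delta>} \<in> events"
    and "prob {\<omega> \<in> space M. \<forall>j\<in>S. norm (U j \<omega> ^ m - U i \<omega> ^ m) \<le> \<delta>} \<le> (2 * \<delta>) ^ card S"
proof -
  let ?B = "{u \<in> space (Pi\<^sub>M (insert i S) (\<lambda>_. borel :: complex measure)). \<forall>j\<in>S. norm (u j ^ m - u i ^ m) \<le> \<delta>}"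
  interpret P: prob_space "Pi\<^sub>M (insert i S) (\<lambda>_. uniform_circle)"
    by (intro prob_space_PiM prob_space_uniform_circle)
  have [measurable]: "?B \<in> sets (Pi\<^sub>M (insert i S) (\<lambda>_. borel))"
    using assms(3) by measurable
  have eq: "{\<omega> \<in> space M. \<forall>j\<in>S. norm (U j \<omega> ^ m - U i \<omega> ^ m) \<le> \<delta>}
      = {\<omega> \<in> space M. (\<lambda>j\<in>insert i S. U j \<omega>) \<in> ?B}"
    by (auto simp: space_PiM)
  show "{\<omega> \<in> space M. \<forall>j\<in>S. norm (U j \<omega> ^ m - U i \<omega> ^ m) \<le> \<delta>} \<in> events"
    unfolding eq using measurable_sets[OF measurable_sample[OF assms(5)], of ?B]
    by (simp add: vimage_def Int_def conj_commute)
  have "prob {\<omega> \<in> space M. \<forall>j\<in>S. norm (U j \<omega> ^ m - U i \<omega> ^ m) \<le> \<delta>} = measure (Pi\<^sub>M (insert i S) (\<lambda>_. uniform_circle)) ?B"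
    unfolding eq using assms(5) by (intro prob_sample) auto
  also have "\<dots> \<le> (2 * \<delta>) ^ card S"
    using emeasure_PiM_powers_close[OF assms(1,2,3,4)] assms(2)
    by (simp add: P.emeasure_eq_measure)
  finally show "prob {\<omega> \<in> space M. \<forall>j\<in>S. norm (U j \<omega> ^ m - U i \<omega> ^ m) \<le> \<delta>} \<le> (2 * \<delta>) ^ card S" .
qed

lemma large_indep:
  assumes I: "finite I" "I \<subseteq> {1..}" and B: "finite B" "B \<subseteq> {1..}" "I \<inter> B = {}"
    and \<J>: "\<And>J. J \<in> \<J> \<Longrightarrow> J \<subseteq> B"
  shows "prob (large s I \<inter> {\<omega> \<in> space M. card {J \<in> \<J>. \<omega> \<in> large s J} = l})
    = prob (large s I) * prob {\<omega> \<in> space M. card {J \<in> \<J>. \<omega> \<in> large s J} = l}"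
proof -
  have fin: "finite \<J>" using \<J> B(1) by (metis PowI finite_Pow_iff finite_subset subsetI)
  let ?XI = "\<lambda>\<omega>. \<lambda>i\<in>I. U i \<omega>" and ?XB = "\<lambda>\<omega>. \<lambda>i\<in>B. U i \<omega>"
  let ?E = "near_maximal I s \<inter> space (Pi\<^sub>M I (\<lambda>_. borel))"
  define F where "F = {u \<in> space (Pi\<^sub>M B (\<lambda>_. borel)). (\<Sum>J\<in>\<J>. if u \<in> near_maximal J s \<inter> space (Pi\<^sub>M B (\<lambda>_. borel)) then 1 else 0) = l}"
  have [measurable]: "near_maximal J s \<inter> space (Pi\<^sub>M B (\<lambda>_. borel)) \<in> sets (Pi\<^sub>M B (\<lambda>_. borel))" if "J \<in> \<J>" for J
    using \<J>[OF that] B(1) finite_subset by (intro sets_near_maximal) auto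
  have F: "F \<in> sets (Pi\<^sub>M B (\<lambda>_. borel))"
  proof -
    have "(\<lambda>u. \<Sum>J\<in>\<J>. if u \<in> near_maximal J s \<inter> space (Pi\<^sub>M B (\<lambda>_. borel)) then 1 else 0 :: nat) \<in> Pi\<^sub>M B (\<lambda>_. borel) \<rightarrow>\<^sub>M count_space UNIV"
      by measurable
    then show ?thesis unfolding F_def by measurable
  qed
  have E: "?E \<in> sets (Pi\<^sub>M I (\<lambda>_. borel))" by (rule sets_near_maximal[OF I(1) order_refl])
  have eqI: "large s I = ?XI -` ?E \<inter> space M"
    unfolding large_eq[OF order_refl] by auto
  have eqB: "{\<omega> \<in> space M. card {J \<in> \<J>. \<omega> \<in> large s J} = l} = ?XB -` F \<inter> space M"
  proof -
    have "card {J \<in> \<J>. \<omega> \<in> large s J} = (\<Sum>J\<in>\<J>. if ?XB \<omega> \<in> near_maximal J s \<inter> space (Pi\<^sub>M B (\<lambda>_. borel)) then 1 else 0)"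
      if "\<omega> \<in> space M" for \<omega>
    proof -
      have "\<omega> \<in> large s J \<longleftrightarrow> ?XB \<omega> \<in> near_maximal J s \<inter> space (Pi\<^sub>M B (\<lambda>_. borel))" if "J \<in> \<J>" for J
        using large_eq[OF \<J>[OF that], of s] \<open>\<omega> \<in> space M\<close> by simp
      then have "{J \<in> \<J>. \<omega> \<in> large s J} = {J \<in> \<J>. ?XB \<omega> \<in> near_maximal J s \<inter> space (Pi\<^sub>M B (\<lambda>_. borel))}"
        by blast
      then show ?thesis using fin by (simp add: sum.If_cases Int_def)
    qed
    then show ?thesis by (auto simp: F_def space_PiM)
  qed
  have "indep_var (Pi\<^sub>M I (\<lambda>_. borel)) ?XI (Pi\<^sub>M B (\<lambda>_. borel)) ?XB"
    using indep_U B(3) I(2) B(2) by (rule indep_var_restrict)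
  from indep_varD[OF this E F]
  have "prob ((?XI -` ?E \<inter> space M) \<inter> (?XB -` F \<inter> space M)) = prob (?XI -` ?E \<inter> space M) * prob (?XB -` F \<inter> space M)"
    by (simp add: vimage_def Int_def conj_ac)
  then show ?thesis unfolding eqI eqB .
qed

lemma prob_large_Int_le:
  assumes C: "C > 0"
    "\<And>(u :: nat \<Rightarrow> complex) I s i j. card I = m \<Longrightarrow> (\<And>i. i \<in> I \<Longrightarrow> norm (u i) = 1) \<Longrightarrow> 0 \<le> s \<Longrightarrow>
       real m / 2 * sin (2 * pi / m) - s \<le> polygon_area (u ` I) \<Longrightarrow>
       i \<in> I \<Longrightarrow> j \<in> I \<Longrightarrow> norm (u i ^ m - u j ^ m) \<le> C * sqrt s"
    and m: "m \<ge> 1" and s: "s \<ge> 0"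
    and IJ: "I \<subseteq> {1..}" "J \<subseteq> {1..}" "card I = m" "card J = m" "I \<inter> J \<noteq> {}"
  shows "prob (large s I \<inter> large s J) \<le> (2 * C * sqrt s) ^ (card (I \<union> J) - 1)"
proof -
  obtain i where i: "i \<in> I" "i \<in> J" using IJ(5) by auto
  have fin: "finite I" "finite J" using IJ(3,4) m by (auto intro: card_ge_0_finite)
  define S where "S = I \<union> J - {i}"
  have S: "finite S" "i \<notin> S" "insert i S \<subseteq> {1..}" "card S = card (I \<union> J) - 1"
    using fin i IJ by (auto simp: S_def)
  have nn: "0 \<le> C * sqrt s" using C(1) s by simp
  note close = prob_powers_close_le[OF m nn S(1-3)]
  have "AE \<omega> in M. \<omega> \<in> large s I \<inter> large s J \<longrightarrow> \<omega> \<in> {\<omega> \<in> space M. \<forall>j\<in>S. norm (U j \<omega> ^ m - U i \<omega> ^ m) \<le> C * sqrt s}"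
    using AE_U_norm AE_space
  proof eventually_elim
    case (elim \<omega>)
    have *: "norm (U j \<omega> ^ m - U i \<omega> ^ m) \<le> C * sqrt s"
      if "\<omega> \<in> large s K" "j \<in> K" "i \<in> K" "K \<subseteq> {1..}" "card K = m" for j K
      using that elim s by (intro C(2)[of K]) (auto simp: large_def near_maximal_def)
    show ?case
    proof
      assume "\<omega> \<in> large s I \<inter> large s J"
      then show "\<omega> \<in> {\<omega> \<in> space M. \<forall>j\<in>S. norm (U j \<omega> ^ m - U i \<omega> ^ m) \<le> C * sqrt s}"
        using elim(2) *[of I] *[of J] i IJ by (auto simp: S_def)
    qed
  qed
  then have "prob (large s I \<inter> large s J) \<le> prob {\<omega> \<in> space M. \<forall>j\<in>S. norm (U j \<omega> ^ m - U i \<omega> ^ m) \<le> C * sqrt s}"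
    using close(1) by (rule finite_measure_mono_AE)
  also have "\<dots> \<le> (2 * (C * sqrt s)) ^ card S" by (rule close(2))
  finally show ?thesis by (simp add: S(4) mult.assoc)
qed

end

lemma exp_minus_lipschitz:
  fixes a b :: real
  assumes "0 \<le> a" "0 \<le> b"
  shows "\<bar>exp (- a) - exp (- b)\<bar> \<le> \<bar>a - b\<bar>"
proof -
  have *: "exp (- a) - exp (- b) \<le> b - a" if "0 \<le> a" "a \<le> b" for a b :: real
  proof -
    have "exp (- a) - exp (- b) = exp (- a) * (1 - exp (a - b))"
      by (simp add: right_diff_distrib exp_add[symmetric])
    also have "\<dots> \<le> 1 * (1 - exp (a - b))" using that by (intro mult_right_mono) auto
    also have "\<dots> \<le> b - a" using exp_ge_add_one_self[of "a - b"] by (simp only: mult_1_left)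
    finally show ?thesis .
  qed
  show ?thesis using *[of a b] *[of b a] assms by (cases "a \<le> b") (auto simp: abs_if)
qed

context uniform_circle_sample
begin

lemma prob_no_large_poisson:
  assumes C: "C > 0"
    "\<And>(u :: nat \<Rightarrow> complex) I s i j. card I = m \<Longrightarrow> (\<And>i. i \<in> I \<Longrightarrow> norm (u i) = 1) \<Longrightarrow> 0 \<le> s \<Longrightarrow>
       real m / 2 * sin (2 * pi / m) - s \<le> polygon_area (u ` I) \<Longrightarrow>
       i \<in> I \<Longrightarrow> j \<in> I \<Longrightarrow> norm (u i ^ m - u j ^ m) \<le> C * sqrt s"
    and m: "m \<ge> 2" and s: "s \<ge> 0" and n: "n \<ge> 1" and q: "real n * (2 * C * sqrt s) \<le> 1"
    and p: "\<And>I. I \<subseteq> {1..n} \<Longrightarrow> card I = m \<Longrightarrow> prob (large s I) = p"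
  shows "\<bar>prob (space M - (\<Union>I\<in>{I. I \<subseteq> {1..n} \<and> card I = m}. large s I)) - exp (- (real (n choose m) * p))\<bar>
    \<le> 2 * 4 ^ (2 * m) * real (m + 1) * (real n * (real n * (2 * C * sqrt s)) ^ m)"
proof -
  define J where "J = {I. I \<subseteq> {1..n} \<and> card I = m}"
  define N where "N I = {I' \<in> J. I \<inter> I' \<noteq> {}}" for I
  define q where "q = 2 * C * sqrt s"
  have q0: "0 \<le> q" using C(1) s by (simp add: q_def)
  have "q \<le> real n * q" using q0 n mult_right_mono[of 1 "real n" q] by simp
  then have q1: "q \<le> 1" using \<open>real n * _ \<le> 1\<close> by (simp add: q_def)
  have J: "finite J" "card J = n choose m"
    unfolding J_def using n_subsets[of "{1..n}" m] by auto
  have JD: "I \<subseteq> {1..n}" "I \<subseteq> {1..}" "card I = m" "finite I" "I \<noteq> {}" if "I \<in> J" for I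
    using that m finite_subset[of I "{1..n}"] by (auto simp: J_def)
  define f where "f r = q ^ max (r - 1) m" for r
  have Int_le: "prob (large s I \<inter> large s I') \<le> q ^ (card (I \<union> I') - 1)" if "I \<in> J" "I' \<in> N I" for I I'
  proof -
    have "I' \<in> J" "I \<inter> I' \<noteq> {}" using that(2) by (auto simp: N_def)
    then show ?thesis unfolding q_def
      using JD[OF that(1)] JD[of I'] m s by (intro prob_large_Int_le[OF C]) auto
  qed
  have card_Un: "card (I \<union> I') \<in> {m..2 * m}" "card (I \<union> I') \<le> 2 * m - 1"
    if "I \<in> J" "I' \<in> N I" for I I'
  proof -
    have I': "I' \<in> J" "I \<inter> I' \<noteq> {}" using that(2) by (auto simp: N_def)
    have "card (I \<union> I') + card (I \<inter> I') = 2 * m"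
      using card_Un_Int[of I I'] JD[OF that(1)] JD[OF I'(1)] by simp
    moreover have "card (I \<inter> I') > 0" using I' JD[OF that(1)] by (simp add: card_gt_0_iff)
    moreover have "m \<le> card (I \<union> I')" using card_mono[of "I \<union> I'" I] JD[OF that(1)] JD[OF I'(1)] by simp
    ultimately show "card (I \<union> I') \<in> {m..2 * m}" "card (I \<union> I') \<le> 2 * m - 1" by auto
  qed
  have single: "prob (large s I) \<le> q ^ (m - 1)" if "I \<in> J" for I
    using Int_le[of I I] that JD[OF that] by (auto simp: N_def)
  have prod_le: "prob (large s I) * prob (large s I') \<le> f (card (I \<union> I'))" if "I \<in> J" "I' \<in> N I" for I I'
  proof -
    have "I' \<in> J" using that(2) by (auto simp: N_def)
    then have "prob (large s I) * prob (large s I') \<le> q ^ (m - 1) * q ^ (m - 1)"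
      using single that by (intro mult_mono) (auto simp: q0)
    also have "\<dots> = q ^ (2 * m - 2)" using m by (simp add: power_add[symmetric] mult_2 numeral_2_eq_2)
    also have "\<dots> \<le> f (card (I \<union> I'))"
      unfolding f_def using card_Un(2)[OF that] q0 q1 m by (intro power_decreasing) auto
    finally show ?thesis .
  qed
  have Int_le': "prob (large s I \<inter> large s I') \<le> f (card (I \<union> I'))" if "I \<in> J" "I' \<in> N I - {I}" for I I'
  proof -
    have I': "I' \<in> J" "I' \<noteq> I" using that(2) by (auto simp: N_def)
    have "m < card (I \<union> I')"
    proof (rule ccontr)
      assume "\<not> m < card (I \<union> I')"
      then have le: "card (I \<union> I') \<le> m" by simp
      have fin: "finite (I \<union> I')" using JD(4)[OF that(1)] JD(4)[OF I'(1)] by simp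
      have "I = I \<union> I'" using fin le JD(3)[OF that(1)] by (intro card_seteq) auto
      moreover have "I' = I \<union> I'" using fin le JD(3)[OF I'(1)] by (intro card_seteq) auto
      ultimately have "I' = I" by metis
      with I'(2) show False by simp
    qed
    then have "max (card (I \<union> I') - 1) m = card (I \<union> I') - 1" by simp
    then show ?thesis using Int_le[of I I'] that by (simp add: f_def)
  qed
  have "\<bar>prob (space M - (\<Union>I\<in>J. large s I)) - exp (- (\<Sum>I\<in>J. prob (large s I)))\<bar>
    \<le> (\<Sum>I\<in>J. (\<Sum>I'\<in>N I. prob (large s I) * prob (large s I')) + (\<Sum>I'\<in>N I - {I}. prob (large s I \<inter> large s I')))"
  proof (rule chen_stein_no_event[OF J(1)])
    fix I l assume I: "I \<in> J"
    show "large s I \<in> events" using JD[OF I] by (intro large_event)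
    show "I \<in> N I" using I JD[OF I] by (auto simp: N_def)
    show "N I \<subseteq> J" by (auto simp: N_def)
    show "prob (large s I \<inter> {\<omega> \<in> space M. card {j \<in> J - N I. \<omega> \<in> large s j} = l}) =
          prob (large s I) * prob {\<omega> \<in> space M. card {j \<in> J - N I. \<omega> \<in> large s j} = l}"
    proof (rule large_indep[where B = "{1..n} - I"])
      fix j assume "j \<in> J - N I"
      then have "j \<subseteq> {1..n}" "I \<inter> j = {}" using JD(1)[of j] by (simp_all add: N_def)
      then show "j \<subseteq> {1..n} - I" by blast
    qed (use JD[OF I] in auto)
  qed
  also have "\<dots> \<le> (\<Sum>I\<in>J. (\<Sum>I'\<in>N I. f (card (I \<union> I'))) + (\<Sum>I'\<in>N I. f (card (I \<union> I'))))"
  proof (intro sum_mono add_mono)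
    fix I assume I: "I \<in> J"
    show "prob (large s I) * prob (large s I') \<le> f (card (I \<union> I'))" if "I' \<in> N I" for I'
      using prod_le[OF I that] .
    have "(\<Sum>I'\<in>N I - {I}. prob (large s I \<inter> large s I')) \<le> (\<Sum>I'\<in>N I - {I}. f (card (I \<union> I')))"
      using Int_le'[OF I] by (intro sum_mono)
    also have "\<dots> \<le> (\<Sum>I'\<in>N I. f (card (I \<union> I')))"
      using J(1) q0 by (intro sum_mono2) (auto simp: N_def f_def)
    finally show "(\<Sum>I'\<in>N I - {I}. prob (large s I \<inter> large s I')) \<le> (\<Sum>I'\<in>N I. f (card (I \<union> I')))" .
  qed
  also have "\<dots> = 2 * (\<Sum>I\<in>J. \<Sum>I'\<in>N I. f (card (I \<union> I')))"
    by (simp only: mult_2 sum.distrib)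
  also have "(\<Sum>I\<in>J. \<Sum>I'\<in>N I. f (card (I \<union> I'))) = (\<Sum>(I, I')\<in>Sigma J N. f (card (I \<union> I')))"
    using J(1) by (intro sum.Sigma) (auto simp: N_def)
  also have "(\<Sum>(I, I')\<in>Sigma J N. f (card (I \<union> I'))) \<le> 4 ^ (2 * m) * (\<Sum>r=m..2 * m. real (card {1..n}) ^ r * f r)"
  proof (rule sum_pairs_card_Un_le)
    fix I I' assume "(I, I') \<in> Sigma J N"
    then have I: "I \<in> J" "I' \<in> N I" "I' \<in> J" by (auto simp: N_def)
    then show "I \<subseteq> {1..n} \<and> I' \<subseteq> {1..n} \<and> card (I \<union> I') \<in> {m..2 * m}"
      using JD(1) card_Un(1) by blast
  qed (auto simp: f_def q0)
  also have "(\<Sum>r=m..2 * m. real (card {1..n}) ^ r * f r) \<le> (\<Sum>r=m..2 * m. real n * (real n * q) ^ m)"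
  proof (rule sum_mono)
    fix r assume r: "r \<in> {m..2 * m}"
    show "real (card {1..n}) ^ r * f r \<le> real n * (real n * q) ^ m"
    proof (cases "r = m")
      case True
      have "1 * (real n * q) ^ m \<le> real n * (real n * q) ^ m"
        using n q0 by (intro mult_right_mono) auto
      then show ?thesis using True m by (simp add: f_def power_mult_distrib)
    next
      case False
      then have "max (r - 1) m = r - 1" "r = Suc (r - 1)" using r by auto
      then have "real (card {1..n}) ^ r * f r = real n * (real n * q) ^ (r - 1)"
        unfolding f_def by (simp add: power_mult_distrib) (metis power_Suc mult.assoc)
      also have "\<dots> \<le> real n * (real n * q) ^ m"
        using False r q0 \<open>real n * _ \<le> 1\<close> by (intro mult_left_mono power_decreasing) (auto simp: q_def)
      finally show ?thesis .
    qed
  qed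
  also have "\<dots> = real (m + 1) * (real n * (real n * q) ^ m)" by (simp add: Suc_diff_le)
  also have "(\<Sum>I\<in>J. prob (large s I)) = real (n choose m) * p"
    using p J by (simp add: J_def)
  finally show ?thesis by (simp add: J_def q_def mult.assoc)
qed

text \<open>With \<open>y = n powr (- 1 / k)\<close> all powers of \<open>n\<close> that occur are integer powers of \<open>y\<close>.\<close>

lemma prob_exists_large_rate:
  assumes k: "k \<ge> 2" and t: "t > 0"
  obtains y0 K where "y0 > 0"
    "\<And>n y. n \<ge> Suc k \<Longrightarrow> 0 < y \<Longrightarrow> y < y0 \<Longrightarrow> real n * y ^ k = 1 \<Longrightarrow>
      \<bar>prob (\<Union>I\<in>{I. I \<subseteq> {1..n} \<and> card I = Suc k}. large (t * y ^ (2 * Suc k)) I)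
        - (1 - exp (- (near_maximal_const k * sqrt t ^ k / fact (Suc k))))\<bar> \<le> K * y"
proof -
  define m where "m = Suc k"
  define \<kappa> where "\<kappa> = near_maximal_const k"
  have m: "m \<ge> 3" using k by (simp add: m_def)
  have \<kappa>: "\<kappa> \<ge> 0"
    using near_regular_const_pos[of k] sin_regular_pos[of "Suc k"] k by (simp add: \<kappa>_def near_maximal_const_def)
  define p where "p \<delta> = measure (Pi\<^sub>M {..k} (\<lambda>_. uniform_circle)) (near_maximal {..k} (\<delta>\<^sup>2) \<inter> space (Pi\<^sub>M {..k} (\<lambda>_. borel)))" for \<delta>
  obtain C1 \<delta>0 where C1: "\<delta>0 > 0" "\<And>\<delta>. 0 < \<delta> \<Longrightarrow> \<delta> < \<delta>0 \<Longrightarrow> \<bar>p \<delta> - \<kappa> * \<delta> ^ k\<bar> \<le> C1 * \<delta> ^ Suc k"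
    unfolding p_def \<kappa>_def using measure_near_maximal_asymptotics[OF k] by blast
  obtain C where C: "C > 0"
    "\<And>(u :: nat \<Rightarrow> complex) I s i j. card I = m \<Longrightarrow> (\<And>i. i \<in> I \<Longrightarrow> norm (u i) = 1) \<Longrightarrow> 0 \<le> s \<Longrightarrow>
       real m / 2 * sin (2 * pi / m) - s \<le> polygon_area (u ` I) \<Longrightarrow>
       i \<in> I \<Longrightarrow> j \<in> I \<Longrightarrow> norm (u i ^ m - u j ^ m) \<le> C * sqrt s"
    using polygon_area_large_imp_powers_close[OF m, where 'i = nat] by blast
  define T where "T = sqrt t"
  have T: "T > 0" using t by (simp add: T_def)
  define l where "l = \<kappa> * T ^ k / fact m"
  define K1 where "K1 = 2 * 4 ^ (2 * m) * real (m + 1) * (2 * C * T) ^ m"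
  define K2 where "K2 = \<bar>C1\<bar> * T ^ m + \<kappa> * T ^ k * (real m)\<^sup>2"
  define y0 where "y0 = min 1 (min (\<delta>0 / T) (1 / (2 * C * T)))"
  have "y0 > 0" using C1(1) T C(1) by (simp add: y0_def)
  moreover have "\<bar>prob (\<Union>I\<in>{I. I \<subseteq> {1..n} \<and> card I = Suc k}. large (t * y ^ (2 * Suc k)) I)
        - (1 - exp (- (near_maximal_const k * sqrt t ^ k / fact (Suc k))))\<bar> \<le> (K1 + K2) * y"
    if n: "n \<ge> Suc k" and y: "0 < y" "y < y0" and ny: "real n * y ^ k = 1" for n y
  proof -
    define \<delta> where "\<delta> = T * y ^ m"
    have y1: "y \<le> 1" using y by (simp add: y0_def)
    have \<delta>: "0 < \<delta>" "\<delta> < \<delta>0"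
    proof -
      show "0 < \<delta>" using T y by (simp add: \<delta>_def)
      have "y ^ m \<le> y" using power_decreasing[of 1 m y] y y1 m by simp
      then have "\<delta> \<le> T * y" using T by (simp add: \<delta>_def)
      also have "\<dots> < \<delta>0" using y T by (simp add: y0_def pos_less_divide_eq mult.commute)
      finally show "\<delta> < \<delta>0" .
    qed
    define s where "s = \<delta>\<^sup>2"
    have s_eq: "t * y ^ (2 * Suc k) = s"
    proof -
      have "s = T\<^sup>2 * y ^ (m * 2)" by (simp only: s_def \<delta>_def power_mult_distrib power_mult)
      then show ?thesis using t by (simp only: T_def m_def mult.commute real_sqrt_pow2 less_imp_le)
    qed
    have sqrt_s: "sqrt s = \<delta>" using \<delta> by (simp add: s_def)
    have n\<delta>: "real n * \<delta> = T * y" using ny by (simp add: \<delta>_def m_def mult_ac)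
    define E where "E = (\<Union>I\<in>{I. I \<subseteq> {1..n} \<and> card I = m}. large s I)"
    have n1: "n \<ge> 1" "m \<le> n" using n by (auto simp: m_def)
    have fin: "finite {I. I \<subseteq> {1..n} \<and> card I = m}" by simp
    have sub: "finite I" "I \<subseteq> {1..}" if "I \<subseteq> {1..n}" for I using that finite_subset by auto
    have ev: "E \<in> events" unfolding E_def using fin sub by (intro sets.finite_UN large_event) auto
    have q: "real n * (2 * C * sqrt s) = 2 * C * T * y" using n\<delta> unfolding sqrt_s by (simp add: mult_ac)
    have "\<bar>prob (space M - E) - exp (- (real (n choose m) * p \<delta>))\<bar>
      \<le> 2 * 4 ^ (2 * m) * real (m + 1) * (real n * (real n * (2 * C * sqrt s)) ^ m)"
      unfolding E_def
    proof (rule prob_no_large_poisson[OF C])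
      have "y < 1 / (2 * C * T)" using y by (simp add: y0_def)
      then show "real n * (2 * C * sqrt s) \<le> 1"
        unfolding q using C(1) T by (simp add: pos_less_divide_eq mult_ac)
      fix I assume "I \<subseteq> {1..n}" "card I = m"
      then show "prob (large s I) = p \<delta>"
        unfolding p_def s_def m_def using sub by (intro prob_large) auto
    qed (use m n1 in \<open>auto simp: s_def\<close>)
    also have "real n * (real n * (2 * C * sqrt s)) ^ m = (2 * C * T) ^ m * y"
    proof -
      have "real n * y ^ m = y" using ny by (simp add: m_def)
      then show ?thesis unfolding q power_mult_distrib by (metis mult.commute mult.left_commute)
    qed
    also have "2 * 4 ^ (2 * m) * real (m + 1) * ((2 * C * T) ^ m * y) = K1 * y" by (simp add: K1_def)
    finally have 1: "\<bar>prob (space M - E) - exp (- (real (n choose m) * p \<delta>))\<bar> \<le> K1 * y" .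
    have nk: "real n ^ m * \<delta> ^ k = T ^ k"
    proof -
      have "real n ^ m * \<delta> ^ k = T ^ k * (real n * y ^ k) ^ m"
        by (simp add: \<delta>_def power_mult_distrib power_mult[symmetric] mult_ac)
      then show ?thesis using ny by simp
    qed
    have nm: "real n ^ m * \<delta> ^ m = T ^ m * y ^ m"
      unfolding power_mult_distrib[symmetric] n\<delta> ..
    have ym: "y ^ m \<le> y" "y ^ k \<le> y" using power_decreasing[of 1 m y] power_decreasing[of 1 k y] y y1 m k by auto
    have choose_le: "fact m * real (n choose m) \<le> real n ^ m"
      using binomial_fact_pow[of n m] by (metis mult.commute of_nat_fact of_nat_le_iff of_nat_mult of_nat_power)
    have choose_le': "real (n choose m) \<le> real n ^ m"
    proof -
      have "1 * real (n choose m) \<le> fact m * real (n choose m)" by (intro mult_right_mono) (auto simp: fact_ge_1)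
      then show ?thesis using choose_le by linarith
    qed
    have 2: "\<bar>real (n choose m) * p \<delta> - real (n choose m) * (\<kappa> * \<delta> ^ k)\<bar> \<le> \<bar>C1\<bar> * T ^ m * y"
    proof -
      have "\<bar>real (n choose m) * p \<delta> - real (n choose m) * (\<kappa> * \<delta> ^ k)\<bar> = real (n choose m) * \<bar>p \<delta> - \<kappa> * \<delta> ^ k\<bar>"
        by (simp add: right_diff_distrib[symmetric] abs_mult)
      also have "\<dots> \<le> real n ^ m * (\<bar>C1\<bar> * \<delta> ^ m)"
      proof (intro mult_mono choose_le')
        have "C1 * \<delta> ^ m \<le> \<bar>C1\<bar> * \<delta> ^ m" using \<delta> by (intro mult_right_mono) auto
        then show "\<bar>p \<delta> - \<kappa> * \<delta> ^ k\<bar> \<le> \<bar>C1\<bar> * \<delta> ^ m" using C1(2)[OF \<delta>] by (simp add: m_def)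
      qed auto
      also have "\<dots> = \<bar>C1\<bar> * T ^ m * y ^ m" using nm by (metis mult.left_commute mult.assoc)
      also have "\<dots> \<le> \<bar>C1\<bar> * T ^ m * y" using ym T by (intro mult_left_mono) auto
      finally show ?thesis .
    qed
    have 3: "\<bar>real (n choose m) * (\<kappa> * \<delta> ^ k) - l\<bar> \<le> \<kappa> * T ^ k * (real m)\<^sup>2 * y"
    proof -
      define D where "D = real n ^ m - fact m * real (n choose m)"
      have D: "0 \<le> D" "real n * D \<le> (real m)\<^sup>2 * real n ^ m"
        using choose_le binomial_fact_lower[OF n1(2)] by (auto simp: D_def)
      have Dk: "D * \<delta> ^ k \<le> (real m)\<^sup>2 * T ^ k * y"
      proof -
        have "D * \<delta> ^ k = (real n * D) * \<delta> ^ k * y ^ k" using ny by (simp add: mult_ac)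
        also have "\<dots> \<le> ((real m)\<^sup>2 * real n ^ m) * \<delta> ^ k * y ^ k"
          using D(2) \<delta> y by (intro mult_right_mono) auto
        also have "\<dots> = (real m)\<^sup>2 * T ^ k * y ^ k" unfolding nk[symmetric] by (simp add: mult_ac)
        also have "\<dots> \<le> (real m)\<^sup>2 * T ^ k * y" using ym T by (intro mult_left_mono) auto
        finally show ?thesis .
      qed
      have "l - real (n choose m) * (\<kappa> * \<delta> ^ k) = \<kappa> * (D * \<delta> ^ k) / fact m"
        unfolding l_def nk[symmetric] D_def by (simp add: field_simps)
      then have "\<bar>real (n choose m) * (\<kappa> * \<delta> ^ k) - l\<bar> = \<kappa> * (D * \<delta> ^ k) / fact m"
        using \<kappa> D(1) \<delta>(1) by (subst abs_minus_commute) simp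
      also have "\<dots> \<le> \<kappa> * (D * \<delta> ^ k) / 1"
        using \<kappa> D(1) \<delta>(1) by (intro divide_left_mono) (auto simp: fact_ge_1)
      also have "\<dots> \<le> \<kappa> * ((real m)\<^sup>2 * T ^ k * y) / 1"
        using \<kappa> Dk by (simp add: mult_left_mono)
      finally show ?thesis by (simp add: mult_ac)
    qed
    have l0: "0 \<le> l" using \<kappa> T by (simp add: l_def)
    have "\<bar>exp (- (real (n choose m) * p \<delta>)) - exp (- l)\<bar> \<le> \<bar>real (n choose m) * p \<delta> - l\<bar>"
      using l0 by (intro exp_minus_lipschitz) (auto simp: p_def)
    also have "\<dots> \<le> K2 * y" using 2 3 by (simp add: K2_def distrib_right)
    finally have 4: "\<bar>exp (- (real (n choose m) * p \<delta>)) - exp (- l)\<bar> \<le> K2 * y" .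
    have "prob E = 1 - prob (space M - E)" using prob_compl[OF ev] by simp
    then have "\<bar>prob E - (1 - exp (- l))\<bar> \<le> (K1 + K2) * y"
      unfolding distrib_right using 1 4 by linarith
    then show ?thesis unfolding s_eq E_def by (simp only: l_def \<kappa>_def T_def m_def)
  qed
  ultimately show thesis by (rule that)
qed

end

lemma near_maximal_const_eq:
  assumes m: "m = Suc k" "k \<ge> 2" and t: "t > 0"
  shows "near_maximal_const k * sqrt t ^ k / fact (Suc k) = t powr ((real m - 1) / 2) / K_const m"
proof -
  define \<sigma> where "\<sigma> = sin (2 * pi / real m)"
  have \<sigma>: "\<sigma> > 0" unfolding \<sigma>_def using m by (intro sin_regular_pos) auto
  have powr_half: "x powr ((real m - 1) / 2) = sqrt x ^ k" if "x > 0" for x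
  proof -
    have "x powr ((real m - 1) / 2) = (x powr (1 / 2)) powr real k" using m by (simp add: powr_powr)
    then show ?thesis using that by (simp add: powr_half_sqrt powr_realpow)
  qed
  have m32: "real m powr (3 / 2) = real m * sqrt (real m)"
    using m powr_add[of "real m" 1 "1/2"] by (simp add: powr_half_sqrt)
  have ball: "unit_ball_vol (real k) = sqrt pi ^ k / Gamma ((real m + 1) / 2)"
    using powr_half[of pi] m by (simp add: unit_ball_vol_def add_divide_distrib add.commute)
  have G: "Gamma ((real m + 1) / 2) > 0" by (intro Gamma_real_pos) simp
  have pi2: "(2 * pi) ^ k = (2 ^ k * sqrt pi ^ k) * sqrt pi ^ k"
  proof -
    have "(2 * pi) ^ k = (2 * (sqrt pi * sqrt pi)) ^ k" by simp
    then show ?thesis by (simp only: power_mult_distrib mult.assoc)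
  qed
  have K: "K_const m = real m * sqrt (real m) * (sqrt pi ^ k * sqrt \<sigma> ^ k) * Gamma ((real m + 1) / 2)"
    unfolding K_const_def \<sigma>_def[symmetric] m32 using powr_half[of "pi * \<sigma>"] \<sigma>
    by (simp add: real_sqrt_mult power_mult_distrib)
  have four: "sqrt (4 / \<sigma>) ^ k = 2 ^ k / sqrt \<sigma> ^ k"
    by (simp add: real_sqrt_divide power_divide)
  have near: "near_maximal_const k = fact k * (sqrt pi ^ k / Gamma ((real m + 1) / 2) / ((2 ^ k * sqrt pi ^ k) * sqrt pi ^ k * sqrt (real m)))
      * (2 ^ k / sqrt \<sigma> ^ k)"
    unfolding near_maximal_const_def near_regular_const_def m(1)[symmetric] \<sigma>_def[symmetric] four ball pi2
    using m(1) by (simp add: add.commute)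
  have fact_m: "fact (Suc k) = real m * fact k" using m by simp
  have "sqrt pi ^ k > 0" "sqrt \<sigma> ^ k > 0" "sqrt (real m) > 0" "real m > 0" using \<sigma> m by auto
  then show ?thesis
    unfolding near K powr_half[OF t] fact_m using G by (simp add: divide_simps)
qed

section \<open>Limit theorem for the maximal area\<close>

theorem theorem2:
  fixes M :: "'a measure" and U :: "nat \<Rightarrow> 'a \<Rightarrow> complex" and m :: nat and t :: real
  assumes "prob_space M"
    and "m \<ge> 3"
    and "prob_space.indep_vars M (\<lambda>_. borel) U {1..}"
    and "\<And>i. i \<ge> 1 \<Longrightarrow> distr M borel (U i) = uniform_circle"
    and "t > 0"
  shows "let
      P = (\<lambda>n::nat. measure M {\<omega> \<in> space M.
             real n powr (2 * real m / (real m - 1)) *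
               (real m / 2 * sin (2 * pi / real m) - max_polygon_area m n (\<lambda>i. U i \<omega>)) \<le> t});
      L = 1 - exp (- (t powr ((real m - 1) / 2) / K_const m))
    in P \<longlonglongrightarrow> L \<and>
       (\<lambda>n. \<bar>P n - L\<bar>) \<in> O(\<lambda>n. real n powr (- 1 / (real m - 1)))"
proof -
  interpret uniform_circle_sample M U
    using assms(1,3,4) by (intro uniform_circle_sample.intro uniform_circle_sample_axioms.intro)
  obtain k where k: "m = Suc k" "k \<ge> 2" using assms(2) by (cases m) auto
  define P where "P n = measure M {\<omega> \<in> space M.
             real n powr (2 * real m / (real m - 1)) *
               (real m / 2 * sin (2 * pi / real m) - max_polygon_area m n (\<lambda>i. U i \<omega>)) \<le> t}" for n :: nat
  define L where "L = 1 - exp (- (t powr ((real m - 1) / 2) / K_const m))"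
  define y where "y n = real n powr (- 1 / (real m - 1))" for n :: nat
  obtain y0 K where K: "y0 > 0"
    "\<And>n y. n \<ge> Suc k \<Longrightarrow> 0 < y \<Longrightarrow> y < y0 \<Longrightarrow> real n * y ^ k = 1 \<Longrightarrow>
      \<bar>prob (\<Union>I\<in>{I. I \<subseteq> {1..n} \<and> card I = Suc k}. large (t * y ^ (2 * Suc k)) I)
        - (1 - exp (- (near_maximal_const k * sqrt t ^ k / fact (Suc k))))\<bar> \<le> K * y"
  proof (rule prob_exists_large_rate[OF k(2) assms(5)], goal_cases)
    case (1 y0 K)
    show ?case by (rule 1(1)[OF 1(2)]) (rule 1(3))
  qed
  have P_eq: "P n = prob (\<Union>I\<in>{I. I \<subseteq> {1..n} \<and> card I = Suc k}. large (t * y n ^ (2 * Suc k)) I)"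
    if n: "n \<ge> m" for n
  proof -
    let ?J = "{I. I \<subseteq> {1..n} \<and> card I = m}"
    let ?A = "real m / 2 * sin (2 * pi / real m)"
    have n0: "real n > 0" using n k by simp
    have fin: "finite ?J" by simp
    have "{1..m} \<in> ?J" using n by auto
    then have ne: "?J \<noteq> {}" by blast
    have "y n ^ (2 * Suc k) = (real n powr (- 1 / (real m - 1))) powr real (2 * Suc k)"
      using n0 by (subst powr_realpow) (auto simp: y_def)
    also have "\<dots> = real n powr (- (2 * real m / (real m - 1)))"
      using k by (simp add: powr_powr)
    finally have y: "real n powr (2 * real m / (real m - 1)) = 1 / y n ^ (2 * Suc k)"
      by (simp add: powr_minus_divide)
    have yp: "y n ^ (2 * Suc k) > 0" using n0 by (simp add: y_def)
    have "(real n powr (2 * real m / (real m - 1)) * (?A - max_polygon_area m n u) \<le> t)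
      \<longleftrightarrow> (\<exists>I\<in>?J. u \<in> near_maximal I (t * y n ^ (2 * Suc k)))" for u
    proof -
      have "(real n powr (2 * real m / (real m - 1)) * (?A - max_polygon_area m n u) \<le> t)
         \<longleftrightarrow> ?A - t * y n ^ (2 * Suc k) \<le> max_polygon_area m n u"
        unfolding y using yp by (simp add: pos_divide_le_eq) (simp add: algebra_simps)
      also have "\<dots> \<longleftrightarrow> (\<exists>I\<in>?J. ?A - t * y n ^ (2 * Suc k) \<le> polygon_area (u ` I))"
        unfolding max_polygon_area_def using fin ne by (subst Max_ge_iff) auto
      finally show ?thesis by (auto simp: near_maximal_def)
    qed
    then show ?thesis unfolding P_def large_def k(1)[symmetric] by (intro arg_cong[where f = prob]) auto
  qed
  have "filterlim (\<lambda>n. real n) at_top sequentially" by (rule filterlim_real_sequentially)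
  then have y_lim: "y \<longlonglongrightarrow> 0"
    unfolding y_def using k by (intro tendsto_neg_powr) (auto simp: field_simps)
  have bound: "eventually (\<lambda>n. \<bar>P n - L\<bar> \<le> K * y n) sequentially"
    using eventually_ge_at_top[of m] order_tendstoD(2)[OF y_lim K(1)]
  proof eventually_elim
    case (elim n)
    have n0: "real n > 0" using elim k by simp
    have "y n ^ k = (real n powr (- 1 / (real m - 1))) powr real k"
      using n0 by (subst powr_realpow) (auto simp: y_def)
    also have "\<dots> = real n powr (- 1 / (real m - 1) * real k)" by (rule powr_powr)
    also have "- 1 / (real m - 1) * real k = - 1" using k by simp
    also have "real n powr (- 1) = 1 / real n" using n0 by (simp add: powr_minus_divide)
    finally have "real n * y n ^ k = 1" using n0 by simp
    then have "\<bar>prob (\<Union>I\<in>{I. I \<subseteq> {1..n} \<and> card I = Suc k}. large (t * y n ^ (2 * Suc k)) I)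
        - (1 - exp (- (near_maximal_const k * sqrt t ^ k / fact (Suc k))))\<bar> \<le> K * y n"
      using elim k n0 by (intro K(2)) (auto simp: y_def)
    then show ?case
      unfolding P_eq[OF elim(1)] L_def near_maximal_const_eq[OF k assms(5)] .
  qed
  then have bigo: "(\<lambda>n. \<bar>P n - L\<bar>) \<in> O(y)"
    by (intro bigoI[of _ K]) (auto elim!: eventually_mono simp: y_def)
  have "(\<lambda>n. P n - L) \<longlonglongrightarrow> 0"
  proof (rule Lim_null_comparison)
    show "eventually (\<lambda>n. norm (P n - L) \<le> K * y n) sequentially" using bound by simp
    show "(\<lambda>n. K * y n) \<longlonglongrightarrow> 0" using tendsto_mult_right_zero[OF y_lim] .
  qed
  then have "P \<longlonglongrightarrow> L" by (rule LIM_zero_cancel)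
  with bigo show ?thesis
    unfolding Let_def P_def[symmetric] L_def[symmetric] y_def by simp
qed

end
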